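(* Let $R\in(0,\infty)$, $\gamma\in\mathbb{R}$, and $n\in\mathbb{N}$, $n\geq 2$. Put $\lambda_j=j(j+n-2)$, $j\in\mathbb{N}_0$, $$\alpha_{n,\gamma,\lambda_0}=\alpha_{n,\gamma,0}=4^{-1}(n-\gamma)^2,\qquad \alpha_{n,\gamma,\lambda_j}=\frac{\big[4^{-1}(n+\gamma-4)(n-\gamma)+\lambda_j\big]^2}{4^{-1}(n+\gamma-4)^2+\lambda_j},\quad j\in\mathbb{N},$$ and $A_{n,\gamma}=\min_{j\in\mathbb{N}_0}\{\alpha_{n,\gamma,\lambda_j}\}$. Excluding the cases $(i)$ $n=2$, $\gamma=2$ and $(ii)$ $n=3$, $\gamma=1$, the constant $A_{n,\gamma}$ in the (valid) inequality $$\int_{B_n(0;R)} |x|^\gamma|(\Delta f)(x)|^2\, d^nx\geq A_{n,\gamma}\int_{B_n(0;R)}|x|^{\gamma-2}|(\nabla f)(x)|^2\, d^nx,\quad f\in C_0^\infty(B_n(0;R)\backslash\{0\}),$$ is sharp. In particular, (with the same exclusions) the constant $A_{n,\gamma}$ in the inequality $$\int_{\mathbb{R}^n} |x|^\gamma|(\Delta f)(x)|^2\, d^nx\geq A_{n,\gamma}\int_{\mathbb{R}^n}|x|^{\gamma-2}|(\nabla f)(x)|^2\, d^nx,\quad f\in C_0^\infty(\mathbb{R}^n\backslash\{0\}),$$ is sharp.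
   Context: $\mathbb{N}=\{1,2,\dots\}$, $\mathbb{N}_0=\mathbb{N}\cup\{0\}$. $B_n(0;R)$ is the open ball in $\mathbb{R}^n$ of radius $R$ centered at the origin. For an open set $U$, $C_0^\infty(U)$ denotes the complex-valued infinitely differentiable functions with compact support contained in $U$. "Sharp" means that $A_{n,\gamma}$ is the largest constant for which the inequality holds for all $f$ in the indicated function space, i.e. the inequality fails for some such $f$ if $A_{n,\gamma}$ is replaced by any strictly larger constant. *)

theory Defs
  imports "HOL-Analysis.Analysis"
begin

definition partial_deriv :: "'n::finite \<Rightarrow> (real^'n \<Rightarrow> complex) \<Rightarrow> real^'n \<Rightarrow> complex" where
  "partial_deriv i f x = frechet_derivative f (at x) (axis i 1)"

definition grad :: "(real^'n::finite \<Rightarrow> complex) \<Rightarrow> real^'n \<Rightarrow> complex^'n" where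
  "grad f x = (\<chi> i. partial_deriv i f x)"

definition laplacian :: "(real^'n::finite \<Rightarrow> complex) \<Rightarrow> real^'n \<Rightarrow> complex" where
  "laplacian f x = (\<Sum>i\<in>UNIV. partial_deriv i (partial_deriv i f) x)"

primrec C_k :: "nat \<Rightarrow> (real^'n::finite \<Rightarrow> complex) \<Rightarrow> bool" where
  "C_k 0 f \<longleftrightarrow> continuous_on UNIV f"
| "C_k (Suc k) f \<longleftrightarrow> f differentiable_on UNIV \<and> (\<forall>i. C_k k (partial_deriv i f))"

text \<open>For open $U$, elements of $C_0^\infty(U)$ are represented by their extensions by zero to the whole space,
  which are again smooth because the support is a compact subset of the open set $U$.\<close>

definition C0_infinity :: "(real^'n::finite) set \<Rightarrow> (real^'n \<Rightarrow> complex) set" where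
  "C0_infinity U = {f. (\<forall>k. C_k k f) \<and> compact (closure {x. f x \<noteq> 0}) \<and> closure {x. f x \<noteq> 0} \<subseteq> U}"

definition lam :: "nat \<Rightarrow> nat \<Rightarrow> real" where
  "lam n j = real j * (real j + real n - 2)"

definition alpha :: "nat \<Rightarrow> real \<Rightarrow> nat \<Rightarrow> real" where
  "alpha n \<gamma> j =
    (if j = 0 then (real n - \<gamma>)\<^sup>2 / 4
     else ((real n + \<gamma> - 4) * (real n - \<gamma>) / 4 + lam n j)\<^sup>2 / ((real n + \<gamma> - 4)\<^sup>2 / 4 + lam n j))"

definition A_const :: "nat \<Rightarrow> real \<Rightarrow> real" where
  "A_const n \<gamma> = (LEAST a. a \<in> range (alpha n \<gamma>))"

text \<open>The minimum over the infinite index set exists, since the sequence tends to infinity.\<close>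

lemma A_const_attained_least:
  "A_const n \<gamma> \<in> range (alpha n \<gamma>)" "A_const n \<gamma> \<le> alpha n \<gamma> j"
proof -
  define b c where "b = (real n + \<gamma> - 4) * (real n - \<gamma>) / 4" and "c = (real n + \<gamma> - 4)\<^sup>2 / 4"
  define N where "N = nat \<lceil>2 * \<bar>b\<bar> + c + 8 * alpha n \<gamma> 0\<rceil> + 3"
  have c: "c \<ge> 0" and a0: "alpha n \<gamma> 0 \<ge> 0"
    by (simp_all add: c_def alpha_def)
  have N: "alpha n \<gamma> 0 \<le> alpha n \<gamma> j" if "j \<ge> N" for j
  proof -
    define L where "L = lam n j"
    have j3: "j \<ge> 3" using that by (simp add: N_def)
    have "2 * \<bar>b\<bar> + c + 8 * alpha n \<gamma> 0 \<le> real N"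
      unfolding N_def by linarith
    moreover have "real N \<le> real j" using that by simp
    moreover have jL: "real j * 1 \<le> L"
      unfolding L_def lam_def using j3 by (intro mult_left_mono) auto
    ultimately have L: "2 * \<bar>b\<bar> + c + 8 * alpha n \<gamma> 0 \<le> L" by linarith
    have Lpos: "L > 0" using jL j3 by linarith
    have "alpha n \<gamma> 0 * (c + L) \<le> L / 8 * (2 * L)"
      using L a0 c Lpos by (intro mult_mono) linarith+
    also have "\<dots> = (L / 2)\<^sup>2" by (simp add: power2_eq_square)
    also have "\<dots> \<le> (b + L)\<^sup>2"
      using L a0 c Lpos by (intro power_mono) linarith+
    finally have "alpha n \<gamma> 0 \<le> (b + L)\<^sup>2 / (c + L)"
      using c Lpos by (simp add: pos_le_divide_eq)
    also have "\<dots> = alpha n \<gamma> j"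
      using j3 unfolding alpha_def b_def c_def L_def by simp
    finally show ?thesis .
  qed
  define a where "a = Min (alpha n \<gamma> ` {..N})"
  have "a \<in> alpha n \<gamma> ` {..N}"
    unfolding a_def by (rule Min_in) simp_all
  then have a1: "a \<in> range (alpha n \<gamma>)" by (rule subsetD[OF image_mono[OF subset_UNIV]])
  have a2: "a \<le> alpha n \<gamma> j" for j
  proof (cases "j \<le> N")
    case False
    have "a \<le> alpha n \<gamma> 0" unfolding a_def by (rule Min_le) auto
    also have "\<dots> \<le> alpha n \<gamma> j" using N[of j] False by simp
    finally show ?thesis .
  qed (auto simp: a_def)
  have "A_const n \<gamma> = a"
    unfolding A_const_def by (rule Least_equality, rule a1, metis a2 imageE)
  then show "A_const n \<gamma> \<in> range (alpha n \<gamma>)" "A_const n \<gamma> \<le> alpha n \<gamma> j"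
    using a1 a2[of j] by (simp_all only:)
qed

text \<open>The convention \<open>0 powr \<gamma> = 0\<close> is immaterial below, since all admissible functions vanish near
  the origin; for the same reason both integrands are continuous with compact support.\<close>

definition rellich_hardy_ineq :: "(real^'n::finite) set \<Rightarrow> real \<Rightarrow> real \<Rightarrow> (real^'n \<Rightarrow> complex) \<Rightarrow> bool" where
  "rellich_hardy_ineq U \<gamma> C f \<longleftrightarrow>
    (LINT x:U|lborel. norm x powr \<gamma> * (norm (laplacian f x))\<^sup>2)
      \<ge> C * (LINT x:U|lborel. norm x powr (\<gamma> - 2) * (norm (grad f x))\<^sup>2)"

definition sharp_rellich_hardy_const :: "(real^'n::finite) set \<Rightarrow> real \<Rightarrow> real \<Rightarrow> bool" where
  "sharp_rellich_hardy_const U \<gamma> C \<longleftrightarrow>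
    (\<forall>f \<in> C0_infinity (U - {0}). rellich_hardy_ineq U \<gamma> C f) \<and>
    (\<forall>C' > C. \<exists>f \<in> C0_infinity (U - {0}). \<not> rellich_hardy_ineq U \<gamma> C' f)"

end

theory Submission
  imports Defs
begin

text \<open>
  Put \<open>a = (n + \<gamma> - 4)/2\<close>, \<open>b = (n - \<gamma>)/2\<close>, \<open>f = |x|\<^sup>-\<^sup>a F\<close>, and work in \<open>L\<^sup>2(|x|\<^sup>-\<^sup>n dx)\<close>. The Euler field \<open>E\<close> and the
  rotation fields \<open>L\<^sub>i\<^sub>j\<close> are antisymmetric there and commute, and the spherical Laplacian
  \<open>\<Lambda> = - 1/2 \<Sum> L\<^sub>i\<^sub>j\<^sup>2 = E\<^sup>2 + (n - 2) E - |x|\<^sup>2 \<Delta>\<close> is symmetric, nonnegative and commutes with \<open>E\<close>. Expanding the squares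
  expresses the difference of both sides of the inequality with constant \<open>C\<close> as
  \<open>\<parallel>(\<Lambda> + a b) F\<parallel>\<^sup>2 - C \<langle>(a\<^sup>2 + \<Lambda>) F, F\<rangle> + (a\<^sup>2 + b\<^sup>2 - C) \<parallel>E F\<parallel>\<^sup>2 + 2 \<langle>\<Lambda> E F, E F\<rangle> + \<parallel>E\<^sup>2 F\<parallel>\<^sup>2\<close>.
  For \<open>C = A\<close> the last three terms are nonnegative because \<open>A \<le> b\<^sup>2\<close>; the first two are a quadratic
  polynomial in \<open>\<Lambda>\<close> that is nonnegative at every \<open>\<lambda>\<^sub>j\<close>, and finite sums of eigenfunctions of \<open>\<Lambda>\<close> are dense
  in its graph norm. For sharpness take for \<open>F\<close> a spherical harmonic of the minimizing degree times
  a function of \<open>ln |x|\<close> that is stretched until the terms with \<open>E\<close> become negligible.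
\<close>

section \<open>Smooth functions on punctured space\<close>

text \<open>The power of |x| is chosen so that both weights become |x|^-n dx. This measure is
  dilation invariant, which is why E is antisymmetric and all coefficients are constants. The
  obstacle: (\<lambda> + a b)^2 - A (a^2 + \<lambda>) can be negative between two eigenvalues, so
  \<Lambda> \<ge> 0 is not enough and the discrete spectrum has to enter. This is done without
  integrals over the sphere: eigenfunctions are built from homogeneous polynomials times radial
  bumps, and their density rests on the Stone-Weierstrass theorem. If a = 0, the polynomial vanishes
  at \<lambda> = 0 for every C, and the value b^2 for degree 0 is visible only in the coefficient of
  ||E F||^2. Hence sharpness has a degenerate case, in which ||E^2 F|| must be small against ||E
  F||, not only ||E F|| against ||F||. Every neighbourhood of 0 has infinite mass, which leaves room
  to stretch inside an arbitrarily small ball; so one construction serves all radii and the whole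
  space.\<close>

primrec punctured_C :: "nat \<Rightarrow> (real^'n::finite \<Rightarrow> complex) \<Rightarrow> bool" where
  "punctured_C 0 f \<longleftrightarrow> continuous_on (-{0}) f"
| "punctured_C (Suc k) f \<longleftrightarrow>
     (\<forall>x. x \<noteq> 0 \<longrightarrow> f differentiable (at x)) \<and> (\<forall>i. punctured_C k (partial_deriv i f))"

text \<open>All conditions are placed off the origin because the radial factors |x|^s and functions
  of ln |x| are in general singular there; the value at 0 is left free.\<close>

definition psmooth :: "(real^'n::finite \<Rightarrow> complex) \<Rightarrow> bool" where
  "psmooth f \<longleftrightarrow> (\<forall>k. punctured_C k f)"

text \<open>The derivative of \<open>f\<close> along the vector field \<open>T\<close>. Constant
  fields give partial derivatives, the identity gives the Euler field and \<open>rot\<close> gives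
  rotations, so each rule of calculus is shown once for all three.\<close>

definition dir :: "(real^'n::finite \<Rightarrow> real^'n) \<Rightarrow> (real^'n \<Rightarrow> complex) \<Rightarrow> real^'n \<Rightarrow> complex" where
  "dir T f x = frechet_derivative f (at x) (T x)"

section \<open>Calculus of directional derivatives\<close>

lemma partial_deriv_eq_dir: "partial_deriv i f = dir (\<lambda>_. axis i 1) f"
  by (simp add: fun_eq_iff partial_deriv_def dir_def)

lemma dir_eq:
  assumes "(f has_derivative f') (at x)"
  shows "dir T f x = f' (T x)"
  using frechet_derivative_at[OF assms] by (simp add: dir_def)

lemma dir_expand:
  assumes "f differentiable (at x)"
  shows "dir T f x = (\<Sum>i\<in>UNIV. of_real (T x $ i) * partial_deriv i f x)"
proof -
  have lin: "linear (frechet_derivative f (at x))"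
    using assms by (rule linear_frechet_derivative)
  have "T x = (\<Sum>i\<in>UNIV. (T x $ i) *\<^sub>R axis i 1)"
    by (simp add: basis_expansion scalar_mult_eq_scaleR[symmetric])
  then have "dir T f x = frechet_derivative f (at x) (\<Sum>i\<in>UNIV. (T x $ i) *\<^sub>R axis i 1)"
    by (simp add: dir_def)
  also have "\<dots> = (\<Sum>i\<in>UNIV. (T x $ i) *\<^sub>R frechet_derivative f (at x) (axis i 1))"
    using lin by (simp add: linear_sum linear_cmul)
  finally show ?thesis by (simp add: partial_deriv_def scaleR_conv_of_real)
qed

lemma dir_cong_open:
  assumes "open S" "x \<in> S" "\<And>y. y \<in> S \<Longrightarrow> f y = g y"
  shows "dir T f x = dir T g x"
proof -
  \<comment> \<open>\<open>frechet_derivative\<close> selects some derivative, so equal sets of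
    derivatives yield the same selection even where \<open>f\<close> is not differentiable.\<close>
  have "(f has_derivative f') (at x) \<longleftrightarrow> (g has_derivative f') (at x)" for f'
    using assms by (metis has_derivative_transform_within_open)
  then show ?thesis by (simp add: dir_def frechet_derivative_def)
qed

lemma dir_cong:
  assumes "\<And>y. y \<noteq> 0 \<Longrightarrow> f y = g y" "x \<noteq> 0"
  shows "dir T f x = dir T g x"
  by (rule dir_cong_open[of "-{0}"]) (use assms in auto)

lemma dir_zero_open:
  assumes "open S" "x \<in> S" "\<And>y. y \<in> S \<Longrightarrow> f y = 0"
  shows "dir T f x = 0"
proof -
  have "dir T f x = dir T (\<lambda>_. 0) x" using assms by (rule dir_cong_open)
  then show ?thesis by (simp add: dir_def)
qed

lemma dir_const [simp]: "dir T (\<lambda>_. c) = (\<lambda>_. 0)"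
  by (simp add: fun_eq_iff dir_def)

lemma dir_add:
  assumes "f differentiable (at x)" "g differentiable (at x)"
  shows "dir T (\<lambda>y. f y + g y) x = dir T f x + dir T g x"
  using assms by (subst dir_eq[OF has_derivative_add]) (auto simp: dir_def frechet_derivative_works)

lemma dir_diff:
  assumes "f differentiable (at x)" "g differentiable (at x)"
  shows "dir T (\<lambda>y. f y - g y) x = dir T f x - dir T g x"
  using assms by (subst dir_eq[OF has_derivative_diff]) (auto simp: dir_def frechet_derivative_works)

lemma dir_mult:
  assumes "f differentiable (at x)" "g differentiable (at x)"
  shows "dir T (\<lambda>y. f y * g y) x = dir T f x * g x + f x * dir T g x"
  using assms by (subst dir_eq[OF has_derivative_mult]) (auto simp: dir_def frechet_derivative_works)

lemma dir_sum:
  assumes "\<And>i. i \<in> I \<Longrightarrow> f i differentiable (at x)"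
  shows "dir T (\<lambda>y. \<Sum>i\<in>I. f i y) x = (\<Sum>i\<in>I. dir T (f i) x)"
  using assms by (subst dir_eq[OF has_derivative_sum]) (auto simp: dir_def frechet_derivative_works)

lemma dir_cmult:
  assumes "f differentiable (at x)"
  shows "dir T (\<lambda>y. c * f y) x = c * dir T f x"
  using dir_mult[OF differentiable_const assms] by simp

lemma dir_cnj:
  assumes "f differentiable (at x)"
  shows "dir T (\<lambda>y. cnj (f y)) x = cnj (dir T f x)"
  using assms by (subst dir_eq[OF bounded_linear.has_derivative[OF bounded_linear_cnj]])
    (auto simp: dir_def frechet_derivative_works)

lemma differentiable_cong_open:
  assumes "open S" "x \<in> S" "\<And>y. y \<in> S \<Longrightarrow> f y = g y" "f differentiable (at x)"
  shows "g differentiable (at x)"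
  using assms unfolding differentiable_def by (metis has_derivative_transform_within_open)

section \<open>Closure properties of smoothness off the origin\<close>

lemma partial_deriv_cong:
  assumes "\<And>y. y \<noteq> 0 \<Longrightarrow> f y = g y" "x \<noteq> 0"
  shows "partial_deriv i f x = partial_deriv i g x"
  unfolding partial_deriv_eq_dir using assms by (rule dir_cong)

lemma punctured_C_cong:
  assumes "\<And>x. x \<noteq> 0 \<Longrightarrow> f x = g x" "punctured_C k f"
  shows "punctured_C k g"
  using assms
proof (induction k arbitrary: f g)
  case 0
  then show ?case by (metis punctured_C.simps(1) continuous_on_eq ComplD singletonI)
next
  case (Suc k)
  have "g differentiable (at x)" if "x \<noteq> 0" for x
    using that Suc.prems by (intro differentiable_cong_open[of "-{0}" x f g]) auto
  moreover have "punctured_C k (partial_deriv i g)" for i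
    by (rule Suc.IH[of "partial_deriv i f"]) (use Suc.prems in \<open>auto intro!: partial_deriv_cong\<close>)
  ultimately show ?case by simp
qed

lemma punctured_C_SucD: "punctured_C (Suc k) f \<Longrightarrow> punctured_C k f"
proof (induction k arbitrary: f)
  case 0
  then show ?case
    by (auto intro!: continuous_at_imp_continuous_on differentiable_imp_continuous_within)
qed auto

lemma punctured_C_add:
  "punctured_C k f \<Longrightarrow> punctured_C k g \<Longrightarrow> punctured_C k (\<lambda>x. f x + g x)"
proof (induction k arbitrary: f g)
  case (Suc k)
  have "punctured_C k (partial_deriv i (\<lambda>x. f x + g x))" for i
    by (rule punctured_C_cong[OF _ Suc.IH[of "partial_deriv i f" "partial_deriv i g"]])
      (use Suc.prems in \<open>auto simp: partial_deriv_eq_dir dir_add\<close>)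
  then show ?case using Suc.prems by auto
qed (auto intro!: continuous_intros)

lemma punctured_C_mult:
  "punctured_C k f \<Longrightarrow> punctured_C k g \<Longrightarrow> punctured_C k (\<lambda>x. f x * g x)"
proof (induction k arbitrary: f g)
  case (Suc k)
  have "punctured_C k (\<lambda>x. partial_deriv i f x * g x + f x * partial_deriv i g x)" for i
    using Suc.prems punctured_C_SucD[of k f] punctured_C_SucD[of k g]
    by (intro punctured_C_add Suc.IH) auto
  then have "punctured_C k (partial_deriv i (\<lambda>x. f x * g x))" for i
    by (rule punctured_C_cong[rotated])
      (use Suc.prems in \<open>auto simp: partial_deriv_eq_dir dir_mult\<close>)
  then show ?case using Suc.prems by auto
qed (auto intro!: continuous_intros)

lemma punctured_C_cnj: "punctured_C k f \<Longrightarrow> punctured_C k (\<lambda>x. cnj (f x))"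
proof (induction k arbitrary: f)
  case (Suc k)
  have "punctured_C k (partial_deriv i (\<lambda>x. cnj (f x)))" for i
    by (rule punctured_C_cong[OF _ Suc.IH[of "partial_deriv i f"]])
      (use Suc.prems in \<open>auto simp: partial_deriv_eq_dir dir_cnj\<close>)
  moreover have "(\<lambda>x. cnj (f x)) differentiable (at x)" if "x \<noteq> 0" for x
    using Suc.prems that bounded_linear.has_derivative[OF bounded_linear_cnj]
    unfolding differentiable_def punctured_C.simps by blast
  ultimately show ?case by auto
qed (auto intro!: continuous_intros)

lemma psmooth_differentiable [intro]: "psmooth f \<Longrightarrow> x \<noteq> 0 \<Longrightarrow> f differentiable (at x)"
  unfolding psmooth_def by (metis punctured_C.simps(2))

lemma psmooth_continuous_on: "psmooth f \<Longrightarrow> continuous_on (-{0}) f"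
  unfolding psmooth_def by (metis punctured_C.simps(1))

lemma psmooth_cong: "psmooth f \<Longrightarrow> (\<And>x. x \<noteq> 0 \<Longrightarrow> f x = g x) \<Longrightarrow> psmooth g"
  unfolding psmooth_def using punctured_C_cong by blast

lemma psmooth_partial_deriv [intro]: "psmooth f \<Longrightarrow> psmooth (partial_deriv i f)"
  unfolding psmooth_def by (metis punctured_C.simps(2))

lemma psmoothI:
  assumes "\<And>x. x \<noteq> 0 \<Longrightarrow> f differentiable (at x)" "\<And>i. psmooth (partial_deriv i f)"
  shows "psmooth f"
  unfolding psmooth_def
proof
  fix k
  have "punctured_C (Suc k) f" using assms by (auto simp: psmooth_def)
  then show "punctured_C k f" by (rule punctured_C_SucD)
qed

lemma psmooth_const [intro!, simp]: "psmooth (\<lambda>_::real^'n::finite. c)"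
proof -
  have "punctured_C k (\<lambda>_::real^'n. c)" for k
  proof (induction k arbitrary: c)
    case (Suc k)
    have "partial_deriv i (\<lambda>_::real^'n. c) = (\<lambda>_. 0)" for i by (simp add: fun_eq_iff partial_deriv_def)
    then show ?case using Suc by simp
  qed auto
  then show ?thesis by (simp add: psmooth_def)
qed

lemma psmooth_add [intro!]: "psmooth f \<Longrightarrow> psmooth g \<Longrightarrow> psmooth (\<lambda>x. f x + g x)"
  by (simp add: psmooth_def punctured_C_add)

lemma psmooth_mult [intro!]: "psmooth f \<Longrightarrow> psmooth g \<Longrightarrow> psmooth (\<lambda>x. f x * g x)"
  by (simp add: psmooth_def punctured_C_mult)

lemma psmooth_cnj [intro!]: "psmooth f \<Longrightarrow> psmooth (\<lambda>x. cnj (f x))"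
  by (simp add: psmooth_def punctured_C_cnj)

lemma psmooth_minus [intro!]: "psmooth f \<Longrightarrow> psmooth (\<lambda>x. - f x)"
  using psmooth_mult[OF psmooth_const[of "-1"]] by simp

lemma psmooth_diff [intro!]: "psmooth f \<Longrightarrow> psmooth g \<Longrightarrow> psmooth (\<lambda>x. f x - g x)"
  using psmooth_add[of f "\<lambda>x. - g x"] by auto

lemma psmooth_sum [intro!]: "(\<And>i. i \<in> I \<Longrightarrow> psmooth (f i)) \<Longrightarrow> psmooth (\<lambda>x. \<Sum>i\<in>I. f i x)"
  by (induction I rule: infinite_finite_induct) auto

lemma psmooth_power [intro!]: "psmooth f \<Longrightarrow> psmooth (\<lambda>x. f x ^ m)"
  by (induction m) auto

lemma has_derivative_coord:
  "((\<lambda>x::real^'n::finite. complex_of_real (x $ j)) has_derivative (\<lambda>h. of_real (h $ j))) (at x)"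
  by (auto intro!: derivative_eq_intros bounded_linear_imp_has_derivative bounded_linear_compose[OF bounded_linear_of_real] bounded_linear_vec_nth)

lemma dir_coord [simp]: "dir T (\<lambda>x. complex_of_real (x $ j)) x = of_real (T x $ j)"
  using dir_eq[OF has_derivative_coord] .

lemma psmooth_coord [intro!, simp]: "psmooth (\<lambda>x::real^'n::finite. complex_of_real (x $ j))"
proof (rule psmoothI)
  show "(\<lambda>x. complex_of_real (x $ j)) differentiable (at x)" for x :: "real^'n"
    using has_derivative_coord unfolding differentiable_def by blast
  have "partial_deriv i (\<lambda>x::real^'n. complex_of_real (x $ j)) = (\<lambda>_. of_real (axis i 1 $ j))" for i
    unfolding partial_deriv_eq_dir by (rule ext) (rule dir_coord)
  then show "psmooth (partial_deriv i (\<lambda>x::real^'n. complex_of_real (x $ j)))" for i by simp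
qed

lemma psmooth_dir [intro]:
  assumes "psmooth f" "\<And>i. psmooth (\<lambda>x. of_real (T x $ i))"
  shows "psmooth (dir T f)"
proof (rule psmooth_cong)
  show "psmooth (\<lambda>x. \<Sum>i\<in>UNIV. of_real (T x $ i) * partial_deriv i f x)"
    using assms by auto
qed (use assms in \<open>auto simp: dir_expand psmooth_differentiable\<close>)

subsection \<open>Radial functions\<close>

definition rpow :: "real \<Rightarrow> real^'n::finite \<Rightarrow> complex" where
  "rpow s x = of_real (norm x powr s)"

lemma rpow_add: "rpow s x * rpow t x = rpow (s + t) x"
  by (simp add: rpow_def powr_add)

lemma rpow_0: "x \<noteq> 0 \<Longrightarrow> rpow 0 x = 1"
  by (simp add: rpow_def)

lemma rpow_2: "rpow 2 x = of_real (x \<bullet> x)"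
  by (simp add: rpow_def powr_numeral power2_norm_eq_inner)

lemma has_derivative_norm_vec:
  "x \<noteq> (0::real^'n::finite) \<Longrightarrow> (norm has_derivative (\<lambda>h. (x \<bullet> h) / norm x)) (at x)"
  using GDERIV_norm[of x] by (simp add: gderiv_def sgn_div_norm inner_commute divide_inverse mult.commute)

lemma has_derivative_rpow:
  assumes "x \<noteq> (0::real^'n::finite)"
  shows "(rpow s has_derivative (\<lambda>h. of_real (s * (x \<bullet> h)) * rpow (s - 2) x)) (at x)"
proof -
  have "((\<lambda>x. norm x powr s) has_derivative (\<lambda>h. (s * (x \<bullet> h)) * norm x powr (s - 2))) (at x)"
    using assms
    by (auto intro!: derivative_eq_intros has_derivative_norm_vec
        simp: fun_eq_iff inner_commute sgn_div_norm powr_diff powr_numeral power2_eq_square field_simps)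
  then have "((\<lambda>x. complex_of_real (norm x powr s)) has_derivative (\<lambda>h. of_real ((s * (x \<bullet> h)) * norm x powr (s - 2)))) (at x)"
    by (rule bounded_linear.has_derivative[OF bounded_linear_of_real])
  then show ?thesis by (simp add: rpow_def[abs_def])
qed

lemma dir_rpow: "x \<noteq> 0 \<Longrightarrow> dir T (rpow s) x = of_real (s * (x \<bullet> T x)) * rpow (s - 2) x"
  by (rule dir_eq[OF has_derivative_rpow])

text \<open>The induction treats all exponents at once, because differentiation turns
  \<open>rpow s\<close> into a multiple of a coordinate times \<open>rpow (s - 2)\<close>.\<close>

lemma psmooth_rpow [intro!, simp]: "psmooth (rpow s :: real^'n::finite \<Rightarrow> complex)"
proof -
  have "punctured_C k (rpow s :: real^'n::finite \<Rightarrow> complex)" for k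
  proof (induction k arbitrary: s)
    case 0
    show ?case using has_derivative_rpow 
      by (auto intro!: continuous_at_imp_continuous_on has_derivative_continuous)
  next
    case (Suc k)
    have "punctured_C k (partial_deriv i (rpow s :: real^'n::finite \<Rightarrow> complex))" for i
    proof (rule punctured_C_cong)
      have "punctured_C k (\<lambda>x::real^'n. complex_of_real (x $ i))" using psmooth_coord[of i] unfolding psmooth_def by blast
      moreover have "punctured_C k (\<lambda>x::real^'n. complex_of_real s)" using psmooth_const unfolding psmooth_def by blast
      ultimately show "punctured_C k (\<lambda>x::real^'n. of_real s * (of_real (x $ i) * rpow (s - 2) x))"
        by (intro punctured_C_mult Suc)
    qed (simp add: partial_deriv_eq_dir dir_rpow inner_axis)
    then show ?case using has_derivative_rpow unfolding punctured_C.simps differentiable_def by blast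
  qed
  then show ?thesis by (simp add: psmooth_def)
qed

lemma has_derivative_ln_norm:
  assumes "x \<noteq> (0::real^'n::finite)"
  shows "((\<lambda>x. complex_of_real (ln (norm x))) has_derivative (\<lambda>h. of_real (x \<bullet> h) * rpow (- 2) x)) (at x)"
proof -
  have "((\<lambda>x. ln (norm x)) has_derivative (\<lambda>h. (x \<bullet> h) * norm x powr (- 2))) (at x)"
    using assms
    by (auto intro!: derivative_eq_intros has_derivative_norm_vec
        simp: fun_eq_iff inner_commute sgn_div_norm powr_minus powr_numeral power2_eq_square field_simps)
  then have "((\<lambda>x. complex_of_real (ln (norm x))) has_derivative (\<lambda>h. of_real ((x \<bullet> h) * norm x powr (- 2)))) (at x)"
    by (rule bounded_linear.has_derivative[OF bounded_linear_of_real])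
  then show ?thesis by (simp add: rpow_def[abs_def])
qed

lemma dir_ln_norm: "x \<noteq> 0 \<Longrightarrow> dir T (\<lambda>x. of_real (ln (norm x))) x = of_real (x \<bullet> T x) * rpow (- 2) x"
  by (rule dir_eq[OF has_derivative_ln_norm])

lemma psmooth_ln_norm [intro!, simp]: "psmooth (\<lambda>x::real^'n::finite. of_real (ln (norm x)))"
proof (rule psmoothI)
  show "(\<lambda>x::real^'n. complex_of_real (ln (norm x))) differentiable (at x)" if "x \<noteq> 0" for x :: "real^'n"
    using has_derivative_ln_norm[OF that] unfolding differentiable_def by blast
  show "psmooth (partial_deriv i (\<lambda>x::real^'n. complex_of_real (ln (norm x))))" for i
    by (rule psmooth_cong[of "\<lambda>x. of_real (x $ i) * rpow (- 2) x"])
      (auto simp: partial_deriv_eq_dir dir_ln_norm inner_axis)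
qed

section \<open>Symmetry of second derivatives\<close>

text \<open>Mean value inequality for \<open>f\<close> minus its expected linear growth with slope
  \<open>c\<close>. It serves twice: for mixed second differences, and with \<open>c = 0\<close> to
  bound difference quotients uniformly.\<close>

lemma norm_diff_le_along_segment:
  fixes f :: "real^'n::finite \<Rightarrow> complex"
  assumes "h > 0" "\<And>t. 0 \<le> t \<Longrightarrow> t \<le> h \<Longrightarrow> f differentiable (at (x + t *\<^sub>R v))"
    and "\<And>t. 0 \<le> t \<Longrightarrow> t \<le> h \<Longrightarrow> norm (dir (\<lambda>_. v) f (x + t *\<^sub>R v) - c) \<le> B"
  shows "norm (f (x + h *\<^sub>R v) - f x - h *\<^sub>R c) \<le> B * h"
proof -
  define g where "g t = f (x + t *\<^sub>R v) - t *\<^sub>R c" for t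
  have der: "(g has_derivative (\<lambda>s. s *\<^sub>R (dir (\<lambda>_. v) f (x + t *\<^sub>R v) - c))) (at t)" if "0 \<le> t" "t \<le> h" for t
  proof -
    have D: "(f has_derivative frechet_derivative f (at (x + t *\<^sub>R v))) (at (x + t *\<^sub>R v))"
      using assms(2)[OF that] by (simp add: frechet_derivative_works)
    have "((\<lambda>t. f (x + t *\<^sub>R v)) has_derivative (\<lambda>s. frechet_derivative f (at (x + t *\<^sub>R v)) (s *\<^sub>R v))) (at t)"
      by (rule has_derivative_compose[where f="\<lambda>t. x + t *\<^sub>R v" and g=f, OF _ D]) (auto intro!: derivative_eq_intros)
    then have "(g has_derivative (\<lambda>s. frechet_derivative f (at (x + t *\<^sub>R v)) (s *\<^sub>R v) - s *\<^sub>R c)) (at t)"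
      unfolding g_def by (auto intro!: derivative_eq_intros)
    then show ?thesis
      using linear_cmul[OF has_derivative_linear[OF D]] by (simp add: dir_def algebra_simps)
  qed
  have "continuous_on {0..h} g"
    using der by (auto intro!: continuous_at_imp_continuous_on has_derivative_continuous)
  then have "\<exists>t\<in>{0<..<h}. norm (g h - g 0) \<le> norm ((h - 0) *\<^sub>R (dir (\<lambda>_. v) f (x + t *\<^sub>R v) - c))"
    by (rule mvt_general[OF assms(1)]) (simp add: der)
  then obtain t where t: "0 < t" "t < h" "norm (g h - g 0) \<le> norm ((h - 0) *\<^sub>R (dir (\<lambda>_. v) f (x + t *\<^sub>R v) - c))"
    by auto
  note t(3)
  also have "\<dots> \<le> h * B"
    using assms(1) assms(3)[of t] t by (simp add: mult_left_mono)
  finally show ?thesis by (simp add: g_def mult.commute algebra_simps)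
qed

text \<open>The mean value estimate is applied twice: along the i-axis to the increment of
  \<open>f\<close> in direction j, whose i-derivative is an increment of
  \<open>partial_deriv i f\<close>, and then along the j-axis to that increment.\<close>

lemma second_difference_approx:
  fixes f :: "real^'n::finite \<Rightarrow> complex"
  assumes f: "psmooth f" and x: "x \<noteq> 0" and \<epsilon>: "\<epsilon> > 0"
  shows "\<exists>d>0. \<forall>h. 0 < h \<and> h < d \<longrightarrow>
    norm (f (x + h *\<^sub>R axis i 1 + h *\<^sub>R axis j 1) - f (x + h *\<^sub>R axis i 1) - f (x + h *\<^sub>R axis j 1) + f x
      - (h * h) *\<^sub>R partial_deriv j (partial_deriv i f) x) \<le> \<epsilon> * h * h"
proof -
  let ?u = "axis i (1::real) :: real^'n" and ?v = "axis j (1::real) :: real^'n"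
  define c where "c = partial_deriv j (partial_deriv i f) x"
  have "isCont (partial_deriv j (partial_deriv i f)) x"
    using f x psmooth_continuous_on[of "partial_deriv j (partial_deriv i f)"]
    by (metis Compl_iff continuous_on_eq_continuous_at open_Compl closed_singleton psmooth_partial_deriv singletonD)
  then obtain e where e: "e > 0" "\<And>y. dist y x < e \<Longrightarrow> dist (partial_deriv j (partial_deriv i f) y) c < \<epsilon>"
    unfolding continuous_at_eps_delta c_def using \<epsilon> by metis
  \<comment> \<open>Points of the square with side \<open>d\<close> are at distance below
    \<open>2 * d\<close> from \<open>x\<close>, hence inside the continuity radius and away from
    0.\<close>
  define d where "d = min e (norm x) / 2"
  have d: "d > 0" using e x by (simp add: d_def)
  have close: "dist (x + s *\<^sub>R ?u + t *\<^sub>R ?v) x < min e (norm x)" if "0 \<le> s" "s < d" "0 \<le> t" "t < d" for s t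
  proof -
    have "dist (x + s *\<^sub>R ?u + t *\<^sub>R ?v) x = norm (s *\<^sub>R ?u + t *\<^sub>R ?v)" by (simp add: dist_norm algebra_simps)
    also have "\<dots> \<le> norm (s *\<^sub>R ?u) + norm (t *\<^sub>R ?v)" by (rule norm_triangle_ineq)
    also have "\<dots> = s + t" using that by (simp add: norm_axis_1)
    also have "\<dots> < min e (norm x)" using that by (simp add: d_def)
    finally show ?thesis .
  qed
  have nz: "x + s *\<^sub>R ?u + t *\<^sub>R ?v \<noteq> 0" if "0 \<le> s" "s < d" "0 \<le> t" "t < d" for s t
    using close[OF that] by (metis dist_0_norm less_irrefl min_less_iff_conj)
  have main: "norm (f (x + h *\<^sub>R ?u + h *\<^sub>R ?v) - f (x + h *\<^sub>R ?u) - f (x + h *\<^sub>R ?v) + f x - (h * h) *\<^sub>R c) \<le> \<epsilon> * h * h"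
    if h: "0 < h" "h < d" for h
  proof -
    define g where "g y = f (y + h *\<^sub>R ?v) - f y" for y
    have shift: "((\<lambda>y. f (y + h *\<^sub>R ?v)) has_derivative frechet_derivative f (at (y + h *\<^sub>R ?v))) (at y)"
      if "y + h *\<^sub>R ?v \<noteq> 0" for y
    proof -
      have "(f has_derivative frechet_derivative f (at (y + h *\<^sub>R ?v))) (at (y + h *\<^sub>R ?v))"
        using f that by (simp add: frechet_derivative_works[symmetric] psmooth_differentiable)
      from has_derivative_compose[where f="\<lambda>y. y + h *\<^sub>R ?v" and f'="\<lambda>h. h" and g=f, OF _ this] show ?thesis
        by (rule meta_mp) (auto intro!: derivative_eq_intros)
    qed
    have gd: "g differentiable (at y)" and gdir: "dir (\<lambda>_. ?u) g y = partial_deriv i f (y + h *\<^sub>R ?v) - partial_deriv i f y"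
      if "y \<noteq> 0" "y + h *\<^sub>R ?v \<noteq> 0" for y
    proof -
      have "(g has_derivative (\<lambda>k. frechet_derivative f (at (y + h *\<^sub>R ?v)) k - frechet_derivative f (at y) k)) (at y)"
        unfolding g_def using f that
        by (intro has_derivative_diff shift) (simp_all add: frechet_derivative_works[symmetric] psmooth_differentiable)
      then show "g differentiable (at y)" "dir (\<lambda>_. ?u) g y = partial_deriv i f (y + h *\<^sub>R ?v) - partial_deriv i f y"
        by (auto simp: differentiable_def dir_eq partial_deriv_def)
    qed
    have "norm (g (x + h *\<^sub>R ?u) - g x - h *\<^sub>R (h *\<^sub>R c)) \<le> (\<epsilon> * h) * h"
    proof (rule norm_diff_le_along_segment)
      fix s assume s: "0 \<le> s" "s \<le> h"
      have y: "x + s *\<^sub>R ?u \<noteq> 0" "x + s *\<^sub>R ?u + h *\<^sub>R ?v \<noteq> 0" using nz[of s 0] nz[of s h] s h by auto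
      show "g differentiable at (x + s *\<^sub>R ?u)" by (rule gd[OF y])
      have "norm (partial_deriv i f (x + s *\<^sub>R ?u + h *\<^sub>R ?v) - partial_deriv i f (x + s *\<^sub>R ?u) - h *\<^sub>R c) \<le> \<epsilon> * h"
      proof (rule norm_diff_le_along_segment)
        fix t assume t: "0 \<le> t" "t \<le> h"
        show "partial_deriv i f differentiable at (x + s *\<^sub>R ?u + t *\<^sub>R ?v)"
          using nz[of s t] s t h f by (intro psmooth_differentiable psmooth_partial_deriv) auto
        show "norm (dir (\<lambda>_. ?v) (partial_deriv i f) (x + s *\<^sub>R ?u + t *\<^sub>R ?v) - c) \<le> \<epsilon>"
          using e(2)[of "x + s *\<^sub>R ?u + t *\<^sub>R ?v"] close[of s t] s t h
          by (simp add: partial_deriv_eq_dir[symmetric] dist_norm)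
      qed (use h in auto)
      then show "norm (dir (\<lambda>_. ?u) g (x + s *\<^sub>R ?u) - h *\<^sub>R c) \<le> \<epsilon> * h" by (simp add: gdir[OF y])
    qed (use h in auto)
    then show ?thesis by (simp add: g_def algebra_simps)
  qed
  show ?thesis using d main unfolding c_def by blast
qed

text \<open>Schwarz's theorem: the mixed second difference does not change when the two directions
  are swapped, and divided by h^2 it approximates either iterated derivative.\<close>

lemma partial_deriv_commute:
  assumes f: "psmooth f" and x: "x \<noteq> 0"
  shows "partial_deriv i (partial_deriv j f) x = partial_deriv j (partial_deriv i f) x"
proof (rule ccontr)
  assume ne: "\<not> ?thesis"
  define \<delta> where "\<delta> = partial_deriv i (partial_deriv j f) x - partial_deriv j (partial_deriv i f) x"
  \<comment> \<open>Two errors of relative size \<epsilon> will give norm \<delta> \<le> 2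
    \<epsilon>, which a third of norm \<delta> contradicts.\<close>
  define \<epsilon> where "\<epsilon> = norm \<delta> / 3"
  have \<epsilon>: "\<epsilon> > 0" using ne by (simp add: \<epsilon>_def \<delta>_def)
  let ?u = "axis i (1::real)" and ?v = "axis j (1::real)"
  obtain d1 where d1: "d1 > 0" "\<And>h. 0 < h \<Longrightarrow> h < d1 \<Longrightarrow>
      norm (f (x + h *\<^sub>R ?u + h *\<^sub>R ?v) - f (x + h *\<^sub>R ?u) - f (x + h *\<^sub>R ?v) + f x
      - (h * h) *\<^sub>R partial_deriv j (partial_deriv i f) x) \<le> \<epsilon> * h * h"
    using second_difference_approx[OF f x \<epsilon>, of i j] by blast
  obtain d2 where d2: "d2 > 0" "\<And>h. 0 < h \<Longrightarrow> h < d2 \<Longrightarrow>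
      norm (f (x + h *\<^sub>R ?v + h *\<^sub>R ?u) - f (x + h *\<^sub>R ?v) - f (x + h *\<^sub>R ?u) + f x
      - (h * h) *\<^sub>R partial_deriv i (partial_deriv j f) x) \<le> \<epsilon> * h * h"
    using second_difference_approx[OF f x \<epsilon>, of j i] by blast
  define h where "h = min d1 d2 / 2"
  have h: "0 < h" "h < d1" "h < d2" using d1(1) d2(1) by (auto simp: h_def)
  define S where "S = f (x + h *\<^sub>R ?u + h *\<^sub>R ?v) - f (x + h *\<^sub>R ?u) - f (x + h *\<^sub>R ?v) + f x"
  have 1: "norm (S - (h * h) *\<^sub>R partial_deriv j (partial_deriv i f) x) \<le> \<epsilon> * h * h"
    using d1(2)[OF h(1,2)] by (simp add: S_def)
  have "f (x + h *\<^sub>R ?v + h *\<^sub>R ?u) - f (x + h *\<^sub>R ?v) - f (x + h *\<^sub>R ?u) + f x = S"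
    by (simp add: S_def add_ac)
  then have 2: "norm (S - (h * h) *\<^sub>R partial_deriv i (partial_deriv j f) x) \<le> \<epsilon> * h * h"
    using d2(2)[OF h(1,3)] by simp
  have "(h * h) * norm \<delta> = norm ((S - (h * h) *\<^sub>R partial_deriv j (partial_deriv i f) x) -
      (S - (h * h) *\<^sub>R partial_deriv i (partial_deriv j f) x))"
    by (simp add: \<delta>_def scaleR_diff_right[symmetric] abs_mult)
  also have "\<dots> \<le> \<epsilon> * h * h + \<epsilon> * h * h"
    using norm_triangle_ineq4 1 2 by (meson add_mono order_trans)
  finally have "(h * h) * norm \<delta> \<le> (h * h) * (2 * \<epsilon>)" by (simp add: algebra_simps)
  then have "norm \<delta> \<le> 2 * \<epsilon>" using h by simp
  then show False using \<epsilon> by (simp add: \<epsilon>_def)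
qed

section \<open>Test functions\<close>

text \<open>The space \<open>C0_infinity (UNIV - {0})\<close> in a form whose closure properties are
  read off from zeros: smoothness is required only off the origin, and the support lies in a closed
  annulus.\<close>

definition ptest :: "(real^'n::finite \<Rightarrow> complex) \<Rightarrow> bool" where
  "ptest f \<longleftrightarrow> psmooth f \<and> (\<exists>r>0. \<exists>R. \<forall>x. f x \<noteq> 0 \<longrightarrow> r \<le> norm x \<and> norm x \<le> R)"

lemma ptest_psmooth [intro, simp]: "ptest f \<Longrightarrow> psmooth f"
  by (simp add: ptest_def)

lemma ptest_zero_at_0 [simp]: "ptest f \<Longrightarrow> f 0 = 0"
  unfolding ptest_def by (metis norm_zero not_less)

lemma ptest_supportE:
  assumes "ptest f"
  obtains r R where "r > 0" "r \<le> R" "\<And>x. norm x < r \<Longrightarrow> f x = 0" "\<And>x. norm x > R \<Longrightarrow> f x = 0"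
proof -
  obtain r R where rR: "r > 0" "\<And>x. f x \<noteq> 0 \<Longrightarrow> r \<le> norm x \<and> norm x \<le> R"
    using assms unfolding ptest_def by blast
  show thesis by (rule that[of r "max r R"]) (use rR in \<open>force+\<close>)
qed

lemma ptestI:
  assumes "psmooth f" "r > 0" "\<And>x. norm x < r \<Longrightarrow> f x = 0" "\<And>x. norm x > R \<Longrightarrow> f x = 0"
  shows "ptest f"
  unfolding ptest_def using assms by (metis not_less)

lemma ptest_mono:
  assumes "ptest f" "psmooth g" "\<And>x. f x = 0 \<Longrightarrow> g x = 0"
  shows "ptest g"
  using assms unfolding ptest_def by metis

lemma ptest_mult_left [intro]: "ptest f \<Longrightarrow> psmooth g \<Longrightarrow> ptest (\<lambda>x. f x * g x)"
  by (rule ptest_mono) auto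

lemma ptest_mult_right [intro]: "psmooth f \<Longrightarrow> ptest g \<Longrightarrow> ptest (\<lambda>x. f x * g x)"
  by (rule ptest_mono[of g]) auto

lemma ptest_cmult [intro]: "ptest f \<Longrightarrow> ptest (\<lambda>x. c * f x)"
  by (rule ptest_mult_right) auto

lemma ptest_cnj [intro]: "ptest f \<Longrightarrow> ptest (\<lambda>x. cnj (f x))"
  by (rule ptest_mono) auto

lemma ptest_zero [simp, intro!]: "ptest (\<lambda>_. 0)"
  unfolding ptest_def by (auto intro: exI[of _ 1])

lemma ptest_add [intro]:
  assumes "ptest f" "ptest g"
  shows "ptest (\<lambda>x. f x + g x)"
proof -
  obtain r R where 1: "r > 0" "r \<le> R" "\<And>x. norm x < r \<Longrightarrow> f x = 0" "\<And>x. norm x > R \<Longrightarrow> f x = 0"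
    by (rule ptest_supportE[OF assms(1)]) (rule that)
  obtain r' R' where 2: "r' > 0" "r' \<le> R'" "\<And>x. norm x < r' \<Longrightarrow> g x = 0" "\<And>x. norm x > R' \<Longrightarrow> g x = 0"
    by (rule ptest_supportE[OF assms(2)]) (rule that)
  show ?thesis by (rule ptestI[of _ "min r r'" "max R R'"]) (use assms 1 2 in auto)
qed

lemma ptest_diff [intro]: "ptest f \<Longrightarrow> ptest g \<Longrightarrow> ptest (\<lambda>x. f x - g x)"
  using ptest_add[of f "\<lambda>x. -1 * g x"] ptest_cmult[of g "-1"] by simp

lemma ptest_sum [intro]: "(\<And>i. i \<in> I \<Longrightarrow> ptest (f i)) \<Longrightarrow> ptest (\<lambda>x. \<Sum>i\<in>I. f i x)"
  by (induction I rule: infinite_finite_induct) auto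

lemma ptest_dir [intro]:
  assumes "ptest f" "\<And>i. psmooth (\<lambda>x. of_real (T x $ i))"
  shows "ptest (dir T f)"
proof -
  obtain r R where 1: "r > 0" "r \<le> R" "\<And>x. norm x < r \<Longrightarrow> f x = 0" "\<And>x. norm x > R \<Longrightarrow> f x = 0"
    by (rule ptest_supportE[OF assms(1)]) (rule that)
  show ?thesis
  proof (rule ptestI[OF _ 1(1)])
    show "psmooth (dir T f)" using assms by auto
    show "dir T f x = 0" if "norm x < r" for x
      by (rule dir_zero_open[of "ball 0 r"]) (use that 1 in auto)
    show "dir T f x = 0" if "norm x > R" for x
      by (rule dir_zero_open[of "- cball 0 R"]) (use that 1 in auto)
  qed
qed

lemma ptest_partial_deriv [intro]: "ptest f \<Longrightarrow> ptest (partial_deriv i f)"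
  unfolding partial_deriv_eq_dir by (rule ptest_dir) auto

lemma ptest_differentiable:
  assumes "ptest f"
  shows "f differentiable (at x)"
proof (cases "x = 0")
  case True
  obtain r R where 1: "r > 0" "r \<le> R" "\<And>x. norm x < r \<Longrightarrow> f x = 0" "\<And>x. norm x > R \<Longrightarrow> f x = 0"
    by (rule ptest_supportE[OF assms(1)]) (rule that)
  show ?thesis
    by (rule differentiable_cong_open[of "ball 0 r" x "\<lambda>_. 0" f]) (use 1 True in auto)
qed (use assms in auto)

lemma ptest_continuous_on: "ptest f \<Longrightarrow> continuous_on S f"
  by (auto intro!: continuous_at_imp_continuous_on differentiable_imp_continuous_within ptest_differentiable)

lemma ptest_C_k: "ptest f \<Longrightarrow> C_k k f"
proof (induction k arbitrary: f)
  case 0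
  then show ?case by (simp add: ptest_continuous_on)
next
  case (Suc k)
  then show ?case
    by (auto simp: differentiable_on_def intro: differentiable_at_withinI ptest_differentiable)
qed

lemma C_k_imp_punctured_C: "C_k k f \<Longrightarrow> punctured_C k f"
proof (induction k arbitrary: f)
  case 0
  then show ?case by (auto intro: continuous_on_subset)
qed (auto simp: differentiable_on_def)

lemma C0_infinity_imp_ptest:
  assumes "f \<in> C0_infinity (U - {0})"
  shows "ptest f"
proof -
  let ?K = "closure {x. f x \<noteq> 0}"
  have f: "\<And>k. C_k k f" "compact ?K" "0 \<notin> ?K" using assms by (auto simp: C0_infinity_def)
  obtain R where R: "\<And>x. x \<in> ?K \<Longrightarrow> norm x \<le> R"
    using compact_imp_bounded[OF f(2)] by (auto simp: bounded_iff)
  have "open (- ?K)" by auto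
  then obtain r where r: "r > 0" "ball 0 r \<subseteq> - ?K" using f(3) by (metis ComplI open_contains_ball)
  have K: "f x \<noteq> 0 \<Longrightarrow> x \<in> ?K" for x using closure_subset[of "{x. f x \<noteq> 0}"] by blast
  show ?thesis
  proof (rule ptestI[OF _ r(1)])
    show "psmooth f" using f(1) by (simp add: psmooth_def C_k_imp_punctured_C)
    show "f x = 0" if "norm x < r" for x using r(2) K[of x] that by (meson ComplD in_mono mem_ball_0)
    show "f x = 0" if "norm x > R" for x using R[of x] K[of x] that by auto
  qed
qed

lemma ptest_imp_C0_infinity:
  assumes "ptest f" "\<And>x. f x \<noteq> 0 \<Longrightarrow> norm x \<le> R'" "cball 0 R' \<subseteq> U"
  shows "f \<in> C0_infinity (U - {0})"
proof -
  obtain r R where 1: "r > 0" "r \<le> R" "\<And>x. norm x < r \<Longrightarrow> f x = 0" "\<And>x. norm x > R \<Longrightarrow> f x = 0"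
    by (rule ptest_supportE[OF assms(1)]) (rule that)
  have sub: "closure {x. f x \<noteq> 0} \<subseteq> cball 0 R' - ball 0 r"
  proof (rule closure_minimal)
    show "{x. f x \<noteq> 0} \<subseteq> cball 0 R' - ball 0 r" using 1 assms(2) by auto
    show "closed (cball 0 R' - ball (0::real^'a) r)" by (intro closed_Diff) auto
  qed
  moreover have "compact (cball 0 R' - ball (0::real^'a) r)" by (intro compact_diff) auto
  ultimately have "compact (closure {x. f x \<noteq> 0})"
    by (metis closed_closure compact_Int_closed inf.absorb_iff2)
  then show ?thesis
    using sub 1 assms by (auto simp: C0_infinity_def ptest_C_k)
qed

section \<open>Integration by parts\<close>

lemma integrable_continuous_bounded_support:
  fixes f :: "'a::euclidean_space \<Rightarrow> 'b::{banach, second_countable_topology}"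
  assumes "continuous_on UNIV f" "\<And>x. norm x > R \<Longrightarrow> f x = 0"
  shows "integrable lborel f"
proof -
  have "integrable lborel (\<lambda>x. indicator (cball 0 R) x *\<^sub>R f x)"
    using assms(1) by (intro borel_integrable_compact) (auto intro: continuous_on_subset)
  also have "(\<lambda>x. indicator (cball 0 R) x *\<^sub>R f x) = f"
    using assms(2) by (force simp: indicator_def fun_eq_iff)
  finally show ?thesis .
qed

lemma ptest_integrable [intro, simp]:
  assumes "ptest f"
  shows "integrable lborel f"
proof -
  obtain r R where 1: "r > 0" "r \<le> R" "\<And>x. norm x < r \<Longrightarrow> f x = 0" "\<And>x. norm x > R \<Longrightarrow> f x = 0"
    by (rule ptest_supportE[OF assms]) (rule that)
  show ?thesis by (rule integrable_continuous_bounded_support[of _ R]) (use 1 assms ptest_continuous_on in auto)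
qed

lemma ptest_bounded:
  assumes "ptest f"
  obtains B where "B \<ge> 0" "\<And>x. norm (f x) \<le> B"
proof -
  obtain r R where 1: "r > 0" "r \<le> R" "\<And>x. norm x < r \<Longrightarrow> f x = 0" "\<And>x. norm x > R \<Longrightarrow> f x = 0"
    by (rule ptest_supportE[OF assms]) (rule that)
  have "compact (f ` cball 0 R)"
    using assms by (intro compact_continuous_image ptest_continuous_on) auto
  then obtain B where B: "\<And>x. norm x \<le> R \<Longrightarrow> norm (f x) \<le> B"
    using compact_imp_bounded[of "f ` cball 0 R"] unfolding bounded_iff by (metis imageI mem_cball_0)
  show thesis
  proof (rule that[of "max B 0"])
    show "norm (f x) \<le> max B 0" for x using B[of x] 1(4)[of x] by (cases "norm x \<le> R") auto
  qed auto
qed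

lemma difference_quotient_tendsto:
  assumes "f differentiable (at x)" "v \<noteq> 0"
  shows "(\<lambda>m. real (Suc m) *\<^sub>R (f (x + (1 / real (Suc m)) *\<^sub>R v) - f x)) \<longlonglongrightarrow> frechet_derivative f (at x) v"
proof -
  let ?D = "frechet_derivative f (at x)" and ?h = "\<lambda>m. (1 / real (Suc m)) *\<^sub>R v"
  have D: "(f has_derivative ?D) (at x)" using assms(1) by (simp add: frechet_derivative_works)
  have h: "filterlim ?h (at 0) sequentially"
    unfolding filterlim_at using assms(2)
    using tendsto_scaleR[OF LIMSEQ_inverse_real_of_nat tendsto_const[of v]]
    by (auto simp: inverse_eq_divide)
  have "(\<lambda>h. norm (f (x + h) - f x - ?D h) / norm h) \<midarrow>0\<rightarrow> 0"
    using D by (simp add: has_derivative_at)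
  from tendsto_mult_left_zero[OF filterlim_compose[OF this h], of "norm v"]
  have "(\<lambda>m. norm (f (x + ?h m) - f x - ?D (?h m)) / norm (?h m) * norm v) \<longlonglongrightarrow> 0" .
  moreover have "norm (f (x + ?h m) - f x - ?D (?h m)) / norm (?h m) * norm v
      = norm (real (Suc m) *\<^sub>R (f (x + ?h m) - f x) - ?D v)" for m
  proof -
    have "real (Suc m) *\<^sub>R (f (x + ?h m) - f x) - ?D v = real (Suc m) *\<^sub>R (f (x + ?h m) - f x - ?D (?h m))"
      using linear_cmul[OF has_derivative_linear[OF D], of "1 / real (Suc m)" v] by (simp add: scaleR_diff_right del: of_nat_Suc)
    then show ?thesis using assms(2) by (simp del: of_nat_Suc add: mult.commute)
  qed
  ultimately have "(\<lambda>m. norm (real (Suc m) *\<^sub>R (f (x + ?h m) - f x) - ?D v)) \<longlonglongrightarrow> 0" by simp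
  then show ?thesis by (simp only: tendsto_norm_zero_iff LIM_zero_iff)
qed

text \<open>Translation invariance makes the integrals of all difference quotients vanish.\<close>

lemma integral_partial_deriv:
  fixes u :: "real^'n::finite \<Rightarrow> complex"
  assumes u: "ptest u"
  shows "(\<integral>x. partial_deriv i u x \<partial>lborel) = 0"
proof -
  let ?v = "axis i (1::real) :: real^'n"
  define s where "s m x = real (Suc m) *\<^sub>R (u (x + (1 / real (Suc m)) *\<^sub>R ?v) - u x)" for m x
  obtain B where B: "B \<ge> 0" "\<And>x. norm (partial_deriv i u x) \<le> B"
    by (rule ptest_bounded[OF ptest_partial_deriv[OF u]]) (rule that)
  obtain r R where 1: "r > 0" "r \<le> R" "\<And>x. norm x < r \<Longrightarrow> u x = 0" "\<And>x. norm x > R \<Longrightarrow> u x = 0"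
    by (rule ptest_supportE[OF u]) (rule that)
  have shift: "integrable lborel (\<lambda>x. u (x + a))" "(\<integral>x. u (x + a) \<partial>lborel) = (\<integral>x. u x \<partial>lborel)" for a
  proof -
    have [measurable]: "u \<in> borel_measurable borel"
      using ptest_continuous_on[OF u] by (rule borel_measurable_continuous_onI)
    have "integrable (distr lborel borel ((+) a)) u" using u by (simp add: lborel_distr_plus)
    then show "integrable lborel (\<lambda>x. u (x + a))" by (simp add: integrable_distr_eq add.commute)
    have "(\<integral>x. u x \<partial>lborel) = (\<integral>x. u x \<partial>distr lborel borel ((+) a))" by (simp add: lborel_distr_plus)
    then show "(\<integral>x. u (x + a) \<partial>lborel) = (\<integral>x. u x \<partial>lborel)" by (simp add: integral_distr add.commute)
  qed
  have int_s: "(\<integral>x. s m x \<partial>lborel) = 0" "integrable lborel (s m)" for m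
    using shift u by (auto simp: s_def[abs_def])
  have "(\<lambda>m. \<integral>x. s m x \<partial>lborel) \<longlonglongrightarrow> (\<integral>x. partial_deriv i u x \<partial>lborel)"
  proof (rule integral_dominated_convergence)
    \<comment> \<open>The translations have length at most 1, so all quotients vanish outside the
      ball of radius \<open>R + 1\<close>; inside, the mean value inequality bounds them by
      \<open>B\<close>.\<close>
    show "integrable lborel (\<lambda>x. B * indicator (cball (0::real^'n) (R + 1)) x)"
      by (auto intro!: integrable_mult_right emeasure_compact_finite)
    show "AE x in lborel. (\<lambda>m. s m x) \<longlonglongrightarrow> partial_deriv i u x"
      unfolding s_def partial_deriv_def
      by (intro AE_I2 difference_quotient_tendsto ptest_differentiable u) (simp add: axis_eq_0_iff)
    show "AE x in lborel. norm (s m x) \<le> B * indicator (cball (0::real^'n) (R + 1)) x" for m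
    proof (rule AE_I2)
      fix x :: "real^'n"
      let ?h = "1 / real (Suc m)"
      show "norm (s m x) \<le> B * indicator (cball (0::real^'n) (R + 1)) x"
      proof (cases "norm x \<le> R + 1")
        case True
        have "norm (u (x + ?h *\<^sub>R ?v) - u x - ?h *\<^sub>R 0) \<le> B * ?h"
          using B(2) u by (intro norm_diff_le_along_segment) (auto simp: partial_deriv_eq_dir[symmetric] ptest_differentiable)
        then have "real (Suc m) * norm (u (x + ?h *\<^sub>R ?v) - u x) \<le> real (Suc m) * (B * ?h)"
          by (intro mult_left_mono) auto
        then have "norm (s m x) \<le> B" by (simp add: s_def del: of_nat_Suc)
        then show ?thesis using True by simp
      next
        case False
        have "norm (?h *\<^sub>R ?v) \<le> 1" by (simp add: divide_simps)
        then have "norm (x + ?h *\<^sub>R ?v) > R" using False norm_diff_ineq[of x "?h *\<^sub>R ?v"] by linarith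
        then have "s m x = 0" using 1(4) False by (simp add: s_def)
        then show ?thesis using B(1) by simp
      qed
    qed
    show "partial_deriv i u \<in> borel_measurable lborel"
      by (rule borel_measurable_integrable) (use u in auto)
    show "s m \<in> borel_measurable lborel" for m using int_s(2) by auto
  qed
  then show ?thesis by (simp add: int_s LIMSEQ_const_iff)
qed

text \<open>The complex numbers are regarded as a real plane, so this is the real part of the
  Hermitian product. It is symmetric, hence cross terms in an expanded square come in equal
  pairs.\<close>

definition ip :: "(real^'n::finite \<Rightarrow> complex) \<Rightarrow> (real^'n \<Rightarrow> complex) \<Rightarrow> real" where
  "ip u v = (\<integral>x. norm x powr (- real CARD('n)) * (u x \<bullet> v x) \<partial>lborel)"

section \<open>Algebra of the weighted inner product\<close>

lemma Re_rpow_mult_cnj: "Re (rpow s x * (z * cnj w)) = norm x powr s * (z \<bullet> w)"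
  by (simp add: rpow_def inner_complex_def)

lemma weighted_inner_integrable [intro, simp]:
  assumes "ptest u" "ptest v"
  shows "integrable lborel (\<lambda>x. norm x powr s * (u x \<bullet> v x))"
proof -
  have "integrable lborel (\<lambda>x. rpow s x * (u x * cnj (v x)))"
    using assms by (intro ptest_integrable ptest_mult_right psmooth_rpow ptest_mult_left) auto
  then have "integrable lborel (\<lambda>x. Re (rpow s x * (u x * cnj (v x))))" by (rule integrable_Re)
  then show ?thesis by (simp only: Re_rpow_mult_cnj)
qed

lemma ip_eq_Re:
  fixes u v :: "real^'n::finite \<Rightarrow> complex"
  assumes "ptest u" "ptest v"
  shows "ip u v = Re (\<integral>x. rpow (- real CARD('n)) x * (u x * cnj (v x)) \<partial>lborel)"
proof -
  have "integrable lborel (\<lambda>x. rpow (- real CARD('n)) x * (u x * cnj (v x)))"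
    using assms by (intro ptest_integrable ptest_mult_right psmooth_rpow ptest_mult_left) auto
  from integral_Re[OF this] show ?thesis
    by (simp only: ip_def Re_rpow_mult_cnj)
qed

lemma ip_commute: "ip u v = ip v u"
  by (simp add: ip_def inner_commute)

lemma ip_add_left: "ptest u \<Longrightarrow> ptest v \<Longrightarrow> ptest w \<Longrightarrow> ip (\<lambda>x. u x + v x) w = ip u w + ip v w"
  by (simp add: ip_def inner_add_left distrib_left)

lemma ip_diff_left: "ptest u \<Longrightarrow> ptest v \<Longrightarrow> ptest w \<Longrightarrow> ip (\<lambda>x. u x - v x) w = ip u w - ip v w"
  by (simp add: ip_def inner_diff_left right_diff_distrib)

lemma ip_cmult_left: "ip (\<lambda>x. of_real c * u x) v = c * ip u v"
  by (simp add: ip_def mult.left_commute flip: scaleR_conv_of_real)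

lemma ip_add_right: "ptest u \<Longrightarrow> ptest v \<Longrightarrow> ptest w \<Longrightarrow> ip w (\<lambda>x. u x + v x) = ip w u + ip w v"
  by (metis ip_commute ip_add_left)

lemma ip_diff_right: "ptest u \<Longrightarrow> ptest v \<Longrightarrow> ptest w \<Longrightarrow> ip w (\<lambda>x. u x - v x) = ip w u - ip w v"
  by (metis ip_commute ip_diff_left)

lemma ip_cmult_right: "ip u (\<lambda>x. of_real c * v x) = c * ip u v"
  by (metis ip_commute ip_cmult_left)

lemma ip_sum_left:
  "(\<And>i. i \<in> I \<Longrightarrow> ptest (u i)) \<Longrightarrow> ptest w \<Longrightarrow> ip (\<lambda>x. \<Sum>i\<in>I. u i x) w = (\<Sum>i\<in>I. ip (u i) w)"
  by (simp add: ip_def inner_sum_left sum_distrib_left)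

lemma ip_sum_right:
  "(\<And>i. i \<in> I \<Longrightarrow> ptest (u i)) \<Longrightarrow> ptest w \<Longrightarrow> ip w (\<lambda>x. \<Sum>i\<in>I. u i x) = (\<Sum>i\<in>I. ip w (u i))"
  using ip_sum_left[of I u w] by (simp add: ip_commute)

lemma ip_nonneg [simp]: "ip u u \<ge> 0"
  by (simp add: ip_def)

lemma ip_Cauchy_Schwarz:
  assumes u: "ptest u" and v: "ptest v"
  shows "\<bar>ip u v\<bar> \<le> sqrt (ip u u) * sqrt (ip v v)"
proof -
  have "0 \<le> ip u u * t\<^sup>2 + 2 * ip u v * t + ip v v" for t
  proof -
    have "0 \<le> ip (\<lambda>x. of_real t * u x + v x) (\<lambda>x. of_real t * u x + v x)" by simp
    also have "\<dots> = ip u u * t\<^sup>2 + 2 * ip u v * t + ip v v"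
      using u v by (simp add: ip_add_left ip_add_right ip_cmult_left ip_cmult_right ptest_cmult ptest_add
          ip_commute[of v u] power2_eq_square algebra_simps)
    finally show ?thesis .
  qed
  note q = this
  have "(ip u v)\<^sup>2 \<le> ip u u * ip v v"
  proof (cases "ip u u = 0")
    case True
    have "ip u v = 0"
    proof (rule ccontr)
      assume "ip u v \<noteq> 0"
      \<comment> \<open>With leading coefficient 0 the polynomial is affine, and at this argument it
        equals -1.\<close>
      then show False using q[of "- (ip v v + 1) / (2 * ip u v)"] True by simp
    qed
    then show ?thesis by simp
  next
    case False
    then have "ip u u > 0" by (simp add: order_less_le)
    then show ?thesis using q[of "- ip u v / ip u u"] by (simp add: field_simps power2_eq_square)
  qed
  then show ?thesis by (metis real_sqrt_abs real_sqrt_le_mono real_sqrt_mult)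
qed

text \<open>The hypothesis \<open>div\<close> says that |x|^-n \<open>T\<close> is divergence free
  off the origin: div \<open>T\<close> cancels against n (x . T) / |x|^2, which comes from
  differentiating the weight. Hence the integrand is the divergence of a test field.\<close>

lemma integral_weighted_dir:
  fixes T :: "real^'n::finite \<Rightarrow> real^'n"
  assumes u: "ptest u" and T: "\<And>i. psmooth (\<lambda>x. of_real (T x $ i))"
    and div: "\<And>x. x \<noteq> 0 \<Longrightarrow> (\<Sum>i\<in>UNIV. partial_deriv i (\<lambda>x. of_real (T x $ i)) x)
      = of_real (real CARD('n) * (x \<bullet> T x)) * rpow (-2) x"
  shows "(\<integral>x. rpow (- real CARD('n)) x * dir T u x \<partial>lborel) = 0"
proof -
  let ?n = "real CARD('n)"
  define g where "g i x = rpow (- ?n) x * (of_real (T x $ i) * u x)" for i x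
  have g: "ptest (g i)" for i
    unfolding g_def by (intro ptest_mult_right psmooth_rpow T u)
  have eq: "(\<Sum>i\<in>UNIV. partial_deriv i (g i) x) = rpow (- ?n) x * dir T u x" for x
  proof (cases "x = 0")
    case True
    have "ptest (dir T u)" "ptest (partial_deriv i (g i))" for i
      using u T g by auto
    then show ?thesis using True by simp
  next
    case False
    have "partial_deriv i (g i) x = of_real (- ?n * (x $ i)) * rpow (- ?n - 2) x * (of_real (T x $ i) * u x)
       + rpow (- ?n) x * (partial_deriv i (\<lambda>x. of_real (T x $ i)) x * u x + of_real (T x $ i) * partial_deriv i u x)" for i
      using False u T unfolding g_def partial_deriv_eq_dir
      by (simp add: dir_mult psmooth_differentiable psmooth_mult dir_rpow inner_axis)
    then have "partial_deriv i (g i) x = of_real (- ?n * (x $ i * T x $ i)) * (rpow (- ?n - 2) x * u x)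
       + (rpow (- ?n) x * (partial_deriv i (\<lambda>x. of_real (T x $ i)) x * u x)
       + rpow (- ?n) x * (of_real (T x $ i) * partial_deriv i u x))" for i
      by (simp add: algebra_simps)
    then have "(\<Sum>i\<in>UNIV. partial_deriv i (g i) x) =
        (\<Sum>i\<in>UNIV. of_real (- ?n * (x $ i * T x $ i)) * (rpow (- ?n - 2) x * u x)) +
        (rpow (- ?n) x * ((\<Sum>i\<in>UNIV. partial_deriv i (\<lambda>x. of_real (T x $ i)) x) * u x) +
         rpow (- ?n) x * dir T u x)"
      by (simp only: sum.distrib sum_distrib_left sum_distrib_right
          dir_expand[OF psmooth_differentiable[OF ptest_psmooth[OF u] False]])
    also have "(\<Sum>i\<in>UNIV. of_real (- ?n * (x $ i * T x $ i)) * (rpow (- ?n - 2) x * u x)) =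
        of_real (- ?n * (x \<bullet> T x)) * (rpow (- ?n - 2) x * u x)"
      by (simp add: inner_vec_def sum_distrib_left sum_distrib_right mult.assoc)
    also have "rpow (- ?n - 2) x = rpow (- ?n) x * rpow (- 2) x" by (simp add: rpow_add)
    finally show ?thesis by (simp add: div[OF False] algebra_simps)
  qed
  have "(\<integral>x. rpow (- ?n) x * dir T u x \<partial>lborel) = (\<integral>x. (\<Sum>i\<in>UNIV. partial_deriv i (g i) x) \<partial>lborel)"
    by (simp add: eq)
  also have "\<dots> = 0"
    using g by (subst Bochner_Integration.integral_sum) (auto simp: integral_partial_deriv)
  finally show ?thesis .
qed

text \<open>Apply \<open>integral_weighted_dir\<close> to \<open>u\<close> times the conjugate of
  \<open>v\<close>; the product rule splits the vanishing integral into the two pairings.\<close>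

lemma ip_dir:
  fixes T :: "real^'n::finite \<Rightarrow> real^'n"
  assumes u: "ptest u" and v: "ptest v" and T: "\<And>i. psmooth (\<lambda>x. of_real (T x $ i))"
    and div: "\<And>x. x \<noteq> 0 \<Longrightarrow> (\<Sum>i\<in>UNIV. partial_deriv i (\<lambda>x. of_real (T x $ i)) x)
      = of_real (real CARD('n) * (x \<bullet> T x)) * rpow (-2) x"
  shows "ip (dir T u) v = - ip u (dir T v)"
proof -
  let ?w = "\<lambda>x. rpow (- real CARD('n)) x"
  have tu: "ptest (dir T u)" "ptest (dir T v)" using u v T by auto
  have "dir T (\<lambda>x. u x * cnj (v x)) x = dir T u x * cnj (v x) + u x * cnj (dir T v x)" for x
    using u v by (simp add: dir_mult ptest_differentiable dir_cnj ptest_cnj)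
  then have "0 = (\<integral>x. ?w x * (dir T u x * cnj (v x) + u x * cnj (dir T v x)) \<partial>lborel)"
    using integral_weighted_dir[of "\<lambda>x. u x * cnj (v x)", OF _ T div] u v
    by (simp add: ptest_mult_left psmooth_cnj)
  also have "\<dots> = (\<integral>x. ?w x * (dir T u x * cnj (v x)) \<partial>lborel) + (\<integral>x. ?w x * (u x * cnj (dir T v x)) \<partial>lborel)"
    unfolding distrib_left
    by (intro Bochner_Integration.integral_add ptest_integrable ptest_mult_right psmooth_rpow ptest_mult_left)
      (use u v tu in auto)
  finally have "0 = Re \<dots>" by simp
  then show ?thesis using u v tu by (simp add: ip_eq_Re)
qed

section \<open>Euler field, rotations and the spherical Laplacian\<close>

text \<open>The generator of rotations in the (i, j)-plane, tangent to every sphere around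
  0.\<close>

definition rot :: "'n::finite \<Rightarrow> 'n \<Rightarrow> real^'n \<Rightarrow> real^'n" where
  "rot i j x = (x $ i) *\<^sub>R axis j 1 - (x $ j) *\<^sub>R axis i 1"

abbreviation euler :: "(real^'n::finite \<Rightarrow> complex) \<Rightarrow> real^'n \<Rightarrow> complex" where
  "euler \<equiv> dir (\<lambda>x. x)"

abbreviation rotd :: "'n::finite \<Rightarrow> 'n \<Rightarrow> (real^'n \<Rightarrow> complex) \<Rightarrow> real^'n \<Rightarrow> complex" where
  "rotd i j \<equiv> dir (rot i j)"

text \<open>Minus the Laplace-Beltrami operator of the unit sphere, carried to all spheres around 0.
  This form gives the action on homogeneous functions at once; symmetry and sign are read off from
  the rotation formula \<open>sph_lap_eq_sum_rotd\<close>.\<close>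

definition sph_lap :: "(real^'n::finite \<Rightarrow> complex) \<Rightarrow> real^'n \<Rightarrow> complex" where
  "sph_lap f x = euler (euler f) x + of_real (real CARD('n) - 2) * euler f x - rpow 2 x * laplacian f x"

lemma psmooth_rot_nth [simp, intro]: "psmooth (\<lambda>x. of_real (rot i j x $ k))"
  by (auto simp: rot_def)

lemma psmooth_euler [simp, intro]: "psmooth f \<Longrightarrow> psmooth (euler f)"
  by auto

lemma psmooth_rotd [simp, intro]: "psmooth f \<Longrightarrow> psmooth (rotd i j f)"
  by auto

lemma ptest_euler [simp, intro]: "ptest f \<Longrightarrow> ptest (euler f)"
  by auto

lemma ptest_rotd [simp, intro]: "ptest f \<Longrightarrow> ptest (rotd i j f)"
  by auto

lemma psmooth_laplacian [simp, intro]: "psmooth f \<Longrightarrow> psmooth (laplacian f)"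
  unfolding laplacian_def[abs_def] by auto

lemma psmooth_sph_lap [simp, intro]: "psmooth f \<Longrightarrow> psmooth (sph_lap f)"
  unfolding sph_lap_def[abs_def] by auto

lemma ptest_laplacian [simp, intro]: "ptest f \<Longrightarrow> ptest (laplacian f)"
  unfolding laplacian_def[abs_def] by (intro ptest_sum ptest_partial_deriv)

lemma ptest_sph_lap [simp, intro]: "ptest f \<Longrightarrow> ptest (sph_lap f)"
  unfolding sph_lap_def[abs_def] by (intro ptest_add ptest_diff ptest_cmult ptest_mult_right) auto

lemma inner_rot [simp]: "x \<bullet> rot i j x = 0"
  by (simp add: rot_def inner_diff_right inner_axis)

lemma euler_expand: "f differentiable (at x) \<Longrightarrow> euler f x = (\<Sum>i\<in>UNIV. of_real (x $ i) * partial_deriv i f x)"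
  by (rule dir_expand)

lemma rotd_expand:
  assumes "f differentiable (at x)"
  shows "rotd i j f x = of_real (x $ i) * partial_deriv j f x - of_real (x $ j) * partial_deriv i f x"
proof -
  have lin: "linear (frechet_derivative f (at x))" using assms by (rule linear_frechet_derivative)
  show ?thesis
    by (simp add: dir_def rot_def partial_deriv_def linear_diff[OF lin] linear_cmul[OF lin] scaleR_conv_of_real[where 'a=complex])
qed

text \<open>For the Euler field both sides of the divergence condition in \<open>ip_dir\<close>
  equal n; for the rotations, treated next, both are 0.\<close>

lemma ip_euler: "ptest u \<Longrightarrow> ptest v \<Longrightarrow> ip (euler u) v = - ip u (euler v)"
proof (rule ip_dir)
  show "(\<Sum>i\<in>UNIV. partial_deriv i (\<lambda>x::real^'a. of_real (x $ i)) x) = of_real (real CARD('a) * (x \<bullet> x)) * rpow (-2) x"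
    if "x \<noteq> 0" for x
    using that rpow_add[of 2 x "-2"]
    by (simp add: partial_deriv_eq_dir rpow_2 rpow_0 mult.assoc)
qed auto

lemma ip_rotd: "ptest u \<Longrightarrow> ptest v \<Longrightarrow> ip (rotd i j u) v = - ip u (rotd i j v)"
proof (rule ip_dir)
  have "partial_deriv k (\<lambda>x. complex_of_real (rot i j x $ k)) x = (if k = i \<and> i = j then 1 else 0) - (if k = j \<and> i = j then 1 else 0)"
    if "x \<noteq> 0" for x k
  proof -
    have "partial_deriv k (\<lambda>x. complex_of_real (rot i j x $ k)) x =
        dir (\<lambda>_. axis k 1) (\<lambda>x. of_real (x $ i) * of_real (axis j 1 $ k) - of_real (x $ j) * of_real (axis i 1 $ k)) x"
      by (simp add: partial_deriv_eq_dir rot_def)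
    also have "\<dots> = of_real (axis k 1 $ i) * of_real (axis j 1 $ k) - of_real (axis k 1 $ j) * of_real (axis i 1 $ k)"
      using that by (subst dir_diff) (auto simp: dir_mult psmooth_differentiable)
    finally show ?thesis by (auto simp: axis_def)
  qed
  then show "(\<Sum>k\<in>UNIV. partial_deriv k (\<lambda>x. complex_of_real (rot i j x $ k)) x) = of_real (real CARD('a) * (x \<bullet> rot i j x)) * rpow (-2) x"
    if "x \<noteq> 0" for x
    using that by (cases "i = j") (auto simp: sum_subtractf)
qed auto

lemma partial_deriv_coord_mult:
  assumes "psmooth g" "x \<noteq> 0"
  shows "partial_deriv k (\<lambda>x. of_real (x $ l) * g x) x =
    (if k = l then g x else 0) + of_real (x $ l) * partial_deriv k g x"
  using assms by (simp add: partial_deriv_eq_dir dir_mult psmooth_differentiable) (simp add: axis_def)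

lemma partial_deriv_euler:
  assumes f: "psmooth f" and x: "x \<noteq> 0"
  shows "partial_deriv k (euler f) x = partial_deriv k f x + (\<Sum>l\<in>UNIV. of_real (x $ l) * partial_deriv k (partial_deriv l f) x)"
proof -
  have "partial_deriv k (euler f) x = partial_deriv k (\<lambda>x. \<Sum>l\<in>UNIV. of_real (x $ l) * partial_deriv l f x) x"
    using f x by (intro partial_deriv_cong euler_expand) auto
  also have "\<dots> = (\<Sum>l\<in>UNIV. partial_deriv k (\<lambda>x. of_real (x $ l) * partial_deriv l f x) x)"
    unfolding partial_deriv_eq_dir[of k] using f x by (intro dir_sum) auto
  also have "\<dots> = (\<Sum>l\<in>UNIV. (if k = l then partial_deriv l f x else 0) + of_real (x $ l) * partial_deriv k (partial_deriv l f) x)"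
    using f x by (intro sum.cong partial_deriv_coord_mult) auto
  finally show ?thesis by (simp add: sum.distrib)
qed

lemma partial_deriv_rotd:
  assumes f: "psmooth f" and x: "x \<noteq> 0"
  shows "partial_deriv k (rotd i j f) x =
    (if k = i then partial_deriv j f x else 0) + of_real (x $ i) * partial_deriv k (partial_deriv j f) x
    - (if k = j then partial_deriv i f x else 0) - of_real (x $ j) * partial_deriv k (partial_deriv i f) x"
proof -
  have "partial_deriv k (rotd i j f) x = partial_deriv k (\<lambda>x. of_real (x $ i) * partial_deriv j f x - of_real (x $ j) * partial_deriv i f x) x"
    using f x by (intro partial_deriv_cong rotd_expand) auto
  also have "\<dots> = partial_deriv k (\<lambda>x. of_real (x $ i) * partial_deriv j f x) x - partial_deriv k (\<lambda>x. of_real (x $ j) * partial_deriv i f x) x"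
    unfolding partial_deriv_eq_dir[of k] using f x by (intro dir_diff) auto
  finally show ?thesis using f x by (simp add: partial_deriv_coord_mult psmooth_partial_deriv)
qed

text \<open>Dilations commute with rotations. In coordinates the first-order terms agree, and the
  second-order ones match by \<open>partial_deriv_commute\<close>.\<close>

lemma euler_rotd_commute:
  assumes f: "psmooth f" and x: "x \<noteq> 0"
  shows "euler (rotd i j f) x = rotd i j (euler f) x"
proof -
  let ?p = "\<lambda>i. partial_deriv i f x" and ?q = "\<lambda>k i. partial_deriv k (partial_deriv i f) x"
  have "euler (rotd i j f) x = (\<Sum>k\<in>UNIV. of_real (x $ k) * partial_deriv k (rotd i j f) x)"
    using f x by (intro euler_expand psmooth_differentiable) auto
  also have "\<dots> = (\<Sum>k\<in>UNIV. (if k = i then of_real (x $ i) * ?p j else 0) + of_real (x $ i) * (of_real (x $ k) * ?q k j)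
      - (if k = j then of_real (x $ j) * ?p i else 0) - of_real (x $ j) * (of_real (x $ k) * ?q k i))"
    by (rule sum.cong) (auto simp: partial_deriv_rotd[OF f x] algebra_simps)
  also have "\<dots> = of_real (x $ i) * ?p j + of_real (x $ i) * (\<Sum>k\<in>UNIV. of_real (x $ k) * ?q k j)
      - of_real (x $ j) * ?p i - of_real (x $ j) * (\<Sum>k\<in>UNIV. of_real (x $ k) * ?q k i)"
    by (simp only: sum_subtractf sum.distrib sum_distrib_left) simp
  also have "\<dots> = of_real (x $ i) * partial_deriv j (euler f) x - of_real (x $ j) * partial_deriv i (euler f) x"
    by (simp add: partial_deriv_euler[OF f x] partial_deriv_commute[OF f x, of j] partial_deriv_commute[OF f x, of i] algebra_simps)
  also have "\<dots> = rotd i j (euler f) x"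
    using f x by (intro rotd_expand[symmetric] psmooth_differentiable) auto
  finally show ?thesis .
qed

text \<open>The double sum counts each plane twice, whence the 1/2. In coordinates the mixed
  second-order terms \<open>Q\<close> agree on both sides, and the first-order terms combine to the
  factor n - 2.\<close>

lemma sph_lap_eq_sum_rotd:
  fixes f :: "real^'n::finite \<Rightarrow> complex"
  assumes f: "psmooth f" and x: "x \<noteq> 0"
  shows "sph_lap f x = of_real (- (1/2)) * (\<Sum>i\<in>UNIV. \<Sum>j\<in>UNIV. rotd i j (rotd i j f) x)"
proof -
  let ?p = "\<lambda>i. partial_deriv i f x" and ?q = "\<lambda>k i. partial_deriv k (partial_deriv i f) x"
  let ?x = "\<lambda>i. complex_of_real (x $ i)"
  define a where "a = (\<Sum>i\<in>UNIV. ?x i * ?p i)"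
  define s where "s = (\<Sum>i\<in>UNIV. ?x i * ?x i)"
  define L where "L = (\<Sum>i\<in>UNIV. ?q i i)"
  define Q where "Q = (\<Sum>i\<in>UNIV. \<Sum>j\<in>UNIV. ?x i * ?x j * ?q i j)"
  \<comment> \<open>For \<open>i = j\<close> the field \<open>rot i j\<close> is 0, and the
    \<open>if\<close> term makes the right-hand side 0 as well, so the sums may run over all
    pairs.\<close>
  have "rotd i j (rotd i j f) x = (if i = j then 2 * (?x i * ?p i) else 0) + (?x i * ?x i) * ?q j j + (?x j * ?x j) * ?q i i
      - ?x i * ?p i - ?x j * ?p j - ?x j * ?x i * ?q j i - ?x i * ?x j * ?q i j" for i j
    using f x by (subst rotd_expand) (auto simp: partial_deriv_rotd[OF f x] psmooth_differentiable algebra_simps)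
  then have "(\<Sum>i\<in>UNIV. \<Sum>j\<in>UNIV. rotd i j (rotd i j f) x) =
    (\<Sum>i\<in>UNIV. \<Sum>j\<in>UNIV. if i = j then 2 * (?x i * ?p i) else 0) + (\<Sum>i\<in>UNIV. \<Sum>j\<in>UNIV. (?x i * ?x i) * ?q j j)
    + (\<Sum>i\<in>UNIV. \<Sum>j\<in>UNIV. (?x j * ?x j) * ?q i i) - (\<Sum>i\<in>UNIV. \<Sum>j\<in>(UNIV::'n set). ?x i * ?p i) - (\<Sum>i\<in>(UNIV::'n set). \<Sum>j\<in>UNIV. ?x j * ?p j)
    - (\<Sum>i\<in>UNIV. \<Sum>j\<in>UNIV. ?x j * ?x i * ?q j i) - (\<Sum>i\<in>UNIV. \<Sum>j\<in>UNIV. ?x i * ?x j * ?q i j)"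
    by (simp only: sum_subtractf sum.distrib)
  also have "(\<Sum>i\<in>UNIV. \<Sum>j\<in>UNIV. if i = j then 2 * (?x i * ?p i) else 0) = 2 * a"
    by (simp add: a_def sum_distrib_left)
  also have "(\<Sum>i\<in>UNIV. \<Sum>j\<in>UNIV. (?x i * ?x i) * ?q j j) = s * L"
    by (simp add: s_def L_def sum_product)
  also have "(\<Sum>i\<in>UNIV. \<Sum>j\<in>UNIV. (?x j * ?x j) * ?q i i) = s * L"
    by (subst sum.swap) (simp add: s_def L_def sum_product)
  also have "(\<Sum>i\<in>UNIV. \<Sum>j\<in>(UNIV::'n set). ?x i * ?p i) = of_nat CARD('n) * a"
    by (simp add: a_def sum_distrib_left)
  also have "(\<Sum>i\<in>(UNIV::'n set). \<Sum>j\<in>UNIV. ?x j * ?p j) = of_nat CARD('n) * a"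
    by (simp add: a_def)
  also have "(\<Sum>i\<in>UNIV. \<Sum>j\<in>UNIV. ?x j * ?x i * ?q j i) = Q"
    by (subst sum.swap) (simp add: Q_def)
  also have "(\<Sum>i\<in>UNIV. \<Sum>j\<in>UNIV. ?x i * ?x j * ?q i j) = Q"
    by (simp add: Q_def)
  finally have LL2: "(\<Sum>i\<in>UNIV. \<Sum>j\<in>UNIV. rotd i j (rotd i j f) x) = 2 * a + 2 * s * L - 2 * of_nat CARD('n) * a - 2 * Q"
    by (simp add: algebra_simps)
  have E: "euler f x = a" using f x by (simp add: euler_expand psmooth_differentiable a_def)
  have "euler (euler f) x = (\<Sum>k\<in>UNIV. ?x k * (?p k + (\<Sum>l\<in>UNIV. ?x l * ?q k l)))"
    using f x by (subst euler_expand) (auto simp: partial_deriv_euler[OF f x] psmooth_differentiable)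
  then have EE2: "euler (euler f) x = a + Q"
    by (simp add: a_def Q_def distrib_left sum.distrib sum_distrib_left mult.assoc)
  have "rpow 2 x = s" by (simp add: rpow_2 inner_vec_def s_def)
  moreover have "laplacian f x = L" by (simp add: laplacian_def L_def)
  ultimately show ?thesis unfolding sph_lap_def LL2 EE2 E by (simp add: algebra_simps)
qed

lemma ptest_eq_zero_at_0I: "ptest f \<Longrightarrow> ptest g \<Longrightarrow> (\<And>x. x \<noteq> 0 \<Longrightarrow> f x = g x) \<Longrightarrow> f = g"
  by (rule ext) (metis ptest_zero_at_0)

lemma ptest_sph_lap_eq:
  "ptest f \<Longrightarrow> sph_lap f = (\<lambda>x. of_real (- (1/2)) * (\<Sum>i\<in>UNIV. \<Sum>j\<in>UNIV. rotd i j (rotd i j f) x))"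
  by (intro ptest_eq_zero_at_0I ptest_cmult ptest_sum sph_lap_eq_sum_rotd ptest_psmooth ptest_rotd ptest_sph_lap)

text \<open>One integration by parts in each rotation field produces a Dirichlet form, in which
  symmetry and nonnegativity are visible.\<close>

lemma ip_sph_lap:
  assumes u: "ptest u" and v: "ptest v"
  shows "ip (sph_lap u) v = 1/2 * (\<Sum>i\<in>UNIV. \<Sum>j\<in>UNIV. ip (rotd i j u) (rotd i j v))"
  using u v
  by (simp add: ptest_sph_lap_eq ip_cmult_left ip_sum_left ptest_sum ip_rotd[of "rotd _ _ u"] sum_negf del: of_real_minus of_real_divide)

lemma ip_sph_lap_commute: "ptest u \<Longrightarrow> ptest v \<Longrightarrow> ip (sph_lap u) v = ip u (sph_lap v)"
  by (simp add: ip_sph_lap ip_commute[of u "sph_lap v"] ip_commute[of "rotd _ _ u"])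

lemma ip_sph_lap_nonneg: "ptest u \<Longrightarrow> ip (sph_lap u) u \<ge> 0"
  by (simp add: ip_sph_lap sum_nonneg)

lemma euler_sph_lap_commute:
  assumes f: "ptest f"
  shows "euler (sph_lap f) = sph_lap (euler f)"
proof (rule ptest_eq_zero_at_0I)
  fix x :: "real^'a" assume x: "x \<noteq> 0"
  have eq: "euler (rotd i j (rotd i j f)) x = rotd i j (rotd i j (euler f)) x" for i j
  proof -
    have "euler (rotd i j (rotd i j f)) x = rotd i j (euler (rotd i j f)) x"
      using f x by (intro euler_rotd_commute) auto
    also have "\<dots> = rotd i j (rotd i j (euler f)) x"
      using f by (intro dir_cong euler_rotd_commute x) auto
    finally show ?thesis .
  qed
  have "euler (sph_lap f) x = of_real (- (1/2)) * (\<Sum>i\<in>UNIV. \<Sum>j\<in>UNIV. euler (rotd i j (rotd i j f)) x)"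
    using f x unfolding ptest_sph_lap_eq[OF f]
    by (simp add: dir_cmult dir_sum ptest_differentiable ptest_sum del: of_real_minus of_real_divide)
  then show "euler (sph_lap f) x = sph_lap (euler f) x"
    using f by (simp add: ptest_sph_lap_eq eq)
qed (use f in auto)

lemma sph_lap_add: "psmooth f \<Longrightarrow> psmooth g \<Longrightarrow> x \<noteq> 0 \<Longrightarrow> sph_lap (\<lambda>x. f x + g x) x = sph_lap f x + sph_lap g x"
proof -
  assume f: "psmooth f" and g: "psmooth g" and x: "x \<noteq> 0"
  have "rotd i j (rotd i j (\<lambda>x. f x + g x)) x = rotd i j (\<lambda>x. rotd i j f x + rotd i j g x) x" for i j
    using f g x by (intro dir_cong dir_add) auto
  then show ?thesis using f g x
    by (simp add: sph_lap_eq_sum_rotd psmooth_add dir_add psmooth_differentiable sum.distrib algebra_simps)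
qed

text \<open>A factor annihilated by all rotations passes through them like a scalar. This covers
  powers of |x|, radial bumps and constants.\<close>

lemma sph_lap_radial_mult:
  assumes w: "psmooth w" "\<And>i j x. x \<noteq> 0 \<Longrightarrow> rotd i j w x = 0" and f: "psmooth f" and x: "x \<noteq> 0"
  shows "sph_lap (\<lambda>x. w x * f x) x = w x * sph_lap f x"
proof -
  have 1: "rotd i j (\<lambda>x. w x * g x) x = w x * rotd i j g x" if "psmooth g" "x \<noteq> 0" for i j g x
    using w that by (simp add: dir_mult psmooth_differentiable)
  have "rotd i j (rotd i j (\<lambda>x. w x * f x)) x = rotd i j (\<lambda>x. w x * rotd i j f x) x" for i j
    using f x 1 by (intro dir_cong) auto
  then show ?thesis using w f x
    by (simp add: sph_lap_eq_sum_rotd psmooth_mult 1 sum_distrib_left algebra_simps)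
qed

lemma sph_lap_cmult: "psmooth f \<Longrightarrow> x \<noteq> 0 \<Longrightarrow> sph_lap (\<lambda>x. c * f x) x = c * sph_lap f x"
  by (rule sph_lap_radial_mult) auto

lemma rotd_rpow [simp]: "x \<noteq> 0 \<Longrightarrow> rotd i j (rpow s) x = 0"
  by (simp add: dir_rpow)

lemma euler_rpow: "x \<noteq> 0 \<Longrightarrow> euler (rpow s) x = of_real s * rpow s x"
  using rpow_add[of 2 x "s - 2"] by (simp add: dir_rpow rpow_2)

section \<open>The energy identity\<close>

text \<open>Lagrange's identity for \<open>x\<close> and the gradient: |x|^2 |p|^2 is |x . p|^2 plus
  the squares of all x_i p_j - x_j p_i with i < j.\<close>

lemma norm_grad_decomposition:
  fixes f :: "real^'n::finite \<Rightarrow> complex"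
  assumes "f differentiable (at x)"
  shows "(norm x)\<^sup>2 * (norm (grad f x))\<^sup>2 =
    (norm (euler f x))\<^sup>2 + 1/2 * (\<Sum>i\<in>UNIV. \<Sum>j\<in>UNIV. (norm (rotd i j f x))\<^sup>2)"
proof -
  let ?p = "\<lambda>i. partial_deriv i f x"
  define s where "s = (\<Sum>i\<in>UNIV. (x $ i)\<^sup>2)"
  define P where "P = (\<Sum>i\<in>UNIV. (norm (?p i))\<^sup>2)"
  define Q where "Q = (\<Sum>i\<in>UNIV. \<Sum>j\<in>UNIV. x $ i * x $ j * (?p i \<bullet> ?p j))"
  have "euler f x = (\<Sum>i\<in>UNIV. (x $ i) *\<^sub>R ?p i)"
    using assms by (simp add: euler_expand scaleR_conv_of_real)
  then have E: "(norm (euler f x))\<^sup>2 = Q"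
    by (simp add: power2_norm_eq_inner Q_def inner_sum_left inner_sum_right sum_distrib_left inner_commute mult_ac)
  have "(norm (rotd i j f x))\<^sup>2 = (x $ i)\<^sup>2 * (norm (?p j))\<^sup>2 + (x $ j)\<^sup>2 * (norm (?p i))\<^sup>2
      - x $ i * x $ j * (?p i \<bullet> ?p j) - x $ i * x $ j * (?p i \<bullet> ?p j)" for i j
  proof -
    have "rotd i j f x = (x $ i) *\<^sub>R ?p j - (x $ j) *\<^sub>R ?p i"
      using assms by (simp add: rotd_expand scaleR_conv_of_real)
    then show ?thesis
      by (simp only: power2_norm_eq_inner inner_diff_left inner_diff_right inner_scaleR_left inner_scaleR_right
          inner_commute[of "?p j" "?p i"]) (simp add: power2_eq_square algebra_simps)
  qed
  then have "(\<Sum>i\<in>UNIV. \<Sum>j\<in>UNIV. (norm (rotd i j f x))\<^sup>2) =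
      (\<Sum>i\<in>UNIV. \<Sum>j\<in>UNIV. (x $ i)\<^sup>2 * (norm (?p j))\<^sup>2) + (\<Sum>i\<in>UNIV. \<Sum>j\<in>UNIV. (x $ j)\<^sup>2 * (norm (?p i))\<^sup>2) - Q - Q"
    unfolding Q_def by (simp only: sum_subtractf sum.distrib)
  also have "(\<Sum>i\<in>UNIV. \<Sum>j\<in>UNIV. (x $ i)\<^sup>2 * (norm (?p j))\<^sup>2) = s * P"
    by (simp add: s_def P_def sum_product)
  also have "(\<Sum>i\<in>UNIV. \<Sum>j\<in>UNIV. (x $ j)\<^sup>2 * (norm (?p i))\<^sup>2) = s * P"
    by (subst sum.swap) (simp add: s_def P_def sum_product)
  finally have L: "(\<Sum>i\<in>UNIV. \<Sum>j\<in>UNIV. (norm (rotd i j f x))\<^sup>2) = 2 * (s * P) - 2 * Q" by simp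
  have "(norm x)\<^sup>2 = s"
    by (simp add: norm_vec_def L2_set_def s_def sum_nonneg)
  moreover have "(norm (grad f x))\<^sup>2 = P"
    by (simp add: norm_vec_def L2_set_def grad_def P_def sum_nonneg)
  ultimately show ?thesis unfolding E L by (simp add: field_simps)
qed

definition rellich_energy :: "real \<Rightarrow> (real^'n::finite \<Rightarrow> complex) \<Rightarrow> real" where
  "rellich_energy \<gamma> f = (\<integral>x. norm x powr \<gamma> * (norm (laplacian f x))\<^sup>2 \<partial>lborel)"

definition hardy_energy :: "real \<Rightarrow> (real^'n::finite \<Rightarrow> complex) \<Rightarrow> real" where
  "hardy_energy \<gamma> f = (\<integral>x. norm x powr (\<gamma> - 2) * (norm (grad f x))\<^sup>2 \<partial>lborel)"

lemma norm_rpow: "norm (rpow s x) = norm x powr s"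
  by (simp add: rpow_def)

lemma euler_rpow_mult:
  assumes "psmooth F" "x \<noteq> 0"
  shows "euler (\<lambda>x. rpow s x * F x) x = rpow s x * (euler F x + of_real s * F x)"
  using assms by (simp add: dir_mult psmooth_differentiable euler_rpow algebra_simps)

text \<open>Since |x|^2 times the Laplacian is E^2 + (n - 2) E - \<Lambda>, conjugation by |x|^s
  replaces E by E + s and leaves \<Lambda> alone.\<close>

lemma laplacian_rpow_mult:
  fixes F :: "real^'n::finite \<Rightarrow> complex"
  assumes F: "psmooth F" and x: "x \<noteq> 0"
  shows "rpow 2 x * laplacian (\<lambda>x. rpow s x * F x) x =
    rpow s x * (euler (euler F) x + of_real (2 * s + real CARD('n) - 2) * euler F x + of_real (s * (s + real CARD('n) - 2)) * F x - sph_lap F x)"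
proof -
  let ?f = "\<lambda>x. rpow s x * F x"
  have "euler (euler ?f) x = euler (\<lambda>x. rpow s x * (euler F x + of_real s * F x)) x"
    using F x by (intro dir_cong euler_rpow_mult) auto
  also have "\<dots> = rpow s x * (euler (\<lambda>x. euler F x + of_real s * F x) x + of_real s * (euler F x + of_real s * F x))"
    using F x by (intro euler_rpow_mult) auto
  also have "euler (\<lambda>x. euler F x + of_real s * F x) x = euler (euler F) x + of_real s * euler F x"
    using F x by (simp add: dir_add dir_cmult psmooth_differentiable psmooth_mult)
  finally have E2: "euler (euler ?f) x = rpow s x * (euler (euler F) x + of_real s * euler F x + of_real s * (euler F x + of_real s * F x))" .
  have L: "sph_lap ?f x = rpow s x * sph_lap F x"
    using F x by (intro sph_lap_radial_mult) auto
  have "rpow 2 x * laplacian ?f x = euler (euler ?f) x + of_real (real CARD('n) - 2) * euler ?f x - sph_lap ?f x"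
    by (simp add: sph_lap_def)
  then show ?thesis unfolding E2 L euler_rpow_mult[OF F x] by (simp add: algebra_simps)
qed

text \<open>The exponent \<open>s\<close> solves \<gamma> + 2 (s - 2) = - n, so the invariant weight
  is left over. The gradient leads to the same equation: its weight \<gamma> - 2 loses 2 through
  \<open>norm_grad_decomposition\<close> and gains 2 s.\<close>

lemma rellich_energy_rpow_mult:
  fixes F :: "real^'n::finite \<Rightarrow> complex" and \<gamma> :: real
  assumes F: "ptest F"
  defines "s \<equiv> - (real CARD('n) + \<gamma> - 4) / 2"
  defines "W \<equiv> \<lambda>x. euler (euler F) x + of_real (2 * s + real CARD('n) - 2) * euler F x + of_real (s * (s + real CARD('n) - 2)) * F x - sph_lap F x"
  shows "rellich_energy \<gamma> (\<lambda>x. rpow s x * F x) = ip W W"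
  unfolding rellich_energy_def ip_def
proof (rule Bochner_Integration.integral_cong)
  fix x :: "real^'n"
  show "norm x powr \<gamma> * (norm (laplacian (\<lambda>x. rpow s x * F x) x))\<^sup>2 = norm x powr - real CARD('n) * (W x \<bullet> W x)"
  proof (cases "x = 0")
    case False
    then have "norm x powr 2 * norm (laplacian (\<lambda>x. rpow s x * F x) x) = norm x powr s * norm (W x)"
      using arg_cong[OF laplacian_rpow_mult[OF ptest_psmooth[OF F], of x s], of norm]
      by (simp add: norm_rpow norm_mult W_def del: of_real_add of_real_diff of_real_mult)
    then have "norm (laplacian (\<lambda>x. rpow s x * F x) x) = norm x powr (s - 2) * norm (W x)"
      using False by (simp add: powr_diff field_simps)
    then have "norm x powr \<gamma> * (norm (laplacian (\<lambda>x. rpow s x * F x) x))\<^sup>2 =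
        norm x powr \<gamma> * (norm x powr (s - 2) * norm x powr (s - 2)) * (norm (W x))\<^sup>2"
      by (simp add: power2_eq_square)
    also have "norm x powr \<gamma> * (norm x powr (s - 2) * norm x powr (s - 2)) = norm x powr (- real CARD('n))"
      by (simp flip: powr_add) (simp add: s_def field_simps)
    finally show ?thesis by (simp add: power2_norm_eq_inner)
  qed simp
qed simp

lemma hardy_energy_rpow_mult:
  fixes F :: "real^'n::finite \<Rightarrow> complex" and \<gamma> :: real
  assumes F: "ptest F"
  defines "s \<equiv> - (real CARD('n) + \<gamma> - 4) / 2"
  defines "G \<equiv> \<lambda>x. euler F x + of_real s * F x"
  shows "hardy_energy \<gamma> (\<lambda>x. rpow s x * F x) = ip G G + ip (sph_lap F) F"
proof -
  let ?f = "\<lambda>x. rpow s x * F x" and ?w = "\<lambda>x::real^'n. norm x powr (- real CARD('n))"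
  have G: "ptest G" using F by (auto simp: G_def)
  have "hardy_energy \<gamma> ?f = (\<integral>x. ?w x * (G x \<bullet> G x) + 1/2 * (\<Sum>i\<in>UNIV. \<Sum>j\<in>UNIV. ?w x * (rotd i j F x \<bullet> rotd i j F x)) \<partial>lborel)"
    unfolding hardy_energy_def
  proof (rule Bochner_Integration.integral_cong)
    fix x :: "real^'n"
    show "norm x powr (\<gamma> - 2) * (norm (grad ?f x))\<^sup>2 =
      ?w x * (G x \<bullet> G x) + 1/2 * (\<Sum>i\<in>UNIV. \<Sum>j\<in>UNIV. ?w x * (rotd i j F x \<bullet> rotd i j F x))"
    proof (cases "x = 0")
      case False
      have rotd: "rotd i j ?f x = rpow s x * rotd i j F x" for i j
        using F False by (simp add: dir_mult psmooth_differentiable)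
      have E: "euler ?f x = rpow s x * G x" using F False by (simp add: euler_rpow_mult G_def)
      have "norm x powr 2 * (norm (grad ?f x))\<^sup>2 = (norm x powr s)\<^sup>2 * (norm (G x))\<^sup>2 +
          1/2 * (\<Sum>i\<in>UNIV. \<Sum>j\<in>UNIV. (norm x powr s)\<^sup>2 * (norm (rotd i j F x))\<^sup>2)"
        using norm_grad_decomposition[of ?f x] F False unfolding rotd E
        by (simp add: norm_rpow norm_mult power_mult_distrib powr_numeral psmooth_differentiable psmooth_mult)
      also have "\<dots> = norm x powr (2 * s) * ((norm (G x))\<^sup>2 + 1/2 * (\<Sum>i\<in>UNIV. \<Sum>j\<in>UNIV. (norm (rotd i j F x))\<^sup>2))"
        using powr_add[of "norm x" s s] by (simp add: power2_eq_square sum_distrib_left algebra_simps)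
      finally have "norm x powr (\<gamma> - 2) * (norm (grad ?f x))\<^sup>2 =
          norm x powr (\<gamma> - 4) * (norm x powr (2 * s) * ((norm (G x))\<^sup>2 + 1/2 * (\<Sum>i\<in>UNIV. \<Sum>j\<in>UNIV. (norm (rotd i j F x))\<^sup>2)))"
        using powr_add[of "norm x" "\<gamma> - 4" 2] by simp
      also have "\<dots> = ?w x * ((norm (G x))\<^sup>2 + 1/2 * (\<Sum>i\<in>UNIV. \<Sum>j\<in>UNIV. (norm (rotd i j F x))\<^sup>2))"
        unfolding mult.assoc[symmetric] powr_add[symmetric] by (simp add: s_def field_simps)
      finally show ?thesis by (simp add: power2_norm_eq_inner sum_distrib_left algebra_simps)
    qed (simp add: powr_def)
  qed simp
  also have "\<dots> = ip G G + 1/2 * (\<Sum>i\<in>UNIV. \<Sum>j\<in>UNIV. ip (rotd i j F) (rotd i j F))"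
    using F G by (simp add: ip_def)
  finally show ?thesis using F by (simp add: ip_sph_lap)
qed

text \<open>Because E is antisymmetric and commutes with \<Lambda>, the pairings of E F with F, with
  \<Lambda> F and with E^2 F vanish. The surviving cross term -2 <E^2 F, Z> contributes 2 <\<Lambda>
  E F, E F> and 2 a b ||E F||^2; the latter completes (b - a)^2 to a^2 + b^2.\<close>

lemma energy_identity:
  fixes F :: "real^'n::finite \<Rightarrow> complex" and \<gamma> :: real
  assumes F: "ptest F"
  defines "a \<equiv> (real CARD('n) + \<gamma> - 4) / 2" and "b \<equiv> (real CARD('n) - \<gamma>) / 2"
  defines "f \<equiv> \<lambda>x. rpow (- a) x * F x"
  defines "Z \<equiv> \<lambda>x. sph_lap F x + of_real (a * b) * F x"
  shows "rellich_energy \<gamma> f - C * hardy_energy \<gamma> f =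
    ip Z Z - C * (a\<^sup>2 * ip F F + ip (sph_lap F) F)
    + (a\<^sup>2 + b\<^sup>2 - C) * ip (euler F) (euler F) + 2 * ip (sph_lap (euler F)) (euler F) + ip (euler (euler F)) (euler (euler F))"
proof -
  have s: "- (real CARD('n) + \<gamma> - 4) / 2 = - a" by (simp add: a_def field_simps)
  have ab: "2 * (- a) + real CARD('n) - 2 = b - a" "(- a) * (- a + real CARD('n) - 2) = - (a * b)"
    by (simp_all add: a_def b_def field_simps)
  have Z: "ptest Z" using F by (auto simp: Z_def)
  have anti: "ip (euler u) u = 0" "ip u (euler u) = 0" if "ptest u" for u :: "real^'n \<Rightarrow> complex"
    using ip_euler[OF that that] ip_commute[of "euler u" u] by simp_all
  have EZ: "euler Z = (\<lambda>x. sph_lap (euler F) x + of_real (a * b) * euler F x)"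
    using F by (simp add: Z_def fun_eq_iff dir_add dir_cmult ptest_differentiable ptest_cmult euler_sph_lap_commute del: of_real_mult)
  have c1: "ip (euler F) Z = 0"
  proof -
    have "ip (euler F) (sph_lap F) = - ip F (sph_lap (euler F))" using F by (simp add: ip_euler euler_sph_lap_commute)
    also have "\<dots> = - ip (euler F) (sph_lap F)" using F by (simp add: ip_sph_lap_commute[symmetric] ip_commute)
    finally have "ip (euler F) (sph_lap F) = 0" by simp
    then show ?thesis using F by (simp add: Z_def ip_add_right ptest_cmult ip_cmult_right anti del: of_real_mult)
  qed
  have c2: "ip (euler (euler F)) Z = - ip (sph_lap (euler F)) (euler F) - a * b * ip (euler F) (euler F)"
    using F Z by (simp add: ip_euler[of "euler F"] EZ ip_add_right ptest_cmult ip_cmult_right ip_commute[of "euler F" "sph_lap (euler F)"] del: of_real_mult)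
  let ?W = "\<lambda>x. euler (euler F) x + of_real (b - a) * euler F x - Z x"
  have W: "(\<lambda>x. euler (euler F) x + of_real (b - a) * euler F x + of_real (- (a * b)) * F x - sph_lap F x) = ?W"
    by (simp add: fun_eq_iff Z_def algebra_simps)
  have "rellich_energy \<gamma> f = ip ?W ?W"
    using rellich_energy_rpow_mult[OF F, of \<gamma>] unfolding s f_def ab W .
  also have "\<dots> = ip (euler (euler F)) (euler (euler F)) + (b - a)\<^sup>2 * ip (euler F) (euler F) + ip Z Z - 2 * ip (euler (euler F)) Z"
  proof -
    define u v where "u = euler (euler F)" and "v = euler F"
    have uv: "ptest u" "ptest v" using F by (auto simp: u_def v_def)
    have [simp]: "ip u v = 0" "ip v u = 0" "ip v Z = 0" "ip Z v = 0" "ip Z u = ip u Z"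
      using anti[of "euler F"] c1 F by (simp_all add: u_def v_def ip_commute[of Z])
    have "ip (\<lambda>x. u x + of_real (b - a) * v x - Z x) (\<lambda>x. u x + of_real (b - a) * v x - Z x)
        = ip u u + (b - a)\<^sup>2 * ip v v + ip Z Z - 2 * ip u Z"
      using uv Z by (simp add: ip_add_left ip_add_right ip_diff_left ip_diff_right ip_cmult_left ip_cmult_right
          ptest_add ptest_diff ptest_cmult power2_eq_square del: of_real_diff)
    then show ?thesis by (simp only: u_def v_def)
  qed
  finally have R: "rellich_energy \<gamma> f = \<dots>" .
  have H: "hardy_energy \<gamma> f = ip (euler F) (euler F) + a\<^sup>2 * ip F F + ip (sph_lap F) F"
    using hardy_energy_rpow_mult[OF F, of \<gamma>] F anti[of F] unfolding s f_def
    by (simp add: ip_add_left ip_add_right ip_cmult_left ip_cmult_right ptest_add ptest_cmult power2_eq_square del: of_real_minus)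
  show ?thesis unfolding R H c2 by (simp add: power2_eq_square algebra_simps)
qed

section \<open>Smooth radial bumps\<close>

text \<open>The flat function exp (- 1/t) over t^m. Derivatives of members of this family are linear
  combinations of members, which turns smoothness into an induction.\<close>

definition psi :: "nat \<Rightarrow> real \<Rightarrow> real" where
  "psi m t = (if t > 0 then exp (- (1 / t)) / t ^ m else 0)"

text \<open>This is the difference quotient of \<open>psi m\<close> at 0; the exponential beats
  every power of 1/t.\<close>

lemma psi_over_tendsto_0: "((\<lambda>t. psi m t / t) \<longlongrightarrow> 0) (at 0)"
proof -
  have "((\<lambda>u::real. u ^ Suc m / exp u) \<longlongrightarrow> 0) at_top" by (rule tendsto_power_div_exp_0)
  from filterlim_compose[OF this filterlim_inverse_at_top_right]
  have "((\<lambda>t::real. inverse t ^ Suc m / exp (inverse t)) \<longlongrightarrow> 0) (at_right 0)" .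
  moreover have "\<forall>\<^sub>F t in at_right 0. inverse t ^ Suc m / exp (inverse t) = psi m t / t"
    unfolding eventually_at_right_field
    by (intro exI[of _ 1]) (auto simp: psi_def exp_minus divide_inverse power_inverse[symmetric] mult_ac)
  ultimately have "((\<lambda>t. psi m t / t) \<longlongrightarrow> 0) (at_right 0)"
    by (rule Lim_transform_eventually)
  moreover have "((\<lambda>t. psi m t / t) \<longlongrightarrow> 0) (at_left 0)"
  proof (rule Lim_transform_eventually[OF tendsto_const])
    show "\<forall>\<^sub>F t in at_left 0. 0 = psi m t / t"
      unfolding eventually_at_left_field by (intro exI[of _ "-1"]) (auto simp: psi_def)
  qed
  ultimately show ?thesis by (simp add: filterlim_split_at)
qed

lemma psi_has_derivative:
  "(psi m has_real_derivative psi (m + 2) t - real m * psi (m + 1) t) (at t)"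
proof (cases t "0::real" rule: linorder_cases)
  case less
  have "((\<lambda>_. 0) has_real_derivative 0) (at t)" by simp
  then show ?thesis
    using less has_field_derivative_transform_within_open[of "\<lambda>_. 0" 0 t "{..<0}" "psi m"]
    by (simp add: psi_def)
next
  case equal
  have "((\<lambda>h. (psi m (0 + h) - psi m 0) / h) \<longlongrightarrow> 0) (at 0)"
    using psi_over_tendsto_0[of m] by (simp add: psi_def[of m 0])
  then show ?thesis by (simp add: DERIV_def equal psi_def[of _ 0])
next
  case greater
  have "((\<lambda>t. exp (- (1 / t)) / t ^ m) has_real_derivative psi (m + 2) t - real m * psi (m + 1) t) (at t)"
    using greater
    by (auto intro!: derivative_eq_intros simp: psi_def field_simps power2_eq_square power_eq_if[of t m])
  then show ?thesis
    using greater has_field_derivative_transform_within_open[of "\<lambda>t. exp (- (1 / t)) / t ^ m" _ t "{0<..}" "psi m"]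
    by (simp add: psi_def[of m])
qed

lemma psi_0_bounds: "psi 0 t \<ge> 0" "psi 0 t \<le> 1" "psi 0 t > 0 \<longleftrightarrow> t > 0"
  by (auto simp: psi_def)

text \<open>Smoothness is formulated for complex functions only. Taking real parts recovers the
  derivative of the real function \<open>q\<close> and shows that the derivative of its embedding is
  real valued.\<close>

lemma has_derivative_of_real_compose:
  assumes h: "(h has_real_derivative h') (at (q x))" and q: "(\<lambda>x. complex_of_real (q x)) differentiable (at x)"
  shows "((\<lambda>x. complex_of_real (h (q x))) has_derivative
    (\<lambda>v. of_real h' * frechet_derivative (\<lambda>x. complex_of_real (q x)) (at x) v)) (at x)"
proof -
  let ?Q = "frechet_derivative (\<lambda>x. complex_of_real (q x)) (at x)"
  have Q: "((\<lambda>x. complex_of_real (q x)) has_derivative ?Q) (at x)"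
    using q by (simp add: frechet_derivative_works)
  from bounded_linear.has_derivative[OF bounded_linear_Re Q]
  have q': "(q has_derivative (\<lambda>v. Re (?Q v))) (at x)" by simp
  then have "((\<lambda>x. complex_of_real (q x)) has_derivative (\<lambda>v. of_real (Re (?Q v)))) (at x)"
    by (rule bounded_linear.has_derivative[OF bounded_linear_of_real])
  then have eq: "?Q = (\<lambda>v. of_real (Re (?Q v)))"
    using Q by (rule has_derivative_unique[rotated])
  have "((\<lambda>x. h (q x)) has_derivative (\<lambda>v. h' * Re (?Q v))) (at x)"
    using has_derivative_compose[OF q' h[unfolded has_field_derivative_def]] by simp
  then have "((\<lambda>x. complex_of_real (h (q x))) has_derivative (\<lambda>v. of_real (h' * Re (?Q v)))) (at x)"
    by (rule bounded_linear.has_derivative[OF bounded_linear_of_real])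
  also have "(\<lambda>v. complex_of_real (h' * Re (?Q v))) = (\<lambda>v. of_real h' * ?Q v)"
    by (subst (2) eq) simp
  finally show ?thesis .
qed

lemma dir_of_real_compose:
  assumes "(h has_real_derivative h') (at (q x))" "(\<lambda>x. complex_of_real (q x)) differentiable (at x)"
  shows "dir T (\<lambda>x. complex_of_real (h (q x))) x = of_real h' * dir T (\<lambda>x. complex_of_real (q x)) x"
  using dir_eq[OF has_derivative_of_real_compose[OF assms]] by (simp add: dir_def)

lemma psmooth_psi_compose:
  fixes q :: "real^'n::finite \<Rightarrow> real"
  assumes q: "psmooth (\<lambda>x. complex_of_real (q x))"
  shows "psmooth (\<lambda>x. complex_of_real (psi m (q x)))"
proof -
  have diff: "(\<lambda>x. complex_of_real (psi m (q x))) differentiable (at x)" if "x \<noteq> 0" for m x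
    using has_derivative_of_real_compose[of "psi m" _ q x, OF psi_has_derivative] q that
    unfolding differentiable_def by (metis differentiable_def psmooth_differentiable)
  have "punctured_C k (\<lambda>x. complex_of_real (psi m (q x)))" for k
  proof (induction k arbitrary: m)
    case 0
    show ?case using diff unfolding punctured_C.simps
      by (intro continuous_at_imp_continuous_on ballI differentiable_imp_continuous_within) blast
  next
    case (Suc k)
    have "punctured_C k (partial_deriv i (\<lambda>x. complex_of_real (psi m (q x))))" for i
    proof (rule punctured_C_cong)
      have 1: "punctured_C k (partial_deriv i (\<lambda>x. complex_of_real (q x)))"
        using q by (auto simp: psmooth_def dest: psmooth_partial_deriv[unfolded psmooth_def])
      have 2: "punctured_C k (\<lambda>_::real^'n. complex_of_real (- real m))"
        using psmooth_const unfolding psmooth_def by blast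
      show "punctured_C k (\<lambda>x. (complex_of_real (psi (m + 2) (q x)) + of_real (- real m) * of_real (psi (m + 1) (q x))) *
          partial_deriv i (\<lambda>x. complex_of_real (q x)) x)"
        by (intro punctured_C_mult punctured_C_add Suc 1 2)
      show "(complex_of_real (psi (m + 2) (q x)) + of_real (- real m) * of_real (psi (m + 1) (q x))) *
          partial_deriv i (\<lambda>x. complex_of_real (q x)) x = partial_deriv i (\<lambda>x. complex_of_real (psi m (q x))) x"
        if "x \<noteq> 0" for x
        using q that unfolding partial_deriv_eq_dir
        by (simp add: dir_of_real_compose[OF psi_has_derivative] psmooth_differentiable)
    qed
    then show ?case using diff by simp
  qed
  then show ?thesis by (simp add: psmooth_def)
qed

text \<open>The value at the origin is fixed explicitly because \<open>ln 0 = 0\<close>.\<close>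

definition radial :: "(real \<Rightarrow> real) \<Rightarrow> real^'n::finite \<Rightarrow> complex" where
  "radial h x = (if x = 0 then 0 else of_real (h (ln (norm x))))"

text \<open>For \<open>p \<le> q\<close> the argument of \<open>psi 0\<close> is positive exactly
  when \<open>c * t\<close> lies strictly between \<open>p\<close> and \<open>q\<close>. A small
  \<open>c\<close> stretches the bump in the logarithmic variable.\<close>

definition bump :: "real \<Rightarrow> real \<Rightarrow> real \<Rightarrow> real \<Rightarrow> real" where
  "bump p q c t = psi 0 ((c * t - p) * (q - c * t))"

lemma dir_radial:
  assumes "x \<noteq> 0" "(h has_real_derivative h') (at (ln (norm x)))"
  shows "dir T (radial h) x = of_real (h' * (x \<bullet> T x)) * rpow (-2) x"
proof -
  have "dir T (radial h) x = dir T (\<lambda>x. of_real (h (ln (norm x)))) x"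
    using assms(1) by (intro dir_cong) (auto simp: radial_def)
  also have "\<dots> = of_real h' * (of_real (x \<bullet> T x) * rpow (-2) x)"
    using assms
    by (subst dir_of_real_compose[where q = "\<lambda>x. ln (norm x)" and h = h and h' = h'])
      (auto simp: psmooth_differentiable dir_ln_norm)
  finally show ?thesis by simp
qed

lemma rotd_radial: "x \<noteq> 0 \<Longrightarrow> (h has_real_derivative h') (at (ln (norm x))) \<Longrightarrow> rotd i j (radial h) x = 0"
  by (simp add: dir_radial)

lemma euler_radial: "x \<noteq> 0 \<Longrightarrow> (h has_real_derivative h') (at (ln (norm x))) \<Longrightarrow> euler (radial h) x = of_real h'"
  using rpow_add[of 2 x "-2"] by (simp add: dir_radial rpow_2 rpow_0 mult.assoc)

lemma bump_has_derivative:
  "(bump p q c has_real_derivative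
    psi 2 ((c * t - p) * (q - c * t)) * (c * (q - c * t) - c * (c * t - p))) (at t)"
proof -
  have "((\<lambda>t. (c * t - p) * (q - c * t)) has_real_derivative c * (q - c * t) - c * (c * t - p)) (at t)"
    by (auto intro!: derivative_eq_intros simp: algebra_simps)
  from DERIV_chain2[OF psi_has_derivative[of 0] this] show ?thesis
    by (simp add: bump_def[abs_def] numeral_2_eq_2)
qed

lemma bump_pos_iff: "p \<le> q \<Longrightarrow> bump p q c t > 0 \<longleftrightarrow> p < c * t \<and> c * t < q"
  by (auto simp: bump_def psi_0_bounds zero_less_mult_iff)

lemma bump_bounds: "bump p q c t \<ge> 0" "bump p q c t \<le> 1"
  by (simp_all add: bump_def psi_0_bounds)

lemma bump_eq_0: "p \<le> q \<Longrightarrow> \<not> (p < c * t \<and> c * t < q) \<Longrightarrow> bump p q c t = 0"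
  using bump_pos_iff[of p q c t] bump_bounds(1)[of p q c t] by linarith

lemma psmooth_radial_bump: "psmooth (radial (bump p q c))"
proof (rule psmooth_cong)
  show "psmooth (\<lambda>x::real^'n. complex_of_real (psi 0 ((c * ln (norm x) - p) * (q - c * ln (norm x)))))"
    by (rule psmooth_psi_compose) auto
qed (auto simp: radial_def bump_def)

lemma ptest_radial_bump:
  assumes "p \<le> q" "c > 0"
  shows "ptest (radial (bump p q c))"
proof (rule ptestI)
  show "radial (bump p q c) x = 0" if "norm x < exp (p / c)" for x :: "real^'n"
  proof (cases "x = 0")
    case False
    then have "ln (norm x) < p / c" using that by (metis exp_less_cancel_iff exp_ln zero_less_norm_iff)
    then show ?thesis using assms by (simp add: radial_def bump_eq_0 field_simps)
  qed (simp add: radial_def)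
  show "radial (bump p q c) x = 0" if "norm x > exp (q / c)" for x :: "real^'n"
  proof (cases "x = 0")
    case False
    then have "ln (norm x) > q / c" using that by (metis exp_less_cancel_iff exp_ln zero_less_norm_iff)
    then show ?thesis using assms by (simp add: radial_def bump_eq_0 field_simps)
  qed (simp add: radial_def)
qed (auto simp: psmooth_radial_bump)

text \<open>Rotation invariance is stated infinitesimally, the form that
  \<open>sph_lap_radial_mult\<close> consumes. The class is stable under powers of |x|, as the
  recursion in \<open>eigspan_hom\<close> demands.\<close>

definition rtest :: "(real^'n::finite \<Rightarrow> complex) \<Rightarrow> bool" where
  "rtest w \<longleftrightarrow> ptest w \<and> (\<forall>i j x. x \<noteq> 0 \<longrightarrow> rotd i j w x = 0)"

lemma rtest_radial_bump: "p \<le> q \<Longrightarrow> c > 0 \<Longrightarrow> rtest (radial (bump p q c))"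
  using rotd_radial[OF _ bump_has_derivative] by (auto simp: rtest_def ptest_radial_bump)

lemma rtest_mult_rpow: "rtest w \<Longrightarrow> rtest (\<lambda>x. w x * rpow s x)"
  by (auto simp: rtest_def dir_mult psmooth_differentiable)

section \<open>Homogeneous polynomials and eigenfunctions\<close>

text \<open>Homogeneous polynomials as functions, generated so that rule induction replaces any
  handling of coefficients. The zero function belongs to every degree.\<close>

inductive hom :: "nat \<Rightarrow> (real^'n::finite \<Rightarrow> complex) \<Rightarrow> bool" where
  hom_const: "hom 0 (\<lambda>_. c)"
| hom_coord: "hom m p \<Longrightarrow> hom (Suc m) (\<lambda>x. of_real (x $ i) * p x)"
| hom_add: "hom m p \<Longrightarrow> hom m q \<Longrightarrow> hom m (\<lambda>x. p x + q x)"

lemma hom_zero [simp, intro]: "hom m (\<lambda>_. 0)"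
proof (induction m)
  case (Suc m)
  from hom_coord[OF this] show ?case by simp
qed (rule hom_const)

lemma hom_sum: "(\<And>i. i \<in> I \<Longrightarrow> hom m (p i)) \<Longrightarrow> hom m (\<lambda>x. \<Sum>i\<in>I. p i x)"
  by (induction I rule: infinite_finite_induct) (auto intro: hom_add)

lemma hom_cmult: "hom m p \<Longrightarrow> hom m (\<lambda>x. c * p x)"
proof (induction rule: hom.induct)
  case (hom_coord m p i)
  from hom.hom_coord[OF hom_coord.IH] show ?case by (simp add: mult_ac)
qed (auto simp: distrib_left intro: hom.intros)

lemma hom_mult: "hom m p \<Longrightarrow> hom k q \<Longrightarrow> hom (m + k) (\<lambda>x. p x * q x)"
proof (induction rule: hom.induct)
  case (hom_coord m p i)
  from hom.hom_coord[OF hom_coord.IH] hom_coord.prems show ?case by (simp add: mult_ac)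
qed (auto simp: distrib_right intro: hom.intros hom_cmult)

lemma hom_psmooth [intro, simp]: "hom m p \<Longrightarrow> psmooth p"
  by (induction rule: hom.induct) auto

lemma hom_euler: "hom m p \<Longrightarrow> x \<noteq> 0 \<Longrightarrow> euler p x = of_nat m * p x"
  by (induction rule: hom.induct)
    (auto simp: dir_mult dir_add psmooth_differentiable algebra_simps)

text \<open>Natural subtraction sends degree 0 to degree 0, hence the separate clause for a
  vanishing derivative; through it second derivatives vanish in degree 1 too.\<close>

lemma hom_partial_deriv:
  "hom m p \<Longrightarrow> \<exists>q. hom (m - 1) q \<and> (m = 0 \<longrightarrow> q = (\<lambda>_. 0)) \<and> (\<forall>x. x \<noteq> 0 \<longrightarrow> partial_deriv k p x = q x)"
proof (induction rule: hom.induct)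
  case (hom_const c)
  then show ?case by (auto simp: partial_deriv_eq_dir)
next
  case (hom_coord m p i)
  then obtain q where q: "hom (m - 1) q" "m = 0 \<Longrightarrow> q = (\<lambda>_. 0)" "\<And>x. x \<noteq> 0 \<Longrightarrow> partial_deriv k p x = q x"
    by blast
  have "hom m (\<lambda>x. of_real (x $ i) * q x)"
  proof (cases m)
    case 0
    then show ?thesis using q(2) by simp
  next
    case (Suc m')
    then show ?thesis using hom.hom_coord[OF q(1)] by simp
  qed
  then have "hom m (\<lambda>x. (if k = i then 1 else 0) * p x + of_real (x $ i) * q x)"
    by (intro hom_add hom_cmult hom_coord)
  moreover have "partial_deriv k (\<lambda>x. of_real (x $ i) * p x) x = (if k = i then 1 else 0) * p x + of_real (x $ i) * q x"
    if "x \<noteq> 0" for x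
    using that hom_coord(1) q(3) by (simp add: partial_deriv_coord_mult)
  ultimately show ?case by auto
next
  case (hom_add m p p')
  then obtain q q' where q: "hom (m - 1) q" "m = 0 \<Longrightarrow> q = (\<lambda>_. 0)" "\<And>x. x \<noteq> 0 \<Longrightarrow> partial_deriv k p x = q x"
      "hom (m - 1) q'" "m = 0 \<Longrightarrow> q' = (\<lambda>_. 0)" "\<And>x. x \<noteq> 0 \<Longrightarrow> partial_deriv k p' x = q' x"
    by blast
  have "partial_deriv k (\<lambda>x. p x + p' x) x = q x + q' x" if "x \<noteq> 0" for x
    using q that hom_add(1,2) by (simp add: partial_deriv_eq_dir dir_add psmooth_differentiable)
  then show ?case using q by (intro exI[of _ "\<lambda>x. q x + q' x"]) (auto intro: hom.hom_add)
qed

lemma hom_laplacian: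
  assumes "hom m p"
  shows "\<exists>q. hom (m - 2) q \<and> (m < 2 \<longrightarrow> q = (\<lambda>_. 0)) \<and> (\<forall>x. x \<noteq> 0 \<longrightarrow> laplacian p x = q x)"
proof -
  have "\<exists>q. hom (m - 2) q \<and> (m < 2 \<longrightarrow> q = (\<lambda>_. 0)) \<and> (\<forall>x. x \<noteq> 0 \<longrightarrow> partial_deriv i (partial_deriv i p) x = q x)" for i
  proof -
    obtain q where q: "hom (m - 1) q" "m = 0 \<Longrightarrow> q = (\<lambda>_. 0)" "\<And>x. x \<noteq> 0 \<Longrightarrow> partial_deriv i p x = q x"
      using hom_partial_deriv[OF assms, of i] by blast
    obtain q' where "hom (m - 1 - 1) q' \<and> (m - 1 = 0 \<longrightarrow> q' = (\<lambda>_. 0)) \<and> (\<forall>x. x \<noteq> 0 \<longrightarrow> partial_deriv i q x = q' x)"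
      using hom_partial_deriv[OF q(1), of i] ..
    then have q': "hom (m - 1 - 1) q'" "m - 1 = 0 \<Longrightarrow> q' = (\<lambda>_. 0)" "\<And>x. x \<noteq> 0 \<Longrightarrow> partial_deriv i q x = q' x"
      by simp_all
    have "partial_deriv i (partial_deriv i p) x = q' x" if "x \<noteq> 0" for x
      using partial_deriv_cong[OF q(3) that, where i = i] q'(3)[OF that] by simp
    moreover have "m - 1 - 1 = m - 2" "m < 2 \<longleftrightarrow> m - 1 = 0" by auto
    ultimately show ?thesis using q'(1,2) by metis
  qed
  then obtain q where q: "\<And>i. hom (m - 2) (q i)" "\<And>i. m < 2 \<Longrightarrow> q i = (\<lambda>_. 0)"
      "\<And>i x. x \<noteq> 0 \<Longrightarrow> partial_deriv i (partial_deriv i p) x = q i x"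
    by metis
  have "hom (m - 2) (\<lambda>x. \<Sum>i\<in>UNIV. q i x)" using q(1) by (rule hom_sum)
  moreover have "laplacian p x = (\<Sum>i\<in>UNIV. q i x)" if "x \<noteq> 0" for x
    using q(3)[OF that] by (simp add: laplacian_def)
  moreover have "m < 2 \<Longrightarrow> (\<lambda>x. \<Sum>i\<in>UNIV. q i x) = (\<lambda>_. 0)" using q(2) by simp
  ultimately show ?thesis by blast
qed

definition eig :: "nat \<Rightarrow> (real^'n::finite \<Rightarrow> complex) \<Rightarrow> bool" where
  "eig j v \<longleftrightarrow> ptest v \<and> sph_lap v = (\<lambda>x. of_real (lam CARD('n) j) * v x)"

text \<open>One summand, possibly zero, for each degree below \<open>m\<close>. Grouping by degree
  makes distinct summands orthogonal.\<close>

definition eigspan :: "nat \<Rightarrow> (real^'n::finite \<Rightarrow> complex) \<Rightarrow> bool" where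
  "eigspan m u \<longleftrightarrow> (\<exists>v. (\<forall>j. eig j (v j)) \<and> u = (\<lambda>x. \<Sum>j<m. v j x))"

section \<open>Linearity and sums of eigenfunctions\<close>

lemma eig_ptest [intro, simp]: "eig j v \<Longrightarrow> ptest v"
  by (simp add: eig_def)

lemma sph_lap_zero [simp]: "sph_lap (\<lambda>_::real^'n::finite. 0) = (\<lambda>_. 0)"
proof
  show "sph_lap (\<lambda>_. 0) x = 0" for x :: "real^'n"
    by (cases "x = 0") (auto simp: sph_lap_eq_sum_rotd)
qed

lemma eig_zero [simp]: "eig j (\<lambda>_. 0)"
  by (simp add: eig_def)

lemma ptest_sph_lap_add: "ptest f \<Longrightarrow> ptest g \<Longrightarrow> sph_lap (\<lambda>x. f x + g x) = (\<lambda>x. sph_lap f x + sph_lap g x)"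
  by (rule ptest_eq_zero_at_0I) (auto simp: sph_lap_add)

lemma ptest_sph_lap_cmult: "ptest f \<Longrightarrow> sph_lap (\<lambda>x. c * f x) = (\<lambda>x. c * sph_lap f x)"
  by (rule ptest_eq_zero_at_0I) (auto simp: sph_lap_cmult)

lemma ptest_sph_lap_sum:
  "(\<And>i. i \<in> I \<Longrightarrow> ptest (f i)) \<Longrightarrow> sph_lap (\<lambda>x. \<Sum>i\<in>I. f i x) = (\<lambda>x. \<Sum>i\<in>I. sph_lap (f i) x)"
proof (induction I rule: infinite_finite_induct)
  case (insert i I)
  then show ?case by (simp add: ptest_sph_lap_add ptest_sum)
qed auto

lemma eig_cmult: "eig j v \<Longrightarrow> eig j (\<lambda>x. c * v x)"
  by (auto simp: eig_def ptest_sph_lap_cmult)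

lemma eig_add: "eig j v \<Longrightarrow> eig j w \<Longrightarrow> eig j (\<lambda>x. v x + w x)"
  by (auto simp: eig_def ptest_sph_lap_add distrib_left)

lemma eigspan_add:
  assumes "eigspan m u" "eigspan k v"
  shows "eigspan (max m k) (\<lambda>x. u x + v x)"
proof -
  obtain a b where ab: "\<And>j. eig j (a j)" "\<And>j. eig j (b j)" "u = (\<lambda>x. \<Sum>j<m. a j x)" "v = (\<lambda>x. \<Sum>j<k. b j x)"
    using assms by (auto simp: eigspan_def)
  define c where "c j x = (if j < m then a j x else 0) + (if j < k then b j x else 0)" for j x
  have "eig j (c j)" for j
  proof -
    have "eig j (\<lambda>x. if j < m then a j x else 0)" "eig j (\<lambda>x. if j < k then b j x else 0)"
      using ab by (cases "j < m"; cases "j < k"; simp)+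
    then show ?thesis unfolding c_def[abs_def] by (rule eig_add)
  qed
  moreover have "u x + v x = (\<Sum>j<max m k. c j x)" for x
  proof -
    have "(\<Sum>j<max m k. if j < m then a j x else 0) = (\<Sum>j<m. a j x)"
      by (rule sum.mono_neutral_cong_right) auto
    moreover have "(\<Sum>j<max m k. if j < k then b j x else 0) = (\<Sum>j<k. b j x)"
      by (rule sum.mono_neutral_cong_right) auto
    ultimately show ?thesis by (simp add: ab c_def sum.distrib)
  qed
  ultimately show ?thesis unfolding eigspan_def by auto
qed

lemma lam_strict_mono:
  assumes "n \<ge> 2" "i < j"
  shows "lam n i < lam n j"
proof -
  have "real i * (real i + real n - 2) \<le> real i * (real j + real n - 2)"
    using assms by (intro mult_left_mono) auto
  also have "\<dots> < real j * (real j + real n - 2)"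
    using assms by (intro mult_strict_right_mono) auto
  finally show ?thesis by (simp add: lam_def)
qed

lemma lam_nonneg: "n \<ge> 2 \<Longrightarrow> lam n j \<ge> 0"
  by (simp add: lam_def)

text \<open>By Euler's relation E acts as m, and m^2 + (n - 2) m = \<open>lam n m\<close>. In
  particular harmonic homogeneous polynomials are eigenfunctions off the origin.\<close>

lemma sph_lap_hom:
  fixes p :: "real^'n::finite \<Rightarrow> complex"
  assumes "hom m p" "x \<noteq> 0"
  shows "sph_lap p x = of_real (lam CARD('n) m) * p x - rpow 2 x * laplacian p x"
proof -
  have "euler (euler p) x = euler (\<lambda>x. of_nat m * p x) x"
    using assms by (intro dir_cong hom_euler) auto
  also have "\<dots> = of_nat m * (of_nat m * p x)"
    using assms by (simp add: dir_cmult hom_euler psmooth_differentiable)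
  finally show ?thesis using assms by (simp add: sph_lap_def hom_euler lam_def algebra_simps)
qed

text \<open>The operator \<open>sph_lap - \<lambda>\<^sub>m\<close> maps \<open>w p\<close> to \<open>- w |x|\<^sup>2 \<Delta> p\<close>, where \<open>\<Delta> p\<close> has lower degree.\<close>

lemma eigspan_hom:
  fixes p w :: "real^'n::finite \<Rightarrow> complex"
  assumes n: "CARD('n) \<ge> 2"
  shows "hom m p \<Longrightarrow> rtest w \<Longrightarrow> eigspan (Suc m) (\<lambda>x. w x * p x)"
proof (induction m arbitrary: p w rule: less_induct)
  case (less m)
  obtain q where q: "hom (m - 2) q" "m < 2 \<Longrightarrow> q = (\<lambda>_. 0)" "\<And>x. x \<noteq> 0 \<Longrightarrow> laplacian p x = q x"
    using hom_laplacian[OF less.prems(1)] by blast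
  let ?l = "lam CARD('n)"
  have w: "ptest w" "\<And>i j x. x \<noteq> 0 \<Longrightarrow> rotd i j w x = 0" using less.prems by (auto simp: rtest_def)
  have wp: "ptest (\<lambda>x. w x * p x)" using w less.prems by auto
  have "\<exists>v. (\<forall>j. eig j (v j)) \<and> (\<lambda>x. (w x * rpow 2 x) * q x) = (\<lambda>x. \<Sum>j<m. v j x)"
  proof (cases "m < 2")
    case True
    then show ?thesis using q(2) by (intro exI[of _ "\<lambda>_ _. 0"]) auto
  next
    case False
    then have "eigspan (Suc (m - 2)) (\<lambda>x. (w x * rpow 2 x) * q x)"
      using q(1) less.prems by (intro less.IH rtest_mult_rpow) auto
    \<comment> \<open>Adding zero pads the index bound from m - 1 to m.\<close>
    moreover have "eigspan m (\<lambda>_::real^'n. 0)"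
      unfolding eigspan_def by (intro exI[of _ "\<lambda>_ _. 0"]) auto
    ultimately have "eigspan (max (Suc (m - 2)) m) (\<lambda>x. (w x * rpow 2 x) * q x + 0)"
      by (rule eigspan_add)
    moreover have "max (Suc (m - 2)) m = m" using False by auto
    ultimately show ?thesis by (simp add: eigspan_def)
  qed
  then obtain v where v: "\<And>j. eig j (v j)" "\<And>x. w x * rpow 2 x * q x = (\<Sum>j<m. v j x)"
    by (auto simp: fun_eq_iff)
  \<comment> \<open>These factors solve (\<Lambda> - \<lambda>_m) u = - \<Sigma> v_j summand by
    summand; no denominator vanishes as the eigenvalues are distinct. The function w p satisfies the
    same equation, so \<open>z\<close>, the difference w p - u, is an eigenfunction of degree
    m.\<close>
  define c where "c j = 1 / (?l m - ?l j)" for j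
  define u where "u x = (\<Sum>j<m. complex_of_real (c j) * v j x)" for x
  have u: "ptest u" unfolding u_def[abs_def] using v by (intro ptest_sum ptest_cmult) auto
  have Lu: "sph_lap u x = of_real (?l m) * u x - (\<Sum>j<m. v j x)" for x
  proof -
    have "sph_lap u x = (\<Sum>j<m. sph_lap (\<lambda>x. complex_of_real (c j) * v j x) x)"
      unfolding u_def[abs_def] using v by (subst ptest_sph_lap_sum) auto
    also have "\<dots> = (\<Sum>j<m. of_real (?l m) * (of_real (c j) * v j x) - v j x)"
    proof (rule sum.cong)
      fix j assume "j \<in> {..<m}"
      then have "?l m - ?l j \<noteq> 0" using lam_strict_mono[OF n, of j m] by simp
      then have "?l j * c j = ?l m * c j - 1" by (simp add: c_def field_simps)
      then have *: "complex_of_real (?l j) * of_real (c j) = of_real (?l m) * of_real (c j) - 1"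
        by (metis of_real_1 of_real_diff of_real_mult)
      have "sph_lap (\<lambda>x. complex_of_real (c j) * v j x) x = (complex_of_real (?l j) * of_real (c j)) * v j x"
        using eig_cmult[OF v(1)[of j], of "of_real (c j)"] by (simp add: eig_def)
      then show "sph_lap (\<lambda>x. complex_of_real (c j) * v j x) x = of_real (?l m) * (of_real (c j) * v j x) - v j x"
        unfolding * by (simp add: algebra_simps)
    qed simp
    also have "\<dots> = of_real (?l m) * u x - (\<Sum>j<m. v j x)"
      by (simp add: u_def sum_subtractf sum_distrib_left)
    finally show ?thesis .
  qed
  define z where "z x = w x * p x + (-1) * u x" for x
  have "sph_lap z x = of_real (?l m) * z x" for x
  proof (cases "x = 0")
    case False
    have "sph_lap z x = w x * sph_lap p x + (-1) * sph_lap u x"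
      unfolding z_def[abs_def]
      using wp u sph_lap_radial_mult[OF ptest_psmooth[OF w(1)] w(2) hom_psmooth[OF less.prems(1)] False]
      by (simp only: ptest_sph_lap_add ptest_cmult ptest_sph_lap_cmult) simp
    also have "\<dots> = of_real (?l m) * z x - w x * rpow 2 x * q x + (\<Sum>j<m. v j x)"
      using False by (simp add: Lu sph_lap_hom[OF less.prems(1)] q(3) z_def algebra_simps)
    finally show ?thesis by (simp add: v(2))
  next
    case True
    have "ptest z" unfolding z_def[abs_def] using wp u by auto
    then show ?thesis using True by simp
  qed
  then have z: "eig m z" unfolding eig_def z_def[abs_def] using wp u by auto
  show ?case unfolding eigspan_def
  proof (intro exI conjI allI)
    show "eig j (if j < m then (\<lambda>x. complex_of_real (c j) * v j x) else if j = m then z else (\<lambda>_. 0))" for j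
      using z eig_cmult[OF v(1)] by auto
    show "(\<lambda>x. w x * p x) = (\<lambda>x. \<Sum>j<Suc m. (if j < m then (\<lambda>x. complex_of_real (c j) * v j x) else if j = m then z else (\<lambda>_. 0)) x)"
      by (rule ext) (simp add: z_def u_def)
  qed
qed

section \<open>From homogeneous to arbitrary polynomials\<close>

inductive hpoly :: "(real^'n::finite \<Rightarrow> complex) \<Rightarrow> bool" where
  hpoly_hom: "hom m p \<Longrightarrow> hpoly p"
| hpoly_add: "hpoly p \<Longrightarrow> hpoly q \<Longrightarrow> hpoly (\<lambda>x. p x + q x)"

lemma hpoly_mult: "hpoly p \<Longrightarrow> hpoly q \<Longrightarrow> hpoly (\<lambda>x. p x * q x)"
proof (induction rule: hpoly.induct)
  case (hpoly_hom m p)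
  from hpoly_hom(2,1) show ?case
    by (induction rule: hpoly.induct) (auto simp: distrib_left intro: hpoly.intros hom_mult)
qed (auto simp: distrib_right intro: hpoly.intros)

lemma hpoly_real_polynomial:
  "real_polynomial_function p \<Longrightarrow> hpoly (\<lambda>x::real^'n::finite. complex_of_real (p x))"
proof (induction rule: real_polynomial_function.induct)
  case (linear f)
  have ex: "f x = (\<Sum>i\<in>UNIV. x $ i * f (axis i 1))" for x
  proof -
    have "f x = f (\<Sum>i\<in>UNIV. (x $ i) *\<^sub>R axis i 1)"
      by (simp add: basis_expansion scalar_mult_eq_scaleR[symmetric])
    then show ?thesis
      by (simp add: linear_sum[OF bounded_linear.linear[OF linear]] linear_cmul[OF bounded_linear.linear[OF linear]])
  qed
  have eq: "(\<lambda>x. complex_of_real (f x)) = (\<lambda>x. \<Sum>i\<in>UNIV. of_real (x $ i) * of_real (f (axis i 1)))"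
    by (rule ext, subst ex) simp
  have "hom (Suc 0) (\<lambda>x. \<Sum>i\<in>UNIV. of_real (x $ i) * complex_of_real (f (axis i 1)))"
    by (intro hom_sum hom_coord hom_const)
  then show ?case by (subst eq) (rule hpoly_hom)
qed (auto intro: hpoly.intros hom.intros hpoly_mult)

lemma hpoly_polynomial_function:
  assumes "polynomial_function P"
  shows "hpoly (P :: real^'n::finite \<Rightarrow> complex)"
proof -
  have "real_polynomial_function (\<lambda>x. Re (P x))" "real_polynomial_function (\<lambda>x. Im (P x))"
    using assms bounded_linear_Re bounded_linear_Im unfolding polynomial_function_def o_def by auto
  then have "hpoly (\<lambda>x. complex_of_real (Re (P x)) + (\<lambda>_. \<i>) x * complex_of_real (Im (P x)))"
    by (intro hpoly_add hpoly_mult hpoly_real_polynomial hpoly_hom[OF hom_const])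
  then show ?thesis by (simp add: complex_eq[symmetric])
qed

lemma eigspan_hpoly:
  assumes n: "CARD('n) \<ge> 2" and w: "rtest w"
  shows "hpoly p \<Longrightarrow> \<exists>m. eigspan m (\<lambda>x::real^'n::finite. w x * p x)"
proof (induction rule: hpoly.induct)
  case (hpoly_hom m p)
  then show ?case using eigspan_hom[OF n _ w] by blast
next
  case (hpoly_add p q)
  then show ?case unfolding distrib_left using eigspan_add by blast
qed

section \<open>Density of eigenfunctions and the inequality\<close>

text \<open>Converts uniform bounds into L^2 bounds: \<open>K\<close> is the mass of the annulus for
  |x|^-n dx and is fixed before \<open>u\<close> and \<delta>.\<close>

lemma ip_le_on_annulus:
  fixes r R :: real
  assumes "r > 0"
  shows "\<exists>K\<ge>0. \<forall>(u :: real^'n::finite \<Rightarrow> complex) \<delta>. ptest u \<longrightarrow> (\<forall>x. norm (u x) \<le> \<delta>) \<longrightarrow>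
    (\<forall>x. \<not> (r \<le> norm x \<and> norm x \<le> R) \<longrightarrow> u x = 0) \<longrightarrow> ip u u \<le> \<delta>\<^sup>2 * K"
proof -
  define S where "S = cball (0::real^'n) R - ball 0 r"
  let ?w = "\<lambda>x::real^'n. norm x powr (- real CARD('n))"
  define K where "K = (\<integral>x. indicator S x *\<^sub>R ?w x \<partial>lborel)"
  have S: "x \<in> S \<longleftrightarrow> r \<le> norm x \<and> norm x \<le> R" for x by (auto simp: S_def)
  have "compact S" unfolding S_def by (intro compact_diff) auto
  moreover have "continuous_on S ?w" using assms by (intro continuous_intros) (auto simp: S)
  ultimately have int: "integrable lborel (\<lambda>x. indicator S x *\<^sub>R ?w x)" by (rule borel_integrable_compact)
  show ?thesis
  proof (intro exI[of _ K] conjI allI impI)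
    show "K \<ge> 0" unfolding K_def by (intro Bochner_Integration.integral_nonneg) auto
    fix u :: "real^'n \<Rightarrow> complex" and \<delta> :: real
    assume u: "ptest u" "\<forall>x. norm (u x) \<le> \<delta>" "\<forall>x. \<not> (r \<le> norm x \<and> norm x \<le> R) \<longrightarrow> u x = 0"
    have "ip u u \<le> (\<integral>x. \<delta>\<^sup>2 * (indicator S x *\<^sub>R ?w x) \<partial>lborel)"
      unfolding ip_def
    proof (rule integral_mono)
      show "integrable lborel (\<lambda>x. norm x powr - real CARD('n) * (u x \<bullet> u x))" using u(1) by simp
      show "integrable lborel (\<lambda>x. \<delta>\<^sup>2 * (indicator S x *\<^sub>R ?w x))" using int by (rule integrable_mult_right)
      fix x :: "real^'n"
      have "(norm (u x))\<^sup>2 \<le> \<delta>\<^sup>2" using u(2) by (intro power_mono) auto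
      then show "norm x powr - real CARD('n) * (u x \<bullet> u x) \<le> \<delta>\<^sup>2 * (indicator S x *\<^sub>R ?w x)"
        using u(3) by (cases "x \<in> S") (auto simp: S power2_norm_eq_inner mult.commute mult_right_mono)
    qed
    then show "ip u u \<le> \<delta>\<^sup>2 * K" by (simp add: K_def)
  qed
qed

lemma eigspan_ptest: "eigspan m u \<Longrightarrow> ptest u"
  by (auto simp: eigspan_def intro: ptest_sum)

text \<open>Divide by a radial bump that is positive on the support, approximate the continuous quotient
  by a polynomial, and multiply the bump back.\<close>

lemma eigspan_dense:
  fixes g :: "real^'n::finite \<Rightarrow> complex"
  assumes n: "CARD('n) \<ge> 2" and g: "ptest g" and \<epsilon>: "\<epsilon> > 0"
  shows "\<exists>m u. eigspan m u \<and> ip (\<lambda>x. g x - u x) (\<lambda>x. g x - u x) \<le> \<epsilon>"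
proof -
  obtain r R where rR: "r > 0" "r \<le> R" "\<And>x. norm x < r \<Longrightarrow> g x = 0" "\<And>x. norm x > R \<Longrightarrow> g x = 0"
    by (rule ptest_supportE[OF g]) (rule that)
  \<comment> \<open>The annulus of the bump is strictly larger than the one carrying
    \<open>g\<close>, so the bump is nonzero wherever \<open>g\<close> is.\<close>
  define p q where "p = ln (r / 2)" and "q = ln (2 * R)"
  have pq: "p \<le> q" using rR by (simp add: p_def q_def)
  define w :: "real^'n \<Rightarrow> complex" where "w = radial (bump p q 1)"
  have w: "rtest w" "ptest w" unfolding w_def using pq by (auto intro: rtest_radial_bump ptest_radial_bump)
  have w_nz: "w x \<noteq> 0" if "r / 2 < norm x" "norm x < 2 * R" for x
  proof -
    have "norm x > 0" using that rR by linarith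
    then have "x \<noteq> 0" "p < ln (norm x)" "ln (norm x) < q"
      unfolding p_def q_def using that rR by (auto simp: ln_less_cancel_iff)
    then show ?thesis using bump_pos_iff[OF pq, of 1 "ln (norm x)"] by (simp add: w_def radial_def)
  qed
  have w_z: "w x = 0" if "\<not> (r / 2 < norm x \<and> norm x < 2 * R)" for x
  proof (cases "x = 0")
    case False
    then have "\<not> (p < ln (norm x) \<and> ln (norm x) < q)"
      unfolding p_def q_def using that rR by (auto simp: ln_less_cancel_iff)
    then show ?thesis using bump_eq_0[OF pq, of 1 "ln (norm x)"] by (simp add: w_def radial_def)
  qed (simp add: w_def radial_def)
  have w_le: "norm (w x) \<le> 1" for x
    using bump_bounds[of p q 1 "ln (norm x)"] by (simp add: w_def radial_def)
  define k where "k x = g x / w x" for x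
  \<comment> \<open>On \<open>?U\<close> the bump is nonzero. On \<open>?V\<close> the quotient is
    0, also where it reads 0 / 0. These two open sets cover the space, so the quotient is
    continuous.\<close>
  let ?U = "ball 0 (2 * R) - cball (0::real^'n) (r / 2)" and ?V = "ball 0 r \<union> - cball (0::real^'n) R"
  have "continuous_on ?U k"
    unfolding k_def using w_nz by (intro continuous_on_divide ptest_continuous_on g w) auto
  moreover have "continuous_on ?V k"
    by (rule continuous_on_eq[OF continuous_on_const[of _ 0]]) (use rR in \<open>auto simp: k_def\<close>)
  moreover have "open ?U" "open ?V" by (auto intro: open_Diff open_Un)
  ultimately have "continuous_on (?U \<union> ?V) k"
    using continuous_on_open_Un[of ?U ?V k] by blast
  moreover have "x \<in> ?U \<union> ?V" for x using rR by auto
  ultimately have kcont: "continuous_on (cball 0 (2 * R)) k" by (meson continuous_on_subset subsetI)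
  obtain K where K: "K \<ge> 0" "\<And>u \<delta>. ptest (u :: real^'n \<Rightarrow> complex) \<Longrightarrow> (\<And>x. norm (u x) \<le> \<delta>) \<Longrightarrow>
    (\<And>x. \<not> (r / 2 \<le> norm x \<and> norm x \<le> 2 * R) \<Longrightarrow> u x = 0) \<Longrightarrow> ip u u \<le> \<delta>\<^sup>2 * K"
    using ip_le_on_annulus[OF half_gt_zero[OF rR(1)], of "2 * R"] by metis
  \<comment> \<open>Makes \<delta>^2 K at most \<epsilon>; the summand 1 covers the case K =
    0.\<close>
  define \<delta> where "\<delta> = sqrt (\<epsilon> / (K + 1))"
  have \<delta>: "\<delta> > 0" using \<epsilon> K(1) by (simp add: \<delta>_def)
  obtain P where P: "polynomial_function P" "\<And>x. x \<in> cball 0 (2 * R) \<Longrightarrow> norm (k x - P x) < \<delta>"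
    using Stone_Weierstrass_polynomial_function[OF compact_cball kcont \<delta>] by auto
  have hP: "hpoly P" by (rule hpoly_polynomial_function[OF P(1)])
  obtain m where m: "eigspan m (\<lambda>x. w x * P x)" using eigspan_hpoly[OF n w(1) hP] by blast
  have wP: "ptest (\<lambda>x. w x * P x)" using m by (rule eigspan_ptest)
  have out: "g x - w x * P x = 0" if "\<not> (r / 2 < norm x \<and> norm x < 2 * R)" for x
    using w_z[OF that] rR(3)[of x] rR(4)[of x] that rR(1,2) by auto
  have "norm (g x - w x * P x) \<le> \<delta>" for x
  proof (cases "r / 2 < norm x \<and> norm x < 2 * R")
    case True
    then have "g x - w x * P x = w x * (k x - P x)" using w_nz[of x] by (simp add: k_def algebra_simps)
    then have "norm (g x - w x * P x) \<le> 1 * \<delta>"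
      unfolding norm_mult using w_le[of x] P(2)[of x] True
      by (simp only: norm_mult) (intro mult_mono, auto intro: less_imp_le)
    then show ?thesis by simp
  qed (use out \<delta> in auto)
  then have "ip (\<lambda>x. g x - w x * P x) (\<lambda>x. g x - w x * P x) \<le> \<delta>\<^sup>2 * K"
    using g wP out by (intro K(2)) auto
  also have "\<dots> \<le> \<epsilon>" using \<epsilon> K(1) by (simp add: \<delta>_def field_simps)
  finally show ?thesis using m by blast
qed

text \<open>Since \<open>sph_lap + 1\<close> maps the span of the eigenfunctions onto itself, density in \<open>L\<^sup>2\<close> of the span
  yields density in the graph norm of \<open>sph_lap\<close>.\<close>

lemma eigspan_graph_dense:
  fixes F :: "real^'n::finite \<Rightarrow> complex"
  assumes n: "CARD('n) \<ge> 2" and F: "ptest F" and \<epsilon>: "\<epsilon> > 0"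
  shows "\<exists>m v h. eigspan m v \<and> ptest h \<and> v = (\<lambda>x. F x - h x) \<and> ip h h \<le> \<epsilon> \<and> ip (sph_lap h) (sph_lap h) \<le> \<epsilon>"
proof -
  have "ptest (\<lambda>x. sph_lap F x + F x)" using F by auto
  from eigspan_dense[OF n this \<epsilon>] obtain m u where
    u: "eigspan m u" "ip (\<lambda>x. sph_lap F x + F x - u x) (\<lambda>x. sph_lap F x + F x - u x) \<le> \<epsilon>" by blast
  obtain a where a: "\<And>j. eig j (a j)" "u = (\<lambda>x. \<Sum>j<m. a j x)" using u(1) by (auto simp: eigspan_def)
  let ?l = "lam CARD('n)"
  have l: "?l j + 1 > 0" for j using lam_nonneg[OF n, of j] by simp
  \<comment> \<open>The preimage of \<open>a j\<close> under \<Lambda> + 1, which acts on degree j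
    as a positive scalar.\<close>
  define b where "b j x = complex_of_real (1 / (?l j + 1)) * a j x" for j x
  have b: "eig j (b j)" for j unfolding b_def[abs_def] by (rule eig_cmult[OF a(1)])
  define v where "v x = (\<Sum>j<m. b j x)" for x
  have v: "eigspan m v" unfolding eigspan_def v_def[abs_def] using b by blast
  have vt: "ptest v" using v by (rule eigspan_ptest)
  have Lv: "sph_lap v x + v x = u x" for x
  proof -
    have "sph_lap v x = (\<Sum>j<m. of_real (?l j) * b j x)"
      unfolding v_def[abs_def] using b by (subst ptest_sph_lap_sum) (auto simp: eig_def)
    then have "sph_lap v x + v x = (\<Sum>j<m. of_real (?l j) * b j x + b j x)"
      by (simp add: v_def sum.distrib)
    also have "\<dots> = (\<Sum>j<m. a j x)"
    proof (rule sum.cong)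
      fix j
      have "complex_of_real (?l j) + 1 \<noteq> 0"
        using l[of j] by (metis of_real_1 of_real_add of_real_eq_0_iff less_irrefl)
      moreover have "b j x = a j x / (of_real (?l j) + 1)" by (simp add: b_def)
      moreover have "of_real (?l j) * b j x + b j x = (of_real (?l j) + 1) * b j x" by (simp add: distrib_right)
      ultimately show "of_real (?l j) * b j x + b j x = a j x" by simp
    qed simp
    finally show ?thesis by (simp add: a(2))
  qed
  define h where "h x = F x + (-1) * v x" for x
  have h: "ptest h" unfolding h_def[abs_def] using F vt by auto
  have Lh: "sph_lap h x + h x = sph_lap F x + F x - u x" for x
  proof -
    have "sph_lap h x = sph_lap F x + (-1) * sph_lap v x"
      unfolding h_def[abs_def] using F vt by (simp only: ptest_sph_lap_add ptest_cmult ptest_sph_lap_cmult)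
    then show ?thesis unfolding Lv[of x, symmetric] by (simp add: h_def)
  qed
  \<comment> \<open>In the square of (\<Lambda> + 1) h the cross term is nonnegative, so each of the
    two squares is bounded by the whole.\<close>
  have "ip (sph_lap h) (sph_lap h) + 2 * ip (sph_lap h) h + ip h h = ip (\<lambda>x. sph_lap h x + h x) (\<lambda>x. sph_lap h x + h x)"
    using h by (simp add: ip_add_left ip_add_right ptest_add ip_commute[of h "sph_lap h"])
  also have "\<dots> \<le> \<epsilon>" unfolding Lh by (rule u(2))
  finally have "ip h h \<le> \<epsilon>" "ip (sph_lap h) (sph_lap h) \<le> \<epsilon>"
    using ip_sph_lap_nonneg[OF h] ip_nonneg[of h] ip_nonneg[of "sph_lap h"] by linarith+
  moreover have "v = (\<lambda>x. F x - h x)" by (simp add: h_def fun_eq_iff)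
  ultimately show ?thesis using v h by blast
qed

section \<open>A quadratic form in the spherical Laplacian\<close>

lemma ip_eig_orthogonal:
  fixes v w :: "real^'n::finite \<Rightarrow> complex"
  assumes n: "CARD('n) \<ge> 2" and "eig i v" "eig j w" "i \<noteq> j"
  shows "ip v w = 0"
proof -
  let ?l = "lam CARD('n)"
  have "?l i * ip v w = ip (sph_lap v) w" using assms by (simp add: eig_def ip_cmult_left)
  also have "\<dots> = ip v (sph_lap w)" using assms by (intro ip_sph_lap_commute) auto
  also have "\<dots> = ?l j * ip v w" using assms by (simp add: eig_def ip_cmult_right)
  finally have "(?l i - ?l j) * ip v w = 0" by (simp add: algebra_simps)
  moreover have "?l i \<noteq> ?l j" using lam_strict_mono[OF n] assms(4) by (metis less_irrefl nat_neq_iff)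
  ultimately show ?thesis by simp
qed

lemma ip_eig_sums:
  fixes v :: "nat \<Rightarrow> real^'n::finite \<Rightarrow> complex"
  assumes n: "CARD('n) \<ge> 2" and v: "\<And>j. eig j (v j)"
  shows "ip (\<lambda>x. \<Sum>j<m. of_real (\<alpha> j) * v j x) (\<lambda>x. \<Sum>j<m. of_real (\<beta> j) * v j x) = (\<Sum>j<m. \<alpha> j * \<beta> j * ip (v j) (v j))"
proof -
  have "ip (\<lambda>x. \<Sum>j<m. of_real (\<alpha> j) * v j x) (\<lambda>x. \<Sum>j<m. of_real (\<beta> j) * v j x) =
      (\<Sum>i<m. \<Sum>j<m. \<alpha> i * (\<beta> j * ip (v i) (v j)))"
    using v by (subst ip_sum_left, (auto intro!: ptest_sum ptest_cmult)[2], subst ip_sum_right)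
      (auto intro!: ptest_cmult simp: ip_cmult_left ip_cmult_right sum_distrib_left)
  also have "\<dots> = (\<Sum>i<m. \<Sum>j<m. if i = j then \<alpha> i * \<beta> i * ip (v i) (v i) else 0)"
    using ip_eig_orthogonal[OF n v v] by (intro sum.cong refl) auto
  also have "\<dots> = (\<Sum>i<m. \<alpha> i * \<beta> i * ip (v i) (v i))" by (simp add: sum.delta')
  finally show ?thesis .
qed

text \<open>By orthogonality both sides are sums over j weighted by the squared norms of the
  components, and \<open>pos\<close> compares them term by term. Only the values at the eigenvalues
  enter.\<close>

lemma sph_lap_quadratic_nonneg_eigspan:
  fixes v :: "real^'n::finite \<Rightarrow> complex" and A c d :: real
  assumes n: "CARD('n) \<ge> 2" and pos: "\<And>j. A * (d + lam CARD('n) j) \<le> (lam CARD('n) j + c)\<^sup>2"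
    and v: "eigspan m v"
  shows "A * (d * ip v v + ip (sph_lap v) v) \<le> ip (\<lambda>x. sph_lap v x + of_real c * v x) (\<lambda>x. sph_lap v x + of_real c * v x)"
proof -
  let ?l = "lam CARD('n)"
  obtain a where a: "\<And>j. eig j (a j)" "v = (\<lambda>x. \<Sum>j<m. a j x)" using v by (auto simp: eigspan_def)
  have 0: "v = (\<lambda>x. \<Sum>j<m. of_real ((\<lambda>_. 1) j) * a j x)" by (simp add: a)
  have 1: "sph_lap v = (\<lambda>x. \<Sum>j<m. of_real (?l j) * a j x)"
    unfolding a(2) using a(1) by (subst ptest_sph_lap_sum) (auto simp: eig_def)
  have 2: "(\<lambda>x. sph_lap v x + of_real c * v x) = (\<lambda>x. \<Sum>j<m. of_real (?l j + c) * a j x)"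
    unfolding 1 by (simp add: a(2) fun_eq_iff sum.distrib sum_distrib_left algebra_simps)
  have "ip v v = (\<Sum>j<m. ip (a j) (a j))"
    using ip_eig_sums[OF n a(1), where \<alpha> = "\<lambda>_. 1" and \<beta> = "\<lambda>_. 1"] by (simp add: a(2))
  moreover have "ip (sph_lap v) v = (\<Sum>j<m. ?l j * ip (a j) (a j))"
    using ip_eig_sums[OF n a(1), where \<alpha> = ?l and \<beta> = "\<lambda>_. 1"] unfolding 1 by (simp add: a(2))
  moreover have "ip (\<lambda>x. sph_lap v x + of_real c * v x) (\<lambda>x. sph_lap v x + of_real c * v x) = (\<Sum>j<m. (?l j + c)\<^sup>2 * ip (a j) (a j))"
    unfolding 2 ip_eig_sums[OF n a(1)] by (simp add: power2_eq_square)
  moreover have "(\<Sum>j<m. A * (d + ?l j) * ip (a j) (a j)) \<le> (\<Sum>j<m. (?l j + c)\<^sup>2 * ip (a j) (a j))"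
    using pos by (intro sum_mono mult_right_mono) auto
  ultimately show ?thesis by (simp add: sum_distrib_left sum.distrib algebra_simps)
qed

lemma nonneg_if_ge_small:
  fixes x K :: real
  assumes "\<And>\<epsilon>. 0 < \<epsilon> \<Longrightarrow> \<epsilon> < 1 \<Longrightarrow> - (K * \<epsilon>) \<le> x"
  shows "0 \<le> x"
proof (rule ccontr)
  assume neg: "\<not> 0 \<le> x"
  \<comment> \<open>Small enough that K \<epsilon> \<le> - x / 2, while staying below 1.\<close>
  define \<epsilon> where "\<epsilon> = min (1/2) (- x / (2 * (\<bar>K\<bar> + 1)))"
  have "\<epsilon> \<le> 1/2" unfolding \<epsilon>_def by (rule min.cobounded1)
  moreover have "0 < - x / (2 * (\<bar>K\<bar> + 1))" using neg by (intro divide_pos_pos) auto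
  ultimately have e: "0 < \<epsilon>" "\<epsilon> < 1" by (auto simp: \<epsilon>_def)
  have "K * \<epsilon> \<le> (\<bar>K\<bar> + 1) * \<epsilon>" using e by (intro mult_right_mono) auto
  also have "\<dots> \<le> (\<bar>K\<bar> + 1) * (- x / (2 * (\<bar>K\<bar> + 1)))"
    by (intro mult_left_mono) (auto simp: \<epsilon>_def)
  also have "\<dots> = - x / 2" by (simp add: field_simps)
  finally show False using assms[OF e] neg by linarith
qed

text \<open>Write F = v + h with \<open>v\<close> a sum of eigenfunctions and \<open>h\<close> small
  in the graph norm. The form is continuous in this norm, so its nonnegativity passes from
  \<open>v\<close> to \<open>F\<close>.\<close>

lemma sph_lap_quadratic_nonneg:
  fixes F :: "real^'n::finite \<Rightarrow> complex" and A c d :: real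
  assumes n: "CARD('n) \<ge> 2" and pos: "\<And>j. A * (d + lam CARD('n) j) \<le> (lam CARD('n) j + c)\<^sup>2"
    and A: "A \<ge> 0" and d: "d \<ge> 0" and F: "ptest F"
  shows "A * (d * ip F F + ip (sph_lap F) F) \<le> ip (\<lambda>x. sph_lap F x + of_real c * F x) (\<lambda>x. sph_lap F x + of_real c * F x)"
proof -
  define Z where "Z u x = sph_lap u x + of_real c * u x" for u :: "real^'n \<Rightarrow> complex" and x
  define Q where "Q u = ip (Z u) (Z u) - A * (d * ip u u + ip (sph_lap u) u)" for u
  have Zt: "ptest (Z u)" if "ptest u" for u unfolding Z_def[abs_def] using that by auto
  define N where "N u = sqrt (ip u u)" for u :: "real^'n \<Rightarrow> complex"
  \<comment> \<open>The first summand bounds the mixed terms in \<open>F\<close> and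
    \<open>h\<close>. The last one bounds the form at \<open>h\<close>, where the part with
    \<open>A\<close> is dropped because of its sign.\<close>
  define K where "K = 2 * (N (Z F) * (1 + \<bar>c\<bar>) + A * d * N F + A * N (sph_lap F)) + (1 + \<bar>c\<bar>)\<^sup>2"
  have "- (K * \<epsilon>) \<le> Q F" if \<epsilon>: "0 < \<epsilon>" "\<epsilon> < 1" for \<epsilon>
  proof -
    \<comment> \<open>A squared tolerance, so that \<open>h\<close> and \<open>sph_lap h\<close>
      have norm at most \<epsilon>.\<close>
    have "\<epsilon>\<^sup>2 > 0" using \<epsilon> by simp
    from eigspan_graph_dense[OF n F this] obtain m v h where
      h: "eigspan m v" "ptest h" "v = (\<lambda>x. F x - h x)" "ip h h \<le> \<epsilon>\<^sup>2" "ip (sph_lap h) (sph_lap h) \<le> \<epsilon>\<^sup>2" by blast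
    have Nh: "N h \<le> \<epsilon>" "N (sph_lap h) \<le> \<epsilon>" using h(4,5) \<epsilon> by (auto simp: N_def real_le_lsqrt)
    have N0: "N u \<ge> 0" for u by (simp add: N_def)
    have bound: "\<bar>ip u w\<bar> \<le> N u * \<epsilon>" if "ptest u" "ptest w" "N w \<le> \<epsilon>" for u w
    proof -
      have "\<bar>ip u w\<bar> \<le> N u * N w" using ip_Cauchy_Schwarz[OF that(1,2)] by (simp add: N_def)
      also have "\<dots> \<le> N u * \<epsilon>" using that(3) N0 by (intro mult_left_mono)
      finally show ?thesis .
    qed
    have Lv: "sph_lap v = (\<lambda>x. sph_lap F x - sph_lap h x)"
      using ptest_sph_lap_add[OF F ptest_cmult[OF h(2), of "-1"]] ptest_sph_lap_cmult[OF h(2), of "-1"] by (simp add: h(3))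
    have Zv: "Z v = (\<lambda>x. Z F x - Z h x)"
      unfolding Z_def Lv by (simp add: h(3) fun_eq_iff algebra_simps)
    have "0 \<le> Q v" using sph_lap_quadratic_nonneg_eigspan[OF n pos h(1)] by (simp add: Q_def Z_def[abs_def])
    also have "Q v = Q F - 2 * (ip (Z F) (Z h) - A * (d * ip F h + ip (sph_lap F) h)) + Q h"
    proof -
      have "ip (Z v) (Z v) = ip (Z F) (Z F) - 2 * ip (Z F) (Z h) + ip (Z h) (Z h)"
        unfolding Zv using F h(2) Zt by (simp add: ip_diff_left ip_diff_right ptest_diff ip_commute[of "Z h" "Z F"])
      moreover have "ip v v = ip F F - 2 * ip F h + ip h h"
        unfolding h(3) using F h(2) by (simp add: ip_diff_left ip_diff_right ptest_diff ip_commute[of h F])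
      moreover have "ip (sph_lap v) v = ip (sph_lap F) F - 2 * ip (sph_lap F) h + ip (sph_lap h) h"
        unfolding Lv unfolding h(3) using F h(2)
        by (simp add: ip_diff_left ip_diff_right ptest_diff ip_sph_lap_commute[of h F] ip_commute[of h "sph_lap F"])
      ultimately show ?thesis unfolding Q_def by (simp only:) (simp add: algebra_simps)
    qed
    finally have 1: "Q F \<ge> 2 * (ip (Z F) (Z h) - A * (d * ip F h + ip (sph_lap F) h)) - Q h" by simp
    have "ip (Z F) (Z h) = ip (Z F) (sph_lap h) + c * ip (Z F) h"
      unfolding Z_def[of h, abs_def] using F h(2) Zt by (simp add: ip_add_right ptest_cmult ip_cmult_right)
    moreover have "\<bar>c * ip (Z F) h\<bar> \<le> \<bar>c\<bar> * (N (Z F) * \<epsilon>)"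
      unfolding abs_mult using bound[OF Zt[OF F] h(2) Nh(1)] by (intro mult_left_mono) auto
    moreover have "\<bar>ip (Z F) (sph_lap h)\<bar> \<le> N (Z F) * \<epsilon>"
      using bound[OF Zt[OF F] ptest_sph_lap[OF h(2)] Nh(2)] .
    ultimately have 2: "ip (Z F) (Z h) \<ge> - (N (Z F) * (1 + \<bar>c\<bar>) * \<epsilon>)" by (simp add: algebra_simps abs_le_iff)
    have "A * (d * ip F h + ip (sph_lap F) h) \<le> A * (d * (N F * \<epsilon>) + N (sph_lap F) * \<epsilon>)"
      using bound[OF F h(2) Nh(1)] bound[OF ptest_sph_lap[OF F] h(2) Nh(1)] A d
      by (intro mult_left_mono add_mono) (auto simp: abs_le_iff)
    then have 3: "A * (d * ip F h + ip (sph_lap F) h) \<le> (A * d * N F + A * N (sph_lap F)) * \<epsilon>" by (simp add: algebra_simps)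
    have "ip (Z h) (Z h) = ip (sph_lap h) (sph_lap h) + 2 * c * ip (sph_lap h) h + c\<^sup>2 * ip h h"
      unfolding Z_def[abs_def] using h(2)
      by (simp add: ip_add_left ip_add_right ptest_add ptest_cmult ip_cmult_left ip_cmult_right ip_commute[of h "sph_lap h"] power2_eq_square algebra_simps)
    also have "\<dots> \<le> \<epsilon>\<^sup>2 + 2 * \<bar>c\<bar> * \<epsilon>\<^sup>2 + c\<^sup>2 * \<epsilon>\<^sup>2"
    proof (intro add_mono mult_left_mono h)
      have "\<bar>ip (sph_lap h) h\<bar> \<le> N (sph_lap h) * \<epsilon>" using bound[OF ptest_sph_lap[OF h(2)] h(2) Nh(1)] .
      also have "\<dots> \<le> \<epsilon> * \<epsilon>" using Nh(2) \<epsilon> by (intro mult_right_mono) auto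
      finally have "\<bar>2 * c\<bar> * \<bar>ip (sph_lap h) h\<bar> \<le> \<bar>2 * c\<bar> * \<epsilon>\<^sup>2"
        by (intro mult_left_mono) (auto simp: power2_eq_square)
      then show "2 * c * ip (sph_lap h) h \<le> 2 * \<bar>c\<bar> * \<epsilon>\<^sup>2"
        using abs_ge_self[of "2 * c * ip (sph_lap h) h"] by (simp add: abs_mult)
    qed auto
    also have "\<dots> = (1 + \<bar>c\<bar>)\<^sup>2 * \<epsilon>\<^sup>2" by (simp add: power2_eq_square algebra_simps)
    also have "\<dots> \<le> (1 + \<bar>c\<bar>)\<^sup>2 * \<epsilon>" using \<epsilon> by (intro mult_left_mono) (auto simp: power2_eq_square)
    finally have "ip (Z h) (Z h) \<le> (1 + \<bar>c\<bar>)\<^sup>2 * \<epsilon>" .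
    moreover have "0 \<le> A * (d * ip h h + ip (sph_lap h) h)"
      using A d ip_sph_lap_nonneg[OF h(2)] by simp
    ultimately have "Q h \<le> (1 + \<bar>c\<bar>)\<^sup>2 * \<epsilon>" unfolding Q_def by linarith
    then show ?thesis using 1 2 3 unfolding K_def distrib_right distrib_left by (simp add: algebra_simps)
  qed
  then have "0 \<le> Q F" by (rule nonneg_if_ge_small)
  then show ?thesis by (simp add: Q_def Z_def[abs_def])
qed

section \<open>The inequality for all test functions\<close>

lemma A_const_nonneg:
  assumes "n \<ge> 2"
  shows "A_const n \<gamma> \<ge> 0"
proof -
  obtain j where "A_const n \<gamma> = alpha n \<gamma> j" using A_const_attained_least(1) by auto
  then show ?thesis using lam_nonneg[OF assms, of j] by (simp add: alpha_def)
qed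

lemma rellich_hardy_ptest:
  fixes f :: "real^'n::finite \<Rightarrow> complex" and \<gamma> :: real
  assumes n: "CARD('n) \<ge> 2" and f: "ptest f"
  shows "A_const CARD('n) \<gamma> * hardy_energy \<gamma> f \<le> rellich_energy \<gamma> f"
proof -
  define a b where "a = (real CARD('n) + \<gamma> - 4) / 2" and "b = (real CARD('n) - \<gamma>) / 2"
  define A where "A = A_const CARD('n) \<gamma>"
  let ?l = "lam CARD('n)"
  define F where "F x = rpow a x * f x" for x
  have F: "ptest F" unfolding F_def[abs_def] using f by (intro ptest_mult_right) auto
  have fF: "(\<lambda>x. rpow (- a) x * F x) = f"
  proof
    show "rpow (- a) x * F x = f x" for x
      using rpow_add[of "-a" x a] f by (cases "x = 0") (auto simp: F_def rpow_0 mult.assoc[symmetric])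
  qed
  have A0: "A \<ge> 0" unfolding A_def by (rule A_const_nonneg[OF n])
  have "alpha CARD('n) \<gamma> 0 = b\<^sup>2" by (simp add: alpha_def b_def power2_eq_square)
  then have Ab: "A \<le> b\<^sup>2" using A_const_attained_least(2)[of "CARD('n)" \<gamma> 0] by (simp add: A_def)
  \<comment> \<open>For \<open>j = 0\<close> the claim is A a^2 \<le> a^2 b^2. It follows from A
    \<le> b^2 even if a = 0, where the quotient used for the other degrees would read 0 / 0.\<close>
  have pos: "A * (a\<^sup>2 + ?l j) \<le> (?l j + a * b)\<^sup>2" for j
  proof (cases "j = 0")
    case True
    then have "?l j = 0" by (simp add: lam_def)
    moreover have "A * a\<^sup>2 \<le> b\<^sup>2 * a\<^sup>2" using Ab by (intro mult_right_mono) auto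
    ultimately show ?thesis by (simp add: power_mult_distrib mult.commute)
  next
    case False
    have "?l 0 < ?l j" using lam_strict_mono[OF n] False by simp
    moreover have "?l 0 = 0" by (simp add: lam_def)
    ultimately have l: "a\<^sup>2 + ?l j > 0" using zero_le_power2[of a] by linarith
    have "alpha CARD('n) \<gamma> j = (a * b + ?l j)\<^sup>2 / (a\<^sup>2 + ?l j)"
      using False by (simp add: alpha_def a_def b_def power_divide)
    then have "A \<le> (a * b + ?l j)\<^sup>2 / (a\<^sup>2 + ?l j)"
      using A_const_attained_least(2)[of "CARD('n)" \<gamma> j] by (simp add: A_def)
    then show ?thesis using l by (simp add: pos_le_divide_eq add.commute)
  qed
  have "A * (a\<^sup>2 * ip F F + ip (sph_lap F) F) \<le> ip (\<lambda>x. sph_lap F x + of_real (a * b) * F x) (\<lambda>x. sph_lap F x + of_real (a * b) * F x)"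
    by (rule sph_lap_quadratic_nonneg[OF n pos A0 _ F]) simp
  moreover have "0 \<le> (a\<^sup>2 + b\<^sup>2 - A) * ip (euler F) (euler F)"
    using Ab by (intro mult_nonneg_nonneg) (auto simp: add_increasing)
  moreover have "ip (sph_lap (euler F)) (euler F) \<ge> 0" using F by (intro ip_sph_lap_nonneg) auto
  moreover have "ip (euler (euler F)) (euler (euler F)) \<ge> 0" by simp
  ultimately have "0 \<le> rellich_energy \<gamma> f - A * hardy_energy \<gamma> f"
    using energy_identity[OF F, of \<gamma> A] unfolding a_def[symmetric] b_def[symmetric] fF by linarith
  then show ?thesis by (simp add: A_def)
qed

section \<open>Sharpness\<close>

subsection \<open>An explicit spherical harmonic\<close>

text \<open>An isotropic linear form: for distinct axes the squares of its coefficients, 1 and the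
  imaginary unit, add up to 0. Therefore all its powers are harmonic, which supplies a nonzero
  harmonic polynomial of every degree as soon as n \<ge> 2.\<close>

definition zeta :: "'n::finite \<Rightarrow> 'n \<Rightarrow> real^'n \<Rightarrow> complex" where
  "zeta i k x = of_real (x $ i) + \<i> * of_real (x $ k)"

lemma psmooth_zeta [simp, intro]: "psmooth (zeta i k)"
  unfolding zeta_def[abs_def] by auto

lemma partial_deriv_zeta:
  "x \<noteq> 0 \<Longrightarrow> partial_deriv l (zeta i k) x = (if l = i then 1 else 0) + (if l = k then \<i> else 0)"
  unfolding zeta_def[abs_def] partial_deriv_eq_dir
  by (simp add: dir_add dir_cmult psmooth_differentiable psmooth_mult) (auto simp: axis_def)

lemma hom_zeta_power: "hom j (\<lambda>x. zeta i k x ^ j)"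
proof (induction j)
  case (Suc j)
  have 1: "hom (Suc 0) (\<lambda>x. of_real (x $ l) * (\<lambda>_. c) x)" for l :: 'a and c
    by (rule hom_coord[OF hom_const])
  have "hom (Suc 0) (\<lambda>x. of_real (x $ i) * (\<lambda>_. 1) x + of_real (x $ k) * (\<lambda>_. \<i>) x)"
    by (rule hom_add) (rule 1)+
  then have "hom (Suc 0) (zeta i k)" by (simp add: zeta_def[abs_def] mult.commute)
  from hom_mult[OF this Suc] show ?case by simp
qed (simp add: hom_const)

lemma partial_deriv_zeta_power:
  "x \<noteq> 0 \<Longrightarrow> partial_deriv l (\<lambda>x. zeta i k x ^ j) x =
    of_nat j * zeta i k x ^ (j - 1) * partial_deriv l (zeta i k) x"
proof (induction j)
  case (Suc j)
  have "partial_deriv l (\<lambda>x. zeta i k x ^ Suc j) x =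
      partial_deriv l (zeta i k) x * zeta i k x ^ j + zeta i k x * partial_deriv l (\<lambda>x. zeta i k x ^ j) x"
    using Suc.prems unfolding partial_deriv_eq_dir power_Suc
    by (intro dir_mult) (auto intro: psmooth_differentiable psmooth_power)
  then show ?case using Suc by (cases j) (simp_all add: algebra_simps)
qed (simp add: partial_deriv_eq_dir)

lemma laplacian_zeta_power:
  assumes "i \<noteq> k" "x \<noteq> 0"
  shows "laplacian (\<lambda>x. zeta i k x ^ j) x = 0"
proof -
  define d where "d l = (if l = i then 1 else 0) + (if l = k then \<i> else 0)" for l
  have pz: "partial_deriv l (\<lambda>x. zeta i k x ^ m) y = of_nat m * zeta i k y ^ (m - 1) * d l" if "y \<noteq> 0" for l m y
    by (simp only: partial_deriv_zeta_power[OF that] partial_deriv_zeta[OF that] d_def)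
  have "partial_deriv l (partial_deriv l (\<lambda>x. zeta i k x ^ j)) x =
      (of_nat j * of_nat (j - 1) * zeta i k x ^ (j - 1 - 1)) * (d l * d l)" for l
  proof -
    have "partial_deriv l (partial_deriv l (\<lambda>x. zeta i k x ^ j)) x = partial_deriv l (\<lambda>x. (of_nat j * d l) * zeta i k x ^ (j - 1)) x"
      by (rule partial_deriv_cong[OF _ assms(2)]) (subst pz, simp_all)
    also have "\<dots> = (of_nat j * d l) * partial_deriv l (\<lambda>x. zeta i k x ^ (j - 1)) x"
      using assms(2) unfolding partial_deriv_eq_dir by (intro dir_cmult psmooth_differentiable psmooth_power) auto
    finally show ?thesis by (simp only: pz[OF assms(2)] mult_ac)
  qed
  moreover have "(\<Sum>l\<in>UNIV. d l * d l) = 0"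
  proof -
    have "d l * d l = (if l = i then 1 else 0) + (if l = k then - 1 else 0)" for l
      using assms(1) by (auto simp: d_def)
    then show ?thesis by (simp add: sum.distrib)
  qed
  ultimately show ?thesis by (simp add: laplacian_def flip: sum_distrib_left)
qed

text \<open>A spherical harmonic extended constantly along rays, so that E annihilates it while the
  eigenvalue of \<Lambda> is kept.\<close>

definition harmonic :: "'n::finite \<Rightarrow> 'n \<Rightarrow> nat \<Rightarrow> real^'n \<Rightarrow> complex" where
  "harmonic i k j x = rpow (- real j) x * zeta i k x ^ j"

lemma psmooth_harmonic [simp, intro]: "psmooth (harmonic i k j)"
  unfolding harmonic_def[abs_def] by auto

lemma euler_harmonic: "x \<noteq> 0 \<Longrightarrow> euler (harmonic i k j) x = 0"
  unfolding harmonic_def[abs_def]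
  by (subst euler_rpow_mult) (auto simp: hom_euler[OF hom_zeta_power])

lemma sph_lap_harmonic:
  fixes x :: "real^'n::finite"
  assumes "i \<noteq> k" "x \<noteq> 0"
  shows "sph_lap (harmonic i k j) x = of_real (lam CARD('n) j) * harmonic i k j x"
proof -
  have "sph_lap (harmonic i k j) x = rpow (- real j) x * sph_lap (\<lambda>x. zeta i k x ^ j) x"
    unfolding harmonic_def[abs_def] using assms(2) by (intro sph_lap_radial_mult) auto
  then show ?thesis
    using assms by (simp add: sph_lap_hom[OF hom_zeta_power] laplacian_zeta_power harmonic_def)
qed

lemma harmonic_scale: "c > 0 \<Longrightarrow> x \<noteq> 0 \<Longrightarrow> harmonic i k j (c *\<^sub>R x) = harmonic i k j x"
proof -
  assume c: "c > 0" and x: "x \<noteq> 0"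
  have "zeta i k (c *\<^sub>R x) = of_real c * zeta i k x" by (simp add: zeta_def algebra_simps)
  moreover have "rpow (- real j) (c *\<^sub>R x) = of_real (c powr (- real j)) * rpow (- real j) x"
    using c by (simp add: rpow_def powr_mult)
  moreover have "complex_of_real (c powr (- real j)) * of_real c ^ j = 1"
  proof -
    have "c powr (- real j) * c ^ j = 1" using c by (simp add: powr_minus powr_realpow)
    then show ?thesis by (metis of_real_1 of_real_mult of_real_power)
  qed
  ultimately show ?thesis by (simp add: harmonic_def power_mult_distrib mult_ac)
qed

lemma axis_nth_if: "axis i x $ k = (if k = i then x else 0)"
  by (simp add: axis_def)

text \<open>Certifies that the spherical harmonic is not identically zero, with a ray on which this
  is seen.\<close>

lemma harmonic_axis: "i \<noteq> k \<Longrightarrow> c > 0 \<Longrightarrow> harmonic i k j (c *\<^sub>R axis i 1) = 1"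
  by (subst harmonic_scale) (auto simp: harmonic_def rpow_def zeta_def axis_eq_0_iff axis_nth_if)

subsection \<open>Dilation invariant mass of spherical shells\<close>

definition shell :: "real \<Rightarrow> real \<Rightarrow> (real^'n::finite) set" where
  "shell s t = {x. exp s \<le> norm x \<and> norm x \<le> exp t}"

text \<open>For \<open>s \<le> t\<close> and \<open>Y\<close> constant along rays this is t - s
  times the squared norm of \<open>Y\<close> on the unit sphere. Shift invariance and subadditivity
  stand in for this formula and for polar coordinates.\<close>

definition shell_mass :: "(real^'n::finite \<Rightarrow> complex) \<Rightarrow> real \<Rightarrow> real \<Rightarrow> real" where
  "shell_mass Y s t = (\<integral>x. indicator (shell s t) x *\<^sub>R (norm x powr (- real CARD('n)) * (norm (Y x))\<^sup>2) \<partial>lborel)"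

lemma shell_neq_0: "x \<in> shell s t \<Longrightarrow> x \<noteq> 0"
  using exp_gt_zero[of s] by (auto simp: shell_def)

lemma shell_integrable:
  fixes Y :: "real^'n::finite \<Rightarrow> complex"
  assumes "psmooth Y"
  shows "integrable lborel (\<lambda>x. indicator (shell s t) x *\<^sub>R (norm x powr (- real CARD('n)) * (norm (Y x))\<^sup>2))"
proof (rule borel_integrable_compact)
  have "shell s t = cball (0::real^'n) (exp t) - ball 0 (exp s)" by (auto simp: shell_def)
  then show "compact (shell s t :: (real^'n) set)" by (simp add: compact_diff)
  have "continuous_on (shell s t) Y"
    using psmooth_continuous_on[OF assms] by (rule continuous_on_subset) (auto dest: shell_neq_0)
  then show "continuous_on (shell s t) (\<lambda>x. norm x powr (- real CARD('n)) * (norm (Y x))\<^sup>2)"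
    by (intro continuous_intros) (auto dest: shell_neq_0)
qed

lemma lborel_integral_scale:
  fixes f :: "real^'n::finite \<Rightarrow> real"
  assumes [measurable]: "f \<in> borel_measurable borel" and c: "c > 0"
  shows "(\<integral>x. f x \<partial>lborel) = (\<integral>x. c ^ CARD('n) * f (c *\<^sub>R x) \<partial>lborel)"
proof -
  have "(\<integral>x. f x \<partial>lborel) = (\<integral>x. f x \<partial>density (distr lborel borel (\<lambda>x. 0 + c *\<^sub>R x)) (\<lambda>_. ennreal (\<bar>c\<bar> ^ DIM(real^'n))))"
    using c by (subst lborel_affine[of c 0, symmetric]) auto
  also have "\<dots> = (\<integral>x. c ^ CARD('n) * f (c *\<^sub>R x) \<partial>lborel)"
    using c by (subst integral_density) (auto simp: integral_distr)
  finally show ?thesis .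
qed

text \<open>Dilation by \<open>exp u\<close> carries one shell to the other and preserves |x|^-n dx;
  in logarithmic radii it is a translation.\<close>

lemma shell_mass_shift:
  fixes Y :: "real^'n::finite \<Rightarrow> complex"
  assumes Y: "psmooth Y" "\<And>c x. c > 0 \<Longrightarrow> x \<noteq> 0 \<Longrightarrow> Y (c *\<^sub>R x) = Y x"
  shows "shell_mass Y (s + u) (t + u) = shell_mass Y s t"
proof -
  let ?n = "real CARD('n)"
  have meas: "(\<lambda>x. indicator (shell (s + u) (t + u)) x *\<^sub>R (norm x powr (- ?n) * (norm (Y x))\<^sup>2)) \<in> borel_measurable borel"
    using borel_measurable_integrable[OF shell_integrable[OF Y(1)]] by simp
  have ind: "indicator (shell (s + u) (t + u)) (exp u *\<^sub>R x) = (indicator (shell s t) x :: real)" for x :: "real^'n"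
    by (auto simp: indicator_def shell_def exp_add mult.commute)
  show ?thesis unfolding shell_mass_def
  proof (subst lborel_integral_scale[OF meas exp_gt_zero[of u]], rule Bochner_Integration.integral_cong)
    fix x :: "real^'n"
    show "exp u ^ CARD('n) * (indicator (shell (s + u) (t + u)) (exp u *\<^sub>R x) *\<^sub>R
        (norm (exp u *\<^sub>R x) powr (- ?n) * (norm (Y (exp u *\<^sub>R x)))\<^sup>2)) =
        indicator (shell s t) x *\<^sub>R (norm x powr (- ?n) * (norm (Y x))\<^sup>2)"
    proof (cases "x \<in> shell s t")
      case True
      have "exp u ^ CARD('n) * (exp u powr (- ?n)) = 1"
        by (simp add: powr_minus powr_realpow)
      moreover have "norm (exp u *\<^sub>R x) powr (- ?n) = exp u powr (- ?n) * norm x powr (- ?n)"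
        by (simp add: powr_mult)
      ultimately show ?thesis using True shell_neq_0[OF True] unfolding ind by (simp add: Y(2) del: norm_scaleR)
    qed (simp add: ind)
  qed simp
qed

lemma shell_mass_nonneg: "shell_mass Y s t \<ge> 0"
  unfolding shell_mass_def by (intro Bochner_Integration.integral_nonneg) auto

text \<open>A shell of logarithmic length (m + 1) l is covered by m + 1 shifted copies of one of
  length l. The copies share boundary spheres, which is harmless for an upper bound.\<close>

lemma shell_mass_multiple:
  fixes Y :: "real^'n::finite \<Rightarrow> complex"
  assumes Y: "psmooth Y" "\<And>c x. c > 0 \<Longrightarrow> x \<noteq> 0 \<Longrightarrow> Y (c *\<^sub>R x) = Y x"
  shows "shell_mass Y s (s + real (Suc m) * l) \<le> real (Suc m) * shell_mass Y s (s + l)"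
proof (induction m)
  case (Suc m)
  let ?w = "\<lambda>x::real^'n. norm x powr (- real CARD('n)) * (norm (Y x))\<^sup>2"
  let ?t = "s + real (Suc m) * l"
  have "shell_mass Y s (s + real (Suc (Suc m)) * l) \<le>
      (\<integral>x. indicator (shell s ?t) x *\<^sub>R ?w x + indicator (shell ?t (?t + l)) x *\<^sub>R ?w x \<partial>lborel)"
    unfolding shell_mass_def
  proof (rule integral_mono)
    show "indicator (shell s (s + real (Suc (Suc m)) * l)) x *\<^sub>R ?w x \<le>
        indicator (shell s ?t) x *\<^sub>R ?w x + indicator (shell ?t (?t + l)) x *\<^sub>R ?w x" for x
      by (auto simp: indicator_def shell_def algebra_simps)
  qed (use shell_integrable[OF Y(1)] in auto)
  also have "\<dots> = shell_mass Y s ?t + shell_mass Y ?t (?t + l)"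
    unfolding shell_mass_def using shell_integrable[OF Y(1)] by (intro Bochner_Integration.integral_add)
  also have "shell_mass Y ?t (?t + l) = shell_mass Y s (s + l)"
    using shell_mass_shift[OF Y, of s "real (Suc m) * l" "s + l"] by (simp add: add_ac)
  finally show ?case using Suc by (simp add: algebra_simps)
qed simp

text \<open>With its counterpart \<open>radial_ip_ge\<close> this compares norms of radial multiples
  of \<open>Y\<close> by pointwise bounds on the profile, in place of evaluating the integral of
  h^2.\<close>

lemma radial_ip_le:
  fixes Y :: "real^'n::finite \<Rightarrow> complex"
  assumes Y: "psmooth Y" and u: "ptest (\<lambda>x. radial h x * Y x)"
    and h: "\<And>t. (h t)\<^sup>2 \<le> B" "\<And>t. \<not> (s \<le> t \<and> t \<le> s') \<Longrightarrow> h t = 0"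
  shows "ip (\<lambda>x. radial h x * Y x) (\<lambda>x. radial h x * Y x) \<le> B * shell_mass Y s s'"
proof -
  have "ip (\<lambda>x. radial h x * Y x) (\<lambda>x. radial h x * Y x) \<le>
      (\<integral>x. B * (indicator (shell s s') x *\<^sub>R (norm x powr (- real CARD('n)) * (norm (Y x))\<^sup>2)) \<partial>lborel)"
    unfolding ip_def
  proof (rule integral_mono)
    fix x :: "real^'n"
    show "norm x powr - real CARD('n) * ((radial h x * Y x) \<bullet> (radial h x * Y x)) \<le>
        B * (indicator (shell s s') x *\<^sub>R (norm x powr (- real CARD('n)) * (norm (Y x))\<^sup>2))"
    proof (cases "x = 0")
      case False
      have eq: "(radial h x * Y x) \<bullet> (radial h x * Y x) = (h (ln (norm x)))\<^sup>2 * (norm (Y x))\<^sup>2"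
        using False by (simp add: power2_norm_eq_inner[symmetric] norm_mult power_mult_distrib radial_def)
      show ?thesis
      proof (cases "x \<in> shell s s'")
        case True
        then show ?thesis using mult_right_mono[OF h(1)[of "ln (norm x)"], of "norm x powr (- real CARD('n)) * (norm (Y x))\<^sup>2"]
          unfolding eq by (simp add: mult_ac)
      next
        case out: False
        have "\<not> (s \<le> ln (norm x) \<and> ln (norm x) \<le> s')"
          using out False by (auto simp: shell_def ln_ge_iff) (metis exp_le_cancel_iff exp_ln zero_less_norm_iff)
        then show ?thesis using out unfolding eq by (simp add: h(2))
      qed
    qed (simp add: radial_def)
  qed (use u shell_integrable[OF Y] in auto)
  then show ?thesis by (simp add: shell_mass_def)
qed

lemma radial_ip_ge:
  fixes Y :: "real^'n::finite \<Rightarrow> complex"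
  assumes Y: "psmooth Y" and u: "ptest (\<lambda>x. radial h x * Y x)"
    and h: "\<And>t. s \<le> t \<Longrightarrow> t \<le> s' \<Longrightarrow> (h t)\<^sup>2 \<ge> B"
  shows "B * shell_mass Y s s' \<le> ip (\<lambda>x. radial h x * Y x) (\<lambda>x. radial h x * Y x)"
proof -
  have "(\<integral>x. B * (indicator (shell s s') x *\<^sub>R (norm x powr (- real CARD('n)) * (norm (Y x))\<^sup>2)) \<partial>lborel) \<le>
      ip (\<lambda>x. radial h x * Y x) (\<lambda>x. radial h x * Y x)"
    unfolding ip_def
  proof (rule integral_mono)
    fix x :: "real^'n"
    show "B * (indicator (shell s s') x *\<^sub>R (norm x powr (- real CARD('n)) * (norm (Y x))\<^sup>2)) \<le>
      norm x powr - real CARD('n) * ((radial h x * Y x) \<bullet> (radial h x * Y x))"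
    proof (cases "x \<in> shell s s'")
      case True
      have nz: "x \<noteq> 0" using shell_neq_0[OF True] .
      have eq: "(radial h x * Y x) \<bullet> (radial h x * Y x) = (h (ln (norm x)))\<^sup>2 * (norm (Y x))\<^sup>2"
        using nz by (simp add: power2_norm_eq_inner[symmetric] norm_mult power_mult_distrib radial_def)
      have "s \<le> ln (norm x)" "ln (norm x) \<le> s'"
        using True nz by (auto simp: shell_def ln_ge_iff) (metis exp_le_cancel_iff exp_ln zero_less_norm_iff)
      then show ?thesis
        using True mult_right_mono[OF h[of "ln (norm x)"], of "norm x powr (- real CARD('n)) * (norm (Y x))\<^sup>2"]
        unfolding eq by (simp add: mult_ac)
    qed simp
  qed (use u shell_integrable[OF Y] in auto)
  then show ?thesis by (simp add: shell_mass_def)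
qed

text \<open>By continuity a nonzero value persists on a ball, and balls have positive
  measure.\<close>

lemma ip_pos:
  fixes u :: "real^'n::finite \<Rightarrow> complex"
  assumes u: "ptest u" and x: "u x \<noteq> 0"
  shows "ip u u > 0"
proof (rule ccontr)
  assume "\<not> ip u u > 0"
  then have "ip u u = 0" using ip_nonneg[of u] by linarith
  then have "AE x in lborel. norm x powr (- real CARD('n)) * (u x \<bullet> u x) = 0"
    unfolding ip_def using u by (subst (asm) integral_nonneg_eq_0_iff_AE) auto
  then have ae: "AE x in lborel. u x = 0"
    by eventually_elim (use u in auto)
  have "open (u -` (- {0}))" using u by (intro open_vimage ptest_continuous_on) auto
  then obtain e where e: "e > 0" "ball x e \<subseteq> u -` (- {0})"
    using x by (metis ComplI openE singletonD vimageI2)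
  have "AE y in lborel. y \<notin> ball x e" using ae by eventually_elim (use e in auto)
  then have "emeasure lborel (ball x e) = 0"
    by (subst (asm) AE_iff_measurable[of "ball x e"]) auto
  then show False using content_ball_pos[OF e(1), of x] by (simp add: measure_def)
qed


subsection \<open>Slowly varying profiles\<close>

text \<open>A bump on (-3, -1). Its support is negative, so stretching it in ln |x| pushes the
  functions towards the origin.\<close>

definition profile :: "real \<Rightarrow> real" where "profile t = psi 0 ((t + 3) * (- 1 - t))"
definition profile' :: "real \<Rightarrow> real" where "profile' t = psi 2 ((t + 3) * (- 1 - t)) * (- 4 - 2 * t)"
definition profile'' :: "real \<Rightarrow> real" where
  "profile'' t = (psi 4 ((t + 3) * (- 1 - t)) - 2 * psi 3 ((t + 3) * (- 1 - t))) * (- 4 - 2 * t)\<^sup>2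
    - 2 * psi 2 ((t + 3) * (- 1 - t))"

lemma quadratic_deriv: "((\<lambda>t. (t + 3) * (- 1 - t)) has_real_derivative - 4 - 2 * t) (at t)"
  by (auto intro!: derivative_eq_intros)

lemma profile_deriv: "(profile has_real_derivative profile' t) (at t)"
  using DERIV_chain2[OF psi_has_derivative[of 0] quadratic_deriv[of t]]
  by (simp add: profile_def[abs_def] profile'_def numeral_2_eq_2)

lemma profile'_deriv: "(profile' has_real_derivative profile'' t) (at t)"
proof -
  have "((\<lambda>t. psi 2 ((t + 3) * (- 1 - t))) has_real_derivative
      (psi 4 ((t + 3) * (- 1 - t)) - 2 * psi 3 ((t + 3) * (- 1 - t))) * (- 4 - 2 * t)) (at t)"
    using DERIV_chain2[OF psi_has_derivative[of 2] quadratic_deriv[of t]]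
    by (simp add: eval_nat_numeral)
  then have "((\<lambda>t. psi 2 ((t + 3) * (- 1 - t)) * (- 4 - 2 * t)) has_real_derivative
      (psi 4 ((t + 3) * (- 1 - t)) - 2 * psi 3 ((t + 3) * (- 1 - t))) * (- 4 - 2 * t) * (- 4 - 2 * t)
      + psi 2 ((t + 3) * (- 1 - t)) * (- 2)) (at t)"
    by (auto intro!: derivative_eq_intros)
  then show ?thesis by (simp add: profile'_def[abs_def] profile''_def power2_eq_square mult.assoc mult.commute[of "psi 2 _" 2])
qed

lemma H_support:
  assumes "\<not> (- 3 \<le> t \<and> t \<le> - 1)"
  shows "profile t = 0" "profile' t = 0" "profile'' t = 0"
proof -
  have "(t + 3) * (- 1 - t) \<le> 0" using assms by (auto simp: mult_le_0_iff)
  then show "profile t = 0" "profile' t = 0" "profile'' t = 0" by (simp_all add: profile_def profile'_def profile''_def psi_def)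
qed

lemma psi_continuous_on [continuous_intros]:
  "continuous_on S f \<Longrightarrow> continuous_on S (\<lambda>x. psi m (f x))"
proof -
  have "continuous_on UNIV (psi m)"
    using psi_has_derivative DERIV_isCont by (intro continuous_at_imp_continuous_on) blast
  then show "continuous_on S f \<Longrightarrow> continuous_on S (\<lambda>x. psi m (f x))"
    by (rule continuous_on_compose2) auto
qed

lemma continuous_on_H: "continuous_on S profile" "continuous_on S profile'" "continuous_on S profile''"
  unfolding profile_def[abs_def] profile'_def[abs_def] profile''_def[abs_def] by (intro continuous_intros)+

lemma continuous_square_bounds:
  fixes h :: "real \<Rightarrow> real"
  assumes "continuous_on {a..b} h" "a \<le> b"
  shows "\<exists>M. \<forall>t\<in>{a..b}. (h t)\<^sup>2 \<le> M"
proof -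
  have "continuous_on {a..b} (\<lambda>t. (h t)\<^sup>2)" using assms by (intro continuous_intros)
  then show ?thesis
    using continuous_attains_sup[of "{a..b}" "\<lambda>t. (h t)\<^sup>2"] assms(2) by auto
qed

lemma continuous_square_lower:
  fixes h :: "real \<Rightarrow> real"
  assumes "continuous_on {a..b} h" "a \<le> b" "\<And>t. a \<le> t \<Longrightarrow> t \<le> b \<Longrightarrow> h t \<noteq> 0"
  shows "\<exists>\<beta>>0. \<forall>t\<in>{a..b}. (h t)\<^sup>2 \<ge> \<beta>"
proof -
  have "continuous_on {a..b} (\<lambda>t. (h t)\<^sup>2)" using assms by (intro continuous_intros)
  then obtain c where c: "c \<in> {a..b}" "\<forall>t\<in>{a..b}. (h c)\<^sup>2 \<le> (h t)\<^sup>2"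
    using continuous_attains_inf[of "{a..b}" "\<lambda>t. (h t)\<^sup>2"] assms(2) by auto
  then show ?thesis using assms(3)[of c] by (intro exI[of _ "(h c)\<^sup>2"]) auto
qed

lemma profile_bounds:
  obtains B \<beta> where "\<beta> > 0" "\<And>t. (profile' t)\<^sup>2 \<le> B" "\<And>t. (profile'' t)\<^sup>2 \<le> B"
    "\<And>t. - 7/4 \<le> t \<Longrightarrow> t \<le> - 3/2 \<Longrightarrow> (profile t)\<^sup>2 \<ge> \<beta>"
    "\<And>t. - 7/4 \<le> t \<Longrightarrow> t \<le> - 3/2 \<Longrightarrow> (profile' t)\<^sup>2 \<ge> \<beta>"
proof -
  obtain M1 where M1: "\<forall>t\<in>{-3..-1}. (profile' t)\<^sup>2 \<le> M1"
    using continuous_square_bounds[of "-3" "-1" profile'] continuous_on_H by auto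
  obtain M2 where M2: "\<forall>t\<in>{-3..-1}. (profile'' t)\<^sup>2 \<le> M2"
    using continuous_square_bounds[of "-3" "-1" profile''] continuous_on_H by auto
  \<comment> \<open>The interval [-7/4, -3/2] lies inside (-3, -1) and avoids the critical point -2,
    so neither the profile nor its derivative vanishes there.\<close>
  have nz: "profile t \<noteq> 0" "profile' t \<noteq> 0" if "- 7/4 \<le> t" "t \<le> - 3/2" for t :: real
  proof -
    have "(t + 3) * (- 1 - t) > 0" using that by (intro mult_pos_pos) auto
    then show "profile t \<noteq> 0" "profile' t \<noteq> 0" using that by (simp_all add: profile_def profile'_def psi_def)
  qed
  obtain b0 where b0: "b0 > 0" "\<forall>t\<in>{-7/4..-3/2}. (profile t)\<^sup>2 \<ge> b0"
    using continuous_square_lower[of "-7/4" "-3/2" profile, OF continuous_on_H(1) _ nz(1)] by auto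
  obtain b1 where b1: "b1 > 0" "\<forall>t\<in>{-7/4..-3/2}. (profile' t)\<^sup>2 \<ge> b1"
    using continuous_square_lower[of "-7/4" "-3/2" profile', OF continuous_on_H(2) _ nz(2)] by auto
  show thesis
  proof (rule that[of "min b0 b1" "max 0 (max M1 M2)"])
    show "(profile' t)\<^sup>2 \<le> max 0 (max M1 M2)" for t
      using M1 H_support[of t] by (cases "- 3 \<le> t \<and> t \<le> - 1") (auto simp: le_max_iff_disj)
    show "(profile'' t)\<^sup>2 \<le> max 0 (max M1 M2)" for t
      using M2 H_support[of t] by (cases "- 3 \<le> t \<and> t \<le> - 1") (auto simp: le_max_iff_disj)
  qed (use b0 b1 in \<open>auto intro: min.coboundedI1 min.coboundedI2\<close>)
qed

section \<open>Stretched test functions\<close>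

lemma euler_radial_mult:
  fixes Y :: "real^'n::finite \<Rightarrow> complex"
  assumes Y: "psmooth Y" "\<And>x. x \<noteq> 0 \<Longrightarrow> euler Y x = 0" and g: "psmooth (radial g :: real^'n \<Rightarrow> complex)"
    and d: "\<And>t. (g has_real_derivative g' t) (at t)" and x: "x \<noteq> 0"
  shows "euler (\<lambda>x. radial g x * Y x) x = radial g' x * Y x"
proof -
  have "euler (\<lambda>x. radial g x * Y x) x = euler (radial g) x * Y x + radial g x * euler Y x"
    using Y g x by (intro dir_mult) auto
  then show ?thesis using x by (simp add: Y(2) euler_radial[OF x d]) (simp add: radial_def)
qed

text \<open>For F = profile (c ln |x|) Y each application of E brings out a factor c, so both
  quotients are of order c^2. The bound on E^2 F relative to E F prepares the degenerate case of the
  sharpness proof, where ||E F||^2 is the leading term.\<close>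

lemma slowly_varying_eigenfunctions:
  fixes Y :: "real^'n::finite \<Rightarrow> complex"
  assumes Y: "psmooth Y" "\<And>x. x \<noteq> 0 \<Longrightarrow> euler Y x = 0"
    "\<And>x. x \<noteq> 0 \<Longrightarrow> sph_lap Y x = of_real \<mu> * Y x" "\<And>c x. c > 0 \<Longrightarrow> x \<noteq> 0 \<Longrightarrow> Y (c *\<^sub>R x) = Y x"
    "\<And>c. c > 0 \<Longrightarrow> Y (c *\<^sub>R axis i 1) \<noteq> 0"
    and R: "R > 0" and \<delta>: "\<delta> > 0"
  shows "\<exists>(F :: real^'n \<Rightarrow> complex) r. ptest F \<and> sph_lap F = (\<lambda>x. of_real \<mu> * F x) \<and> r < R \<and> (\<forall>x. F x \<noteq> 0 \<longrightarrow> norm x \<le> r) \<and>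
    ip (euler F) (euler F) \<le> \<delta> * ip F F \<and> ip (euler (euler F)) (euler (euler F)) \<le> \<delta> * ip (euler F) (euler F) \<and> ip (euler F) (euler F) > 0"
proof -
  obtain B \<beta> where \<beta>: "\<beta> > 0" and B: "\<And>t. (profile' t)\<^sup>2 \<le> B" "\<And>t. (profile'' t)\<^sup>2 \<le> B"
    and low: "\<And>t. - 7/4 \<le> t \<Longrightarrow> t \<le> - 3/2 \<Longrightarrow> (profile t)\<^sup>2 \<ge> \<beta>"
    "\<And>t. - 7/4 \<le> t \<Longrightarrow> t \<le> - 3/2 \<Longrightarrow> (profile' t)\<^sup>2 \<ge> \<beta>"
    using profile_bounds by metis
  have B0: "B \<ge> 0" using B(1)[of 0] zero_le_power2 order_trans by blast
  \<comment> \<open>\<open>B\<close> over \<beta> compares squared profiles, and 8 compares the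
    masses of the outer and inner shells in \<open>M\<close>.\<close>
  define \<kappa> where "\<kappa> = 8 * B / \<beta>"
  \<comment> \<open>The three bounds serve N \<le> N^2, exp (- N) < R and \<kappa> / N^2 \<le>
    \<delta>, respectively.\<close>
  obtain N :: nat where N: "real N > max (max 1 (- ln R)) (\<kappa> / \<delta>)" using reals_Archimedean2 by blast
  define c where "c = 1 / real N"
  have N1: "real N > 1" "real N > - ln R" "real N > \<kappa> / \<delta>" using N by auto
  have c: "c > 0" "c * real N = 1" using N1 by (auto simp: c_def)
  have \<kappa>c: "c\<^sup>2 * \<kappa> \<le> \<delta>"
  proof -
    have "\<kappa> \<le> real N * \<delta>" using N1(3) \<delta> by (simp add: field_simps)
    also have "\<dots> \<le> real N * real N * \<delta>" using N1(1) \<delta> by (intro mult_right_mono) auto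
    finally show ?thesis using N1(1) by (simp add: c_def field_simps power2_eq_square)
  qed
  define f0 f1 f2 where "f0 t = profile (c * t)" and "f1 t = c * profile' (c * t)" and "f2 t = c\<^sup>2 * profile'' (c * t)" for t
  have f0: "f0 = bump (- 3) (- 1) c" by (simp add: fun_eq_iff f0_def profile_def bump_def)
  have cder: "((\<lambda>t. c * t) has_real_derivative c) (at t)" for t by (auto intro!: derivative_eq_intros)
  have d0: "(f0 has_real_derivative f1 t) (at t)" for t
  proof -
    have "f1 t = profile' (c * t) * c" by (simp add: f1_def)
    then show ?thesis using DERIV_chain2[OF profile_deriv cder, of t] by (simp only: f0_def[abs_def])
  qed
  have d1: "(f1 has_real_derivative f2 t) (at t)" for t
  proof -
    have "f2 t = c * (profile'' (c * t) * c)" by (simp add: f2_def power2_eq_square)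
    then show ?thesis using DERIV_cmult[OF DERIV_chain2[OF profile'_deriv cder], of c t] by (simp only: f1_def[abs_def])
  qed
  define F where "F x = radial f0 x * Y x" for x
  have rt: "rtest (radial f0 :: real^'n \<Rightarrow> complex)" unfolding f0 using c by (intro rtest_radial_bump) auto
  then have r0: "ptest (radial f0 :: real^'n \<Rightarrow> complex)" by (simp add: rtest_def)
  have F: "ptest F" unfolding F_def[abs_def] using r0 Y(1) by auto
  \<comment> \<open>\<open>radial f1\<close> is the Euler derivative of \<open>radial f0\<close>, so
    it inherits smoothness and support; \<open>r2\<close> repeats this once more.\<close>
  have r1: "ptest (radial f1 :: real^'n \<Rightarrow> complex)"
  proof -
    have "euler (radial f0) x = radial f1 x" for x :: "real^'n"
    proof (cases "x = 0")
      case True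
      have "ptest (euler (radial f0 :: real^'n \<Rightarrow> complex))" using r0 by auto
      then show ?thesis using True by (simp add: radial_def)
    qed (simp add: euler_radial[OF _ d0], simp add: radial_def)
    then have "euler (radial f0) = (radial f1 :: real^'n \<Rightarrow> complex)" by (rule ext)
    then show ?thesis using ptest_euler[OF r0] by simp
  qed
  have r2: "ptest (radial f2 :: real^'n \<Rightarrow> complex)"
  proof -
    have "euler (radial f1) x = radial f2 x" for x :: "real^'n"
    proof (cases "x = 0")
      case True
      have "ptest (euler (radial f1 :: real^'n \<Rightarrow> complex))" using r1 by auto
      then show ?thesis using True by (simp add: radial_def)
    qed (simp add: euler_radial[OF _ d1], simp add: radial_def)
    then have "euler (radial f1) = (radial f2 :: real^'n \<Rightarrow> complex)" by (rule ext)
    then show ?thesis using ptest_euler[OF r1] by simp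
  qed
  have E1: "euler F = (\<lambda>x. radial f1 x * Y x)"
    using euler_radial_mult[OF Y(1,2) ptest_psmooth[OF r0] d0] F r1 Y(1) unfolding F_def[abs_def]
    by (intro ptest_eq_zero_at_0I) auto
  have E2: "euler (euler F) = (\<lambda>x. radial f2 x * Y x)"
    using euler_radial_mult[OF Y(1,2) ptest_psmooth[OF r1] d1] r1 r2 Y(1) unfolding E1
    by (intro ptest_eq_zero_at_0I) auto
  have L: "sph_lap F = (\<lambda>x. of_real \<mu> * F x)"
  proof (rule ptest_eq_zero_at_0I)
    fix x :: "real^'n" assume x: "x \<noteq> 0"
    have "sph_lap F x = radial f0 x * sph_lap Y x"
      unfolding F_def[abs_def] using rt Y(1) x by (intro sph_lap_radial_mult) (auto simp: rtest_def)
    then show "sph_lap F x = of_real \<mu> * F x" using x by (simp add: Y(3) F_def)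
  qed (use F in auto)
  \<comment> \<open>The outer shell has logarithmic length 2 N and the inner one N / 4, so eight
    copies suffice. The inner shell corresponds to [-7/4, -3/2], where the profile and its
    derivative are bounded below.\<close>
  have M: "shell_mass Y (- 3 * N) (- N) \<le> 8 * shell_mass Y (- 7/4 * N) (- 3/2 * N)"
  proof -
    have "shell_mass Y (- 3 * N) (- 3 * N + real (Suc 7) * (N / 4)) \<le> real (Suc 7) * shell_mass Y (- 3 * N) (- 3 * N + N / 4)"
      by (rule shell_mass_multiple[OF Y(1,4)])
    also have "shell_mass Y (- 3 * N) (- 3 * N + N / 4) = shell_mass Y (- 7/4 * N) (- 3/2 * N)"
      using shell_mass_shift[OF Y(1,4), of "- 3 * N" "5/4 * N" "- 3 * N + N / 4"] by (simp add: algebra_simps)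
    finally show ?thesis by simp
  qed
  have inner: "- 7/4 \<le> c * t \<and> c * t \<le> - 3/2" if "- 7/4 * N \<le> t" "t \<le> - 3/2 * N" for t :: real
    using that N1(1) by (simp add: c_def field_simps)
  have outer: "\<not> (- 3 \<le> c * t \<and> c * t \<le> - 1)" if "\<not> (- 3 * N \<le> t \<and> t \<le> - N)" for t :: real
    using that N1(1) by (auto simp: c_def field_simps)
  have e1: "ip (euler F) (euler F) \<le> \<delta> * ip F F"
  proof -
    have "ip (euler F) (euler F) \<le> (c\<^sup>2 * B) * shell_mass Y (- 3 * N) (- N)"
      unfolding E1 using r1 Y(1) B outer H_support
      by (intro radial_ip_le) (auto simp: f1_def power_mult_distrib intro!: mult_left_mono)
    also have "\<dots> \<le> (c\<^sup>2 * B) * (8 * shell_mass Y (- 7/4 * N) (- 3/2 * N))"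
      using M B0 by (intro mult_left_mono) auto
    also have "\<dots> = (c\<^sup>2 * \<kappa>) * (\<beta> * shell_mass Y (- 7/4 * N) (- 3/2 * N))"
      using \<beta> by (simp add: \<kappa>_def)
    also have "\<dots> \<le> \<delta> * (\<beta> * shell_mass Y (- 7/4 * N) (- 3/2 * N))"
      using \<kappa>c \<beta> shell_mass_nonneg by (intro mult_right_mono mult_nonneg_nonneg) auto
    also have "\<dots> \<le> \<delta> * ip F F"
      unfolding F_def[abs_def] using r0 Y(1) \<delta> low(1) inner
      by (intro mult_left_mono radial_ip_ge) (auto simp: f0_def)
    finally show ?thesis .
  qed
  have e2: "ip (euler (euler F)) (euler (euler F)) \<le> \<delta> * ip (euler F) (euler F)"
  proof -
    have "ip (euler (euler F)) (euler (euler F)) \<le> (c\<^sup>2 * c\<^sup>2 * B) * shell_mass Y (- 3 * N) (- N)"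
      unfolding E2 using r2 Y(1) B outer H_support
      by (intro radial_ip_le) (auto simp: f2_def power_mult_distrib power2_eq_square[of "c\<^sup>2"] intro!: mult_left_mono)
    also have "\<dots> \<le> (c\<^sup>2 * c\<^sup>2 * B) * (8 * shell_mass Y (- 7/4 * N) (- 3/2 * N))"
      using M B0 by (intro mult_left_mono) auto
    also have "\<dots> = (c\<^sup>2 * \<kappa>) * ((c\<^sup>2 * \<beta>) * shell_mass Y (- 7/4 * N) (- 3/2 * N))"
      using \<beta> by (simp add: \<kappa>_def)
    also have "\<dots> \<le> \<delta> * ((c\<^sup>2 * \<beta>) * shell_mass Y (- 7/4 * N) (- 3/2 * N))"
      using \<kappa>c \<beta> shell_mass_nonneg by (intro mult_right_mono mult_nonneg_nonneg) auto
    also have "\<dots> \<le> \<delta> * ip (euler F) (euler F)"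
      unfolding E1 using r1 Y(1) \<delta> low(2) inner
      by (intro mult_left_mono radial_ip_ge) (auto simp: f1_def power_mult_distrib intro!: mult_left_mono)
    finally show ?thesis .
  qed
  have e3: "ip (euler F) (euler F) > 0"
  proof (rule ip_pos)
    show "ptest (euler F)" using F by auto
    \<comment> \<open>Here c ln |x| = -7/4, the left end of the interval on which the derivative of
      the profile is nonzero.\<close>
    let ?x = "exp (- 7/4 * real N) *\<^sub>R (axis i 1 :: real^'n)"
    have "(profile' (- 7/4))\<^sup>2 \<ge> \<beta>" by (rule low(2)) auto
    then have "profile' (- 7/4) \<noteq> 0" using \<beta> by auto
    moreover have "f1 (- 7/4 * real N) = c * profile' (- 7/4)"
    proof -
      have "c * (- 7/4 * real N) = - 7/4 * (c * real N)" by simp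
      then have "c * (- 7/4 * real N) = - 7/4" unfolding c(2) by simp
      then show ?thesis by (simp only: f1_def)
    qed
    ultimately have "f1 (- 7/4 * real N) \<noteq> 0" using c by simp
    then have "radial f1 ?x \<noteq> 0" by (simp add: radial_def axis_eq_0_iff)
    then show "euler F ?x \<noteq> 0" using Y(5)[OF exp_gt_zero] unfolding E1 by simp
  qed
  have supp: "norm x \<le> exp (- real N)" if "F x \<noteq> 0" for x
  proof -
    have "x \<noteq> 0" "f0 (ln (norm x)) \<noteq> 0" using that by (auto simp: F_def radial_def split: if_splits)
    then have "ln (norm x) \<le> - N" using outer[of "ln (norm x)"] H_support(1)[of "c * ln (norm x)"] by (auto simp: f0_def)
    then have "exp (ln (norm x)) \<le> exp (- real N)" by simp
    then show ?thesis using \<open>x \<noteq> 0\<close> by simp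
  qed
  have "exp (- real N) < exp (ln R)" using N1(2) by simp
  then have less: "exp (- real N) < R" using R by simp
  have supp': "\<forall>x. F x \<noteq> 0 \<longrightarrow> norm x \<le> exp (- real N)" using supp by simp
  show ?thesis
    by (rule exI[of _ F], rule exI[of _ "exp (- real N)"]) (intro conjI F L less supp' e1 e2 e3)
qed

text \<open>On an eigenfunction the energy identity reads -(C - A) (a^2 + \<mu>) \<open>q0\<close> +
  (a^2 + b^2 - C + 2 \<mu>) \<open>q1\<close> + \<open>q2\<close>. If a^2 + \<mu> > 0, the first
  term dominates. Otherwise a = \<mu> = 0, so A = b^2 and the second term, (A - C)
  \<open>q1\<close>, is negative and dominates \<open>q2\<close>.\<close>

lemma rellich_hardy_fails:
  fixes \<gamma> :: real
  assumes n: "CARD('n::finite) \<ge> 2" and R: "R > 0" and C: "C > A_const CARD('n) \<gamma>"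
  shows "\<exists>f \<in> C0_infinity (ball (0 :: real^'n) R - {0}). rellich_energy \<gamma> f < C * hardy_energy \<gamma> f"
proof -
  define a b where "a = (real CARD('n) + \<gamma> - 4) / 2" and "b = (real CARD('n) - \<gamma>) / 2"
  obtain j where j: "A_const CARD('n) \<gamma> = alpha CARD('n) \<gamma> j" using A_const_attained_least(1) by auto
  define A where "A = A_const CARD('n) \<gamma>"
  define \<mu> where "\<mu> = lam CARD('n) j"
  have \<mu>0: "\<mu> \<ge> 0" unfolding \<mu>_def by (rule lam_nonneg[OF n])
  have j0: "\<mu> = 0 \<Longrightarrow> j = 0" using lam_strict_mono[OF n, of 0 j] by (cases "j = 0") (auto simp: \<mu>_def lam_def)
  have A0: "A = b\<^sup>2" if "j = 0"
    using that j by (simp add: A_def alpha_def b_def power2_eq_square)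
  have Aeq: "(\<mu> + a * b)\<^sup>2 = A * (a\<^sup>2 + \<mu>)"
  proof (cases "j = 0")
    case True
    then show ?thesis using A0 by (simp add: \<mu>_def lam_def power_mult_distrib)
  next
    case False
    then have "a\<^sup>2 + \<mu> > 0" using j0 \<mu>0 by (metis add_nonneg_pos order_le_less zero_le_power2)
    moreover have "A = (a * b + \<mu>)\<^sup>2 / (a\<^sup>2 + \<mu>)"
      using False j by (simp add: A_def alpha_def a_def b_def power_divide \<mu>_def)
    ultimately show ?thesis by (simp add: add.commute)
  qed
  define K where "K = \<bar>a\<^sup>2 + b\<^sup>2 - C + 2 * \<mu>\<bar> + 1"
  \<comment> \<open>The gain per unit of \<open>q0\<close>, or per unit of \<open>q1\<close> in the
    degenerate case. The choice of \<delta> keeps the error K \<delta> within half of it.\<close>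
  define \<eta> where "\<eta> = (C - A) * (if a\<^sup>2 + \<mu> > 0 then a\<^sup>2 + \<mu> else 1)"
  have \<eta>: "\<eta> > 0" using C by (auto simp: \<eta>_def A_def)
  define \<delta> where "\<delta> = min 1 (\<eta> / (2 * K))"
  have K: "K \<ge> 1" by (simp add: K_def)
  have \<delta>: "\<delta> > 0" "\<delta> \<le> 1" using \<eta> K by (auto simp: \<delta>_def)
  have "\<delta> \<le> \<eta> / (2 * K)" by (simp add: \<delta>_def)
  then have "K * \<delta> \<le> K * (\<eta> / (2 * K))" using K by (intro mult_left_mono) auto
  then have K\<delta>: "K * \<delta> < \<eta>" using K \<eta> by simp
  have "\<not> card (UNIV :: 'n set) \<le> Suc 0" using n by simp
  then obtain i k :: 'n where ik: "i \<noteq> k" by (auto simp: card_le_Suc0_iff_eq)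
  let ?Y = "harmonic i k j :: real^'n \<Rightarrow> complex"
  have Y5: "?Y (c *\<^sub>R axis i 1) \<noteq> 0" if "c > 0" for c using harmonic_axis[OF ik that] by simp
  have "\<exists>(F :: real^'n \<Rightarrow> complex) r. ptest F \<and> sph_lap F = (\<lambda>x. of_real \<mu> * F x) \<and> r < R \<and> (\<forall>x. F x \<noteq> 0 \<longrightarrow> norm x \<le> r) \<and>
    ip (euler F) (euler F) \<le> \<delta> * ip F F \<and> ip (euler (euler F)) (euler (euler F)) \<le> \<delta> * ip (euler F) (euler F) \<and> ip (euler F) (euler F) > 0"
    by (rule slowly_varying_eigenfunctions[OF psmooth_harmonic euler_harmonic _ harmonic_scale Y5 R \<delta>(1)])
      (simp_all add: sph_lap_harmonic[OF ik] \<mu>_def)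
  then obtain F :: "real^'n \<Rightarrow> complex" and r where F: "ptest F" "sph_lap F = (\<lambda>x. of_real \<mu> * F x)" "r < R" "\<forall>x. F x \<noteq> 0 \<longrightarrow> norm x \<le> r"
    and q: "ip (euler F) (euler F) \<le> \<delta> * ip F F" "ip (euler (euler F)) (euler (euler F)) \<le> \<delta> * ip (euler F) (euler F)" "ip (euler F) (euler F) > 0"
    by (elim exE conjE) (rule that)
  define q0 q1 q2 where "q0 = ip F F" and "q1 = ip (euler F) (euler F)" and "q2 = ip (euler (euler F)) (euler (euler F))"
  define f where "f x = rpow (- a) x * F x" for x
  have f: "ptest f" unfolding f_def[abs_def] using F(1) by auto
  have "f \<in> C0_infinity (ball 0 R - {0})"
    by (rule ptest_imp_C0_infinity[OF f, of r]) (use F in \<open>auto simp: f_def\<close>)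
  moreover have "rellich_energy \<gamma> f - C * hardy_energy \<gamma> f < 0"
  proof -
    have LE: "sph_lap (euler F) = (\<lambda>x. of_real \<mu> * euler F x)"
      using euler_sph_lap_commute[OF F(1)] F(1) unfolding F(2) by (simp add: fun_eq_iff dir_cmult ptest_differentiable)
    have Z: "(\<lambda>x. of_real \<mu> * F x + of_real (a * b) * F x) = (\<lambda>x. of_real (\<mu> + a * b) * F x)"
      by (simp add: fun_eq_iff algebra_simps)
    have "rellich_energy \<gamma> f - C * hardy_energy \<gamma> f =
        (\<mu> + a * b)\<^sup>2 * q0 - C * (a\<^sup>2 * q0 + \<mu> * q0) + (a\<^sup>2 + b\<^sup>2 - C) * q1 + 2 * (\<mu> * q1) + q2"
      using energy_identity[OF F(1), of \<gamma> C] unfolding a_def[symmetric] b_def[symmetric] f_def[abs_def, symmetric] LE F(2) Z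
      by (simp add: ip_cmult_left ip_cmult_right q0_def q1_def q2_def power2_eq_square del: of_real_add of_real_mult)
    also have "\<dots> = - ((C - A) * (a\<^sup>2 + \<mu>) * q0) + (a\<^sup>2 + b\<^sup>2 - C + 2 * \<mu>) * q1 + q2"
      unfolding Aeq by (simp add: algebra_simps)
    finally have D: "rellich_energy \<gamma> f - C * hardy_energy \<gamma> f = \<dots>" .
    have q': "q1 \<le> \<delta> * q0" "q2 \<le> \<delta> * q1" "q1 > 0" using q by (simp_all add: q0_def q1_def q2_def)
    show ?thesis
    proof (cases "a\<^sup>2 + \<mu> > 0")
      case True
      have q0: "q0 > 0" using q'(1,3) \<delta> by (smt (verit) mult_nonneg_nonpos)
      have "q2 \<le> 1 * q1" using q'(2,3) \<delta> mult_right_mono[of \<delta> 1 q1] by linarith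
      moreover have "(a\<^sup>2 + b\<^sup>2 - C + 2 * \<mu>) * q1 \<le> (K - 1) * q1"
        using q'(3) by (intro mult_right_mono) (auto simp: K_def)
      ultimately have "(a\<^sup>2 + b\<^sup>2 - C + 2 * \<mu>) * q1 + q2 \<le> K * q1" by (simp add: algebra_simps)
      also have "\<dots> \<le> K * (\<delta> * q0)" using q'(1) K by (intro mult_left_mono) auto
      also have "\<dots> < \<eta> * q0" using K\<delta> q0 by (simp add: mult.assoc[symmetric])
      finally show ?thesis unfolding D using True by (simp add: \<eta>_def)
    next
      case False
      then have "a\<^sup>2 = 0" "\<mu> = 0" using \<mu>0 zero_le_power2[of a] by linarith+
      then have "rellich_energy \<gamma> f - C * hardy_energy \<gamma> f = (b\<^sup>2 - C) * q1 + q2" unfolding D by simp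
      also have "b\<^sup>2 = A" using A0 j0 \<open>\<mu> = 0\<close> by simp
      also have "(A - C) * q1 + q2 \<le> (A - C + \<delta>) * q1" using q'(2) by (simp add: algebra_simps)
      also have "\<dots> < 0"
      proof -
        have "\<delta> \<le> K * \<delta>" using K \<delta> by simp
        then have "\<delta> < C - A" using K\<delta> False by (simp add: \<eta>_def)
        then show ?thesis using q'(3) by (simp add: mult_neg_pos)
      qed
      finally show ?thesis .
    qed
  qed
  ultimately show ?thesis by force
qed

section \<open>Passage to domains that contain a ball\<close>

lemma vanish_off_domain:
  assumes "f \<in> C0_infinity (U - {0})" "x \<notin> U"
  shows "laplacian f x = 0" "grad f x = 0"
proof -
  let ?W = "- closure {x. f x \<noteq> 0}"
  have W: "open ?W" "x \<in> ?W" using assms by (auto simp: C0_infinity_def)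
  have f: "f y = 0" if "y \<in> ?W" for y
    using that closure_subset[of "{x. f x \<noteq> 0}"] by auto
  have p: "partial_deriv i f y = 0" if "y \<in> ?W" for i y
    unfolding partial_deriv_eq_dir using W(1) that f by (rule dir_zero_open)
  have "partial_deriv i (partial_deriv i f) x = 0" for i
    unfolding partial_deriv_eq_dir[of i "partial_deriv i f"] using W p by (rule dir_zero_open)
  then show "laplacian f x = 0" by (simp add: laplacian_def)
  show "grad f x = 0" using p[OF W(2)] by (simp add: grad_def vec_eq_iff)
qed

text \<open>The derivatives vanish off \<open>U\<close>, so integrating over \<open>U\<close> or
  over the whole space makes no difference.\<close>

lemma rellich_hardy_ineq_iff:
  assumes "f \<in> C0_infinity (U - {0})"
  shows "rellich_hardy_ineq U \<gamma> C f \<longleftrightarrow> C * hardy_energy \<gamma> f \<le> rellich_energy \<gamma> f"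
proof -
  have "(LINT x:U|lborel. norm x powr \<gamma> * (norm (laplacian f x))\<^sup>2) = rellich_energy \<gamma> f"
    unfolding rellich_energy_def set_lebesgue_integral_def
    by (rule Bochner_Integration.integral_cong) (auto simp: indicator_def vanish_off_domain[OF assms])
  moreover have "(LINT x:U|lborel. norm x powr (\<gamma> - 2) * (norm (grad f x))\<^sup>2) = hardy_energy \<gamma> f"
    unfolding hardy_energy_def set_lebesgue_integral_def
    by (rule Bochner_Integration.integral_cong) (auto simp: indicator_def vanish_off_domain[OF assms])
  ultimately show ?thesis by (simp add: rellich_hardy_ineq_def)
qed

text \<open>Treats balls and the whole space together: the inequality is checked after extension by
  zero, and the functions violating a larger constant already live in the ball.\<close>

lemma sharp_rellich_hardy_const_superset_ball:
  assumes n: "CARD('n::finite) \<ge> 2" and R: "R > 0" and U: "ball (0 :: real^'n) R \<subseteq> U"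
  shows "sharp_rellich_hardy_const U \<gamma> (A_const CARD('n) \<gamma>)"
  unfolding sharp_rellich_hardy_const_def
proof (intro conjI ballI allI impI)
  fix f assume f: "f \<in> C0_infinity (U - {0})"
  show "rellich_hardy_ineq U \<gamma> (A_const CARD('n) \<gamma>) f"
    using rellich_hardy_ptest[OF n C0_infinity_imp_ptest[OF f]] rellich_hardy_ineq_iff[OF f] by simp
next
  fix C assume "A_const CARD('n) \<gamma> < C"
  then obtain f where f: "f \<in> C0_infinity (ball (0 :: real^'n) R - {0})" "rellich_energy \<gamma> f < C * hardy_energy \<gamma> f"
    using rellich_hardy_fails[OF n R] by blast
  have "f \<in> C0_infinity (U - {0})" using f(1) U by (auto simp: C0_infinity_def)
  then show "\<exists>f\<in>C0_infinity (U - {0}). \<not> rellich_hardy_ineq U \<gamma> C f"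
    using rellich_hardy_ineq_iff f(2) by (metis not_less)
qed

theorem theoremA6:
  fixes R \<gamma> :: real
  assumes "R > 0"
    and "CARD('n::finite) \<ge> 2"
    and "\<not> (CARD('n) = 2 \<and> \<gamma> = 2)"
    and "\<not> (CARD('n) = 3 \<and> \<gamma> = 1)"
  shows "sharp_rellich_hardy_const (ball (0 :: real^'n) R) \<gamma> (A_const CARD('n) \<gamma>) \<and>
         sharp_rellich_hardy_const (UNIV :: (real^'n) set) \<gamma> (A_const CARD('n) \<gamma>)"
  using sharp_rellich_hardy_const_superset_ball[OF assms(2,1)] by blast

end
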